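(* The opfibration $E\colon\mathbf{CInvMon}\to\mathbf{SLat}$, taking a commutative inverse monoid to its semilattice of idempotents, is equivalent over $\mathbf{SLat}$ to a monoidal opfibration, i.e. to an object of $\mathrm{PsMon}(\mathbf{OpFib})_{\mathbf{SLat}}$, where $\mathbf{SLat}$ and $\mathbf{CInvMon}$ carry their tensor product monoidal structures.
   Context: A commutative inverse monoid is a commutative monoid in which each $x$ has a (unique) $x^*$ with $xx^*x=x$ and $x^*xx^*=x^*$ (equivalently, a commutative Clifford monoid); $\mathbf{CInvMon}$ is the category of these and monoid homomorphisms. $\mathbf{SLat}$ is the category of semilattices (commutative idempotent monoids) and monoid homomorphisms. $E$ sends $M$ to its subset of idempotents under the monoid operation, and acts on homomorphisms by restriction. $\mathbf{CInvMon}$ is monoidal under the tensor product: writing monoids additively, $A\otimes B$ is presented by generators $a\otimes b$ subject to $0\otimes b=0$, $a\otimes 0=0$, $(a+a')\otimes b=a\otimes b+a'\otimes b$, $a\otimes(b+b')=a\otimes b+a\otimes b'$, with unit the free commutative inverse monoid $\mathbb{Z}_0$ on one generator ($\mathbb{Z}$ with an additional identity adjoined). $\mathbf{SLat}$ is monoidal under the analogous tensor product of semilattices, with unit the free semilattice on one generator. A monoidal opfibration is a pseudomonoid in the 2-category $\mathbf{OpFib}$ of opfibrations (with cartesian product); equivalently, an opfibration whose total and base categories are monoidal, whose underlying functor is strict monoidal, and for which the tensor product of the total category preserves opcartesian liftings. $\mathrm{PsMon}(\mathbf{OpFib})_{\mathbf{SLat}}$ consists of those with base the monoidal category $\mathbf{SLat}$.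 "Equivalent over $\mathbf{SLat}$" means there is an equivalence of total categories compatible with the functors to $\mathbf{SLat}$. *)

theory Defs
  imports "HOL-Algebra.Group" "HOL-Library.Multiset" "HOL-Library.Equipollence"
    "HOL-Library.Countable_Set"
begin

section \<open>Categories, functors and natural isomorphisms\<close>

record ('o, 'm) cat =
  Obj :: "'o set"
  Arr :: "'m set"
  Dom :: "'m \<Rightarrow> 'o"
  Cod :: "'m \<Rightarrow> 'o"
  Id :: "'o \<Rightarrow> 'm"
  Comp :: "'m \<Rightarrow> 'm \<Rightarrow> 'm" (infixr \<open>\<cdot>\<index>\<close> 75)

definition Homset :: "('o, 'm, 'x) cat_scheme \<Rightarrow> 'o \<Rightarrow> 'o \<Rightarrow> 'm set" where
  "Homset C x y = {f \<in> Arr C. Dom C f = x \<and> Cod C f = y}"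

locale category =
  fixes C :: "('o, 'm, 'x) cat_scheme" (structure)
  assumes Dom_in_Obj: "f \<in> Arr C \<Longrightarrow> Dom C f \<in> Obj C"
    and Cod_in_Obj: "f \<in> Arr C \<Longrightarrow> Cod C f \<in> Obj C"
    and Id_in_Homset: "x \<in> Obj C \<Longrightarrow> Id C x \<in> Homset C x x"
    and Comp_in_Homset: "f \<in> Homset C x y \<Longrightarrow> g \<in> Homset C y z \<Longrightarrow> g \<cdot> f \<in> Homset C x z"
    and Comp_Id: "f \<in> Homset C x y \<Longrightarrow> f \<cdot> Id C x = f"
    and Id_Comp: "f \<in> Homset C x y \<Longrightarrow> Id C y \<cdot> f = f"
    and Comp_assoc: "f \<in> Homset C w x \<Longrightarrow> g \<in> Homset C x y \<Longrightarrow> h \<in> Homset C y z \<Longrightarrow>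
      (h \<cdot> g) \<cdot> f = h \<cdot> (g \<cdot> f)"

definition is_iso :: "('o, 'm, 'x) cat_scheme \<Rightarrow> 'm \<Rightarrow> bool" where
  "is_iso C f \<longleftrightarrow> f \<in> Arr C \<and> (\<exists>g \<in> Homset C (Cod C f) (Dom C f).
     g \<cdot>\<^bsub>C\<^esub> f = Id C (Dom C f) \<and> f \<cdot>\<^bsub>C\<^esub> g = Id C (Cod C f))"

definition Isoset :: "('o, 'm, 'x) cat_scheme \<Rightarrow> 'o \<Rightarrow> 'o \<Rightarrow> 'm set" where
  "Isoset C x y = {f \<in> Homset C x y. is_iso C f}"

record ('o, 'm, 'p, 'n) ftr =
  obj_map :: "'o \<Rightarrow> 'p"
  arr_map :: "'m \<Rightarrow> 'n"

locale is_functor = dom: category C + cod: category D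
  for C :: "('o, 'm, 'x) cat_scheme" and D :: "('p, 'n, 'y) cat_scheme" +
  fixes F :: "('o, 'm, 'p, 'n) ftr"
  assumes obj_map_in_Obj: "x \<in> Obj C \<Longrightarrow> obj_map F x \<in> Obj D"
    and arr_map_in_Homset:
      "f \<in> Homset C x y \<Longrightarrow> arr_map F f \<in> Homset D (obj_map F x) (obj_map F y)"
    and arr_map_Id: "x \<in> Obj C \<Longrightarrow> arr_map F (Id C x) = Id D (obj_map F x)"
    and arr_map_Comp: "f \<in> Homset C x y \<Longrightarrow> g \<in> Homset C y z \<Longrightarrow>
      arr_map F (g \<cdot>\<^bsub>C\<^esub> f) = arr_map F g \<cdot>\<^bsub>D\<^esub> arr_map F f"

definition id_ftr :: "('o, 'm, 'o, 'm) ftr" where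
  "id_ftr = \<lparr>obj_map = (\<lambda>x. x), arr_map = (\<lambda>f. f)\<rparr>"

definition comp_ftr ::
    "('p, 'n, 'q, 'k) ftr \<Rightarrow> ('o, 'm, 'p, 'n) ftr \<Rightarrow> ('o, 'm, 'q, 'k) ftr" where
  "comp_ftr G F = \<lparr>obj_map = obj_map G \<circ> obj_map F, arr_map = arr_map G \<circ> arr_map F\<rparr>"

text \<open>Functors are total functions on the underlying types, so two functors out of \<open>C\<close> are
  identified when they agree on the objects and arrows of \<open>C\<close>.\<close>

definition ftr_eq ::
    "('o, 'm, 'x) cat_scheme \<Rightarrow> ('o, 'm, 'p, 'n) ftr \<Rightarrow> ('o, 'm, 'p, 'n) ftr \<Rightarrow> bool" where
  "ftr_eq C F G \<longleftrightarrow>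
     (\<forall>x \<in> Obj C. obj_map F x = obj_map G x) \<and> (\<forall>f \<in> Arr C. arr_map F f = arr_map G f)"

definition natural_iso ::
    "('o, 'm, 'x) cat_scheme \<Rightarrow> ('p, 'n, 'y) cat_scheme \<Rightarrow> ('o, 'm, 'p, 'n) ftr \<Rightarrow>
     ('o, 'm, 'p, 'n) ftr \<Rightarrow> ('o \<Rightarrow> 'n) \<Rightarrow> bool" where
  "natural_iso C D F G \<tau> \<longleftrightarrow>
     (\<forall>x \<in> Obj C. \<tau> x \<in> Isoset D (obj_map F x) (obj_map G x)) \<and>
     (\<forall>f \<in> Arr C. \<tau> (Cod C f) \<cdot>\<^bsub>D\<^esub> arr_map F f = arr_map G f \<cdot>\<^bsub>D\<^esub> \<tau> (Dom C f))"

section \<open>Monoidal categories\<close>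

record ('o, 'm) monoidal_cat = "('o, 'm) cat" +
  ten_obj :: "'o \<Rightarrow> 'o \<Rightarrow> 'o" (infixr \<open>\<odot>\<index>\<close> 80)
  ten_arr :: "'m \<Rightarrow> 'm \<Rightarrow> 'm" (infixr \<open>\<otimes>\<^sub>m\<index>\<close> 80)
  ten_unit :: "'o" (\<open>\<I>\<index>\<close>)
  assoc :: "'o \<Rightarrow> 'o \<Rightarrow> 'o \<Rightarrow> 'm"
  lunit :: "'o \<Rightarrow> 'm"
  runit :: "'o \<Rightarrow> 'm"

locale monoidal_category = category V
  for V :: "('o, 'm, 'x) monoidal_cat_scheme" (structure) +
  assumes ten_obj_in_Obj: "x \<in> Obj V \<Longrightarrow> y \<in> Obj V \<Longrightarrow> x \<odot> y \<in> Obj V"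
    and ten_arr_in_Homset: "f \<in> Homset V x x' \<Longrightarrow> g \<in> Homset V y y' \<Longrightarrow>
      f \<otimes>\<^sub>m g \<in> Homset V (x \<odot> y) (x' \<odot> y')"
    and ten_arr_Id: "x \<in> Obj V \<Longrightarrow> y \<in> Obj V \<Longrightarrow> Id V x \<otimes>\<^sub>m Id V y = Id V (x \<odot> y)"
    and ten_arr_Comp: "f \<in> Homset V x x' \<Longrightarrow> f' \<in> Homset V x' x'' \<Longrightarrow>
      g \<in> Homset V y y' \<Longrightarrow> g' \<in> Homset V y' y'' \<Longrightarrow>
      (f' \<cdot> f) \<otimes>\<^sub>m (g' \<cdot> g) = (f' \<otimes>\<^sub>m g') \<cdot> (f \<otimes>\<^sub>m g)"
    and ten_unit_in_Obj: "\<I> \<in> Obj V"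
    and assoc_in_Isoset: "x \<in> Obj V \<Longrightarrow> y \<in> Obj V \<Longrightarrow> z \<in> Obj V \<Longrightarrow>
      assoc V x y z \<in> Isoset V ((x \<odot> y) \<odot> z) (x \<odot> (y \<odot> z))"
    and assoc_natural:
      "f \<in> Homset V x x' \<Longrightarrow> g \<in> Homset V y y' \<Longrightarrow> h \<in> Homset V z z' \<Longrightarrow>
      assoc V x' y' z' \<cdot> ((f \<otimes>\<^sub>m g) \<otimes>\<^sub>m h) = (f \<otimes>\<^sub>m (g \<otimes>\<^sub>m h)) \<cdot> assoc V x y z"
    and lunit_in_Isoset: "x \<in> Obj V \<Longrightarrow> lunit V x \<in> Isoset V (\<I> \<odot> x) x"
    and lunit_natural:
      "f \<in> Homset V x x' \<Longrightarrow> lunit V x' \<cdot> (Id V \<I> \<otimes>\<^sub>m f) = f \<cdot> lunit V x"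
    and runit_in_Isoset: "x \<in> Obj V \<Longrightarrow> runit V x \<in> Isoset V (x \<odot> \<I>) x"
    and runit_natural:
      "f \<in> Homset V x x' \<Longrightarrow> runit V x' \<cdot> (f \<otimes>\<^sub>m Id V \<I>) = f \<cdot> runit V x"
    and pentagon:
      "w \<in> Obj V \<Longrightarrow> x \<in> Obj V \<Longrightarrow> y \<in> Obj V \<Longrightarrow> z \<in> Obj V \<Longrightarrow>
      assoc V w x (y \<odot> z) \<cdot> assoc V (w \<odot> x) y z =
      (Id V w \<otimes>\<^sub>m assoc V x y z) \<cdot> assoc V w (x \<odot> y) z \<cdot> (assoc V w x y \<otimes>\<^sub>m Id V z)"
    and triangle: "x \<in> Obj V \<Longrightarrow> y \<in> Obj V \<Longrightarrow>
      (Id V x \<otimes>\<^sub>m lunit V y) \<cdot> assoc V x \<I> y = runit V x \<otimes>\<^sub>m Id V y"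

locale strict_monoidal_functor =
  dom: monoidal_category V + cod: monoidal_category W + is_functor V W F
  for V :: "('o, 'm, 'x) monoidal_cat_scheme" and W :: "('p, 'n, 'y) monoidal_cat_scheme"
    and F :: "('o, 'm, 'p, 'n) ftr" +
  assumes strict_ten_obj: "x \<in> Obj V \<Longrightarrow> y \<in> Obj V \<Longrightarrow>
      obj_map F (x \<odot>\<^bsub>V\<^esub> y) = obj_map F x \<odot>\<^bsub>W\<^esub> obj_map F y"
    and strict_ten_arr: "f \<in> Arr V \<Longrightarrow> g \<in> Arr V \<Longrightarrow>
      arr_map F (f \<otimes>\<^sub>m\<^bsub>V\<^esub> g) = arr_map F f \<otimes>\<^sub>m\<^bsub>W\<^esub> arr_map F g"
    and strict_unit: "obj_map F \<I>\<^bsub>V\<^esub> = \<I>\<^bsub>W\<^esub>"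
    and strict_assoc: "x \<in> Obj V \<Longrightarrow> y \<in> Obj V \<Longrightarrow> z \<in> Obj V \<Longrightarrow>
      arr_map F (assoc V x y z) = assoc W (obj_map F x) (obj_map F y) (obj_map F z)"
    and strict_lunit: "x \<in> Obj V \<Longrightarrow> arr_map F (lunit V x) = lunit W (obj_map F x)"
    and strict_runit: "x \<in> Obj V \<Longrightarrow> arr_map F (runit V x) = runit W (obj_map F x)"

locale strong_monoidal_functor =
  dom: monoidal_category V + cod: monoidal_category W + is_functor V W F
  for V :: "('o, 'm, 'x) monoidal_cat_scheme" and W :: "('p, 'n, 'y) monoidal_cat_scheme"
    and F :: "('o, 'm, 'p, 'n) ftr" +
  fixes \<phi> :: "'o \<Rightarrow> 'o \<Rightarrow> 'n" and \<phi>\<^sub>0 :: "'n"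
  assumes phi_in_Isoset: "x \<in> Obj V \<Longrightarrow> y \<in> Obj V \<Longrightarrow>
      \<phi> x y \<in> Isoset W (obj_map F x \<odot>\<^bsub>W\<^esub> obj_map F y) (obj_map F (x \<odot>\<^bsub>V\<^esub> y))"
    and phi_natural: "f \<in> Homset V x x' \<Longrightarrow> g \<in> Homset V y y' \<Longrightarrow>
      \<phi> x' y' \<cdot>\<^bsub>W\<^esub> (arr_map F f \<otimes>\<^sub>m\<^bsub>W\<^esub> arr_map F g) = arr_map F (f \<otimes>\<^sub>m\<^bsub>V\<^esub> g) \<cdot>\<^bsub>W\<^esub> \<phi> x y"
    and phi0_in_Isoset: "\<phi>\<^sub>0 \<in> Isoset W \<I>\<^bsub>W\<^esub> (obj_map F \<I>\<^bsub>V\<^esub>)"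
    and phi_assoc: "x \<in> Obj V \<Longrightarrow> y \<in> Obj V \<Longrightarrow> z \<in> Obj V \<Longrightarrow>
      arr_map F (assoc V x y z) \<cdot>\<^bsub>W\<^esub> \<phi> (x \<odot>\<^bsub>V\<^esub> y) z \<cdot>\<^bsub>W\<^esub> (\<phi> x y \<otimes>\<^sub>m\<^bsub>W\<^esub> Id W (obj_map F z)) =
      \<phi> x (y \<odot>\<^bsub>V\<^esub> z) \<cdot>\<^bsub>W\<^esub> (Id W (obj_map F x) \<otimes>\<^sub>m\<^bsub>W\<^esub> \<phi> y z) \<cdot>\<^bsub>W\<^esub>
        assoc W (obj_map F x) (obj_map F y) (obj_map F z)"
    and phi_lunit: "x \<in> Obj V \<Longrightarrow>
      arr_map F (lunit V x) \<cdot>\<^bsub>W\<^esub> \<phi> \<I>\<^bsub>V\<^esub> x \<cdot>\<^bsub>W\<^esub> (\<phi>\<^sub>0 \<otimes>\<^sub>m\<^bsub>W\<^esub> Id W (obj_map F x)) =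
      lunit W (obj_map F x)"
    and phi_runit: "x \<in> Obj V \<Longrightarrow>
      arr_map F (runit V x) \<cdot>\<^bsub>W\<^esub> \<phi> x \<I>\<^bsub>V\<^esub> \<cdot>\<^bsub>W\<^esub> (Id W (obj_map F x) \<otimes>\<^sub>m\<^bsub>W\<^esub> \<phi>\<^sub>0) =
      runit W (obj_map F x)"

section \<open>Opfibrations\<close>

definition opcartesian ::
    "('o, 'm, 'x) cat_scheme \<Rightarrow> ('p, 'n, 'y) cat_scheme \<Rightarrow> ('o, 'm, 'p, 'n) ftr \<Rightarrow> 'm \<Rightarrow> bool"
  where
  "opcartesian T B P f \<longleftrightarrow> f \<in> Arr T \<and>
     (\<forall>z \<in> Obj T. \<forall>g \<in> Homset T (Dom T f) z.
      \<forall>w \<in> Homset B (obj_map P (Cod T f)) (obj_map P z). w \<cdot>\<^bsub>B\<^esub> arr_map P f = arr_map P g \<longrightarrow>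
        (\<exists>!h. h \<in> Homset T (Cod T f) z \<and> arr_map P h = w \<and> h \<cdot>\<^bsub>T\<^esub> f = g))"

locale opfibration = is_functor T B P
  for T :: "('o, 'm, 'x) cat_scheme" and B :: "('p, 'n, 'y) cat_scheme"
    and P :: "('o, 'm, 'p, 'n) ftr" +
  assumes opcartesian_lift:
    "x \<in> Obj T \<Longrightarrow> u \<in> Arr B \<Longrightarrow> Dom B u = obj_map P x \<Longrightarrow>
     \<exists>f. opcartesian T B P f \<and> Dom T f = x \<and> arr_map P f = u"

locale monoidal_opfibration = strict_monoidal_functor T B P + opfibration T B P
  for T :: "('o, 'm, 'x) monoidal_cat_scheme" and B :: "('p, 'n, 'y) monoidal_cat_scheme"
    and P :: "('o, 'm, 'p, 'n) ftr" +
  assumes opcartesian_ten_arr: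
    "opcartesian T B P f \<Longrightarrow> opcartesian T B P g \<Longrightarrow> opcartesian T B P (f \<otimes>\<^sub>m\<^bsub>T\<^esub> g)"

text \<open>Equivalence between \<open>P : T \<rightarrow> B\<close> and \<open>Q : C \<rightarrow> B\<close> in the slice 2-category over \<open>B\<close>: the
  triangles commute strictly, and the invertible 2-cells lie over identities of \<open>B\<close>.\<close>

definition equivalence_over ::
    "('p, 'n, 'y) cat_scheme \<Rightarrow> ('o, 'm, 'x) cat_scheme \<Rightarrow> ('o, 'm, 'p, 'n) ftr \<Rightarrow>
     ('q, 'k, 'z) cat_scheme \<Rightarrow> ('q, 'k, 'p, 'n) ftr \<Rightarrow> ('o, 'm, 'q, 'k) ftr \<Rightarrow> bool" where
  "equivalence_over B T P C Q F \<longleftrightarrow>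
     is_functor T B P \<and> is_functor C B Q \<and>
     is_functor T C F \<and> ftr_eq T (comp_ftr Q F) P \<and>
     (\<exists>G \<eta> \<epsilon>. is_functor C T G \<and> ftr_eq C (comp_ftr P G) Q \<and>
        natural_iso T T id_ftr (comp_ftr G F) \<eta> \<and>
        natural_iso C C (comp_ftr F G) id_ftr \<epsilon> \<and>
        (\<forall>x \<in> Obj T. arr_map P (\<eta> x) = Id B (obj_map P x)) \<and>
        (\<forall>y \<in> Obj C. arr_map Q (\<epsilon> y) = Id B (obj_map Q y)))"

section \<open>Small monoids\<close>

text \<open>A type \<open>'u\<close> plays the role of a universe of sets: a set is small if it has smaller
  cardinality than \<open>'u\<close>, and small structures are taken with carrier inside \<open>'u\<close>. If the cardinality
  of \<open>'u\<close> is inaccessible, every set that is small in the sense of the corresponding Grothendieck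
  universe is in bijection with such a carrier.

  The operation of an object is required to be \<open>undefined\<close> off the carrier, so that equality of
  objects is equality of monoids.\<close>

definition small_monoid :: "'u monoid \<Rightarrow> bool" where
  "small_monoid M \<longleftrightarrow> carrier M \<prec> (UNIV :: 'u set) \<and>
     (\<forall>x y. x \<notin> carrier M \<or> y \<notin> carrier M \<longrightarrow> x \<otimes>\<^bsub>M\<^esub> y = undefined)"

definition comm_inv_monoid :: "('a, 'x) monoid_scheme \<Rightarrow> bool" where
  "comm_inv_monoid M \<longleftrightarrow> comm_monoid M \<and>
     (\<forall>x \<in> carrier M. \<exists>!y. y \<in> carrier M \<and>
        x \<otimes>\<^bsub>M\<^esub> y \<otimes>\<^bsub>M\<^esub> x = x \<and> y \<otimes>\<^bsub>M\<^esub> x \<otimes>\<^bsub>M\<^esub> y = y)"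

definition semilattice_monoid :: "('a, 'x) monoid_scheme \<Rightarrow> bool" where
  "semilattice_monoid M \<longleftrightarrow> comm_monoid M \<and> (\<forall>x \<in> carrier M. x \<otimes>\<^bsub>M\<^esub> x = x)"

definition monoid_hom :: "('a, 'x) monoid_scheme \<Rightarrow> ('b, 'y) monoid_scheme \<Rightarrow> ('a \<Rightarrow> 'b) set" where
  "monoid_hom M N = {h \<in> hom M N \<inter> extensional (carrier M). h \<one>\<^bsub>M\<^esub> = \<one>\<^bsub>N\<^esub>}"

record 'u mon_arr =
  src :: "'u monoid"
  tgt :: "'u monoid"
  fun_of :: "'u \<Rightarrow> 'u"

section \<open>The tensor product\<close>

text \<open>The words in the generators \<open>a \<otimes> b\<close> are finite multisets of pairs, that is, elements of the
  free commutative monoid on the pairs; \<open>ten_rel A B\<close> is the congruence generated by the defining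
  relations. The presentation may be read in commutative monoids, in commutative inverse monoids or
  in semilattices, without change: modulo these relations \<open>a* \<otimes> b\<close> is an inverse of \<open>a \<otimes> b\<close> if \<open>a*\<close>
  is an inverse of \<open>a\<close>, and \<open>a \<otimes> b\<close> is idempotent if \<open>a\<close> is. So the quotient already lies in
  the smaller variety and is the tensor product there.\<close>

abbreviation ten_words ::
    "('a, 'x) monoid_scheme \<Rightarrow> ('b, 'y) monoid_scheme \<Rightarrow> ('a \<times> 'b) multiset set" where
  "ten_words A B \<equiv> {m. set_mset m \<subseteq> carrier A \<times> carrier B}"

inductive ten_rel ::
    "('a, 'x) monoid_scheme \<Rightarrow> ('b, 'y) monoid_scheme \<Rightarrow>
     ('a \<times> 'b) multiset \<Rightarrow> ('a \<times> 'b) multiset \<Rightarrow> bool"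
  for A B where
  unit_left: "b \<in> carrier B \<Longrightarrow> ten_rel A B {#(\<one>\<^bsub>A\<^esub>, b)#} {#}"
| unit_right: "a \<in> carrier A \<Longrightarrow> ten_rel A B {#(a, \<one>\<^bsub>B\<^esub>)#} {#}"
| mult_left: "a \<in> carrier A \<Longrightarrow> a' \<in> carrier A \<Longrightarrow> b \<in> carrier B \<Longrightarrow>
    ten_rel A B {#(a \<otimes>\<^bsub>A\<^esub> a', b)#} {#(a, b), (a', b)#}"
| mult_right: "a \<in> carrier A \<Longrightarrow> b \<in> carrier B \<Longrightarrow> b' \<in> carrier B \<Longrightarrow>
    ten_rel A B {#(a, b \<otimes>\<^bsub>B\<^esub> b')#} {#(a, b), (a, b')#}"
| refl: "m \<in> ten_words A B \<Longrightarrow> ten_rel A B m m"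
| sym: "ten_rel A B m n \<Longrightarrow> ten_rel A B n m"
| trans: "ten_rel A B m n \<Longrightarrow> ten_rel A B n k \<Longrightarrow> ten_rel A B m k"
| cong: "ten_rel A B m n \<Longrightarrow> ten_rel A B m' n' \<Longrightarrow> ten_rel A B (m + m') (n + n')"

definition ten_class ::
    "('a, 'x) monoid_scheme \<Rightarrow> ('b, 'y) monoid_scheme \<Rightarrow> ('a \<times> 'b) multiset \<Rightarrow>
     ('a \<times> 'b) multiset set" where
  "ten_class A B m = {n. ten_rel A B m n}"

definition ten_quot ::
    "('a, 'x) monoid_scheme \<Rightarrow> ('b, 'y) monoid_scheme \<Rightarrow> ('a \<times> 'b) multiset set monoid" where
  "ten_quot A B = \<lparr>carrier = ten_class A B ` ten_words A B,
     monoid.mult = (\<lambda>X Y. \<Union>m \<in> X. \<Union>n \<in> Y. ten_class A B (m + n)),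
     one = ten_class A B {#}\<rparr>"

text \<open>The quotient does not live in \<open>'u\<close>; it is replaced by an isomorphic copy that does, along a
  chosen injection.\<close>

definition encode :: "('a, 'x) monoid_scheme \<Rightarrow> 'a \<Rightarrow> 'u" where
  "encode M = (SOME e. inj_on e (carrier M))"

definition small_copy :: "('a, 'x) monoid_scheme \<Rightarrow> 'u monoid" where
  "small_copy M = (let e = encode M; d = inv_into (carrier M) e; S = e ` carrier M in
     \<lparr>carrier = S,
      monoid.mult = (\<lambda>x y. if x \<in> S \<and> y \<in> S then e (d x \<otimes>\<^bsub>M\<^esub> d y) else undefined),
      one = e \<one>\<^bsub>M\<^esub>\<rparr>)"

definition tensor :: "'u monoid \<Rightarrow> 'u monoid \<Rightarrow> 'u monoid" where
  "tensor A B = small_copy (ten_quot A B)"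

definition pure :: "'u monoid \<Rightarrow> 'u monoid \<Rightarrow> 'u \<Rightarrow> 'u \<Rightarrow> 'u" where
  "pure A B a b = encode (ten_quot A B) (ten_class A B {#(a, b)#})"

text \<open>The full subcategory on the class \<open>K\<close> of monoids with the tensor product as monoidal
  structure; \<open>U\<close> is the unit, free in \<open>K\<close> on the generator \<open>g\<close>. Homomorphisms out of a tensor
  product are determined by their values on the elements \<open>a \<otimes> b\<close>, those out of \<open>U \<otimes> A\<close> and
  \<open>A \<otimes> U\<close> already by their values on \<open>g \<otimes> a\<close> and \<open>a \<otimes> g\<close>.\<close>

definition tensor_category ::
    "'u monoid set \<Rightarrow> 'u monoid \<Rightarrow> 'u \<Rightarrow> ('u monoid, 'u mon_arr) monoidal_cat" where
  "tensor_category K U g =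
    \<lparr>Obj = K,
     Arr = {f. src f \<in> K \<and> tgt f \<in> K \<and> fun_of f \<in> monoid_hom (src f) (tgt f)},
     Dom = src,
     Cod = tgt,
     Id = (\<lambda>A. \<lparr>src = A, tgt = A, fun_of = restrict (\<lambda>x. x) (carrier A)\<rparr>),
     Comp = (\<lambda>g f. \<lparr>src = src f, tgt = tgt g,
        fun_of = compose (carrier (src f)) (fun_of g) (fun_of f)\<rparr>),
     ten_obj = tensor,
     ten_arr = (\<lambda>f g.
       let A = src f; A' = tgt f; B = src g; B' = tgt g in
       \<lparr>src = tensor A B, tgt = tensor A' B',
        fun_of = (THE h. h \<in> monoid_hom (tensor A B) (tensor A' B') \<and>
          (\<forall>a \<in> carrier A. \<forall>b \<in> carrier B.
             h (pure A B a b) = pure A' B' (fun_of f a) (fun_of g b)))\<rparr>),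
     ten_unit = U,
     assoc = (\<lambda>A B C.
       \<lparr>src = tensor (tensor A B) C, tgt = tensor A (tensor B C),
        fun_of = (THE h. h \<in> monoid_hom (tensor (tensor A B) C) (tensor A (tensor B C)) \<and>
          (\<forall>a \<in> carrier A. \<forall>b \<in> carrier B. \<forall>c \<in> carrier C.
             h (pure (tensor A B) C (pure A B a b) c) =
             pure A (tensor B C) a (pure B C b c)))\<rparr>),
     lunit = (\<lambda>A. \<lparr>src = tensor U A, tgt = A,
        fun_of = (THE h. h \<in> monoid_hom (tensor U A) A \<and>
          (\<forall>a \<in> carrier A. h (pure U A g a) = a))\<rparr>),
     runit = (\<lambda>A. \<lparr>src = tensor A U, tgt = A,
        fun_of = (THE h. h \<in> monoid_hom (tensor A U) A \<and>
          (\<forall>a \<in> carrier A. h (pure A U a g) = a))\<rparr>)\<rparr>"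

section \<open>The categories of commutative inverse monoids and of semilattices\<close>

text \<open>\<open>\<int>\<close> under addition, with \<open>None\<close> adjoined as a new identity; the generator is \<open>Some 1\<close>.\<close>

definition int0 :: "int option monoid" where
  "int0 = \<lparr>carrier = UNIV,
     monoid.mult = (\<lambda>x y. case x of None \<Rightarrow> y | Some m \<Rightarrow>
       (case y of None \<Rightarrow> x | Some n \<Rightarrow> Some (m + n))),
     one = None\<rparr>"

definition CInvMon :: "('u monoid, 'u mon_arr) monoidal_cat" where
  "CInvMon = tensor_category {M. small_monoid M \<and> comm_inv_monoid M}
     (small_copy int0) (encode int0 (Some 1))"

text \<open>The free semilattice on one generator is the two-element one, with generator \<open>True\<close>.\<close>

definition free_slat :: "bool monoid" where
  "free_slat = \<lparr>carrier = UNIV, monoid.mult = (\<or>), one = False\<rparr>"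

definition SLat :: "('u monoid, 'u mon_arr) monoidal_cat" where
  "SLat = tensor_category {M. small_monoid M \<and> semilattice_monoid M}
     (small_copy free_slat) (encode free_slat True)"

definition idempotents :: "('a, 'x) monoid_scheme \<Rightarrow> 'a set" where
  "idempotents M = {x \<in> carrier M. x \<otimes>\<^bsub>M\<^esub> x = x}"

definition idem_monoid :: "'u monoid \<Rightarrow> 'u monoid" where
  "idem_monoid M = \<lparr>carrier = idempotents M,
     monoid.mult = (\<lambda>x y. if x \<in> idempotents M \<and> y \<in> idempotents M then x \<otimes>\<^bsub>M\<^esub> y else undefined),
     one = \<one>\<^bsub>M\<^esub>\<rparr>"

definition E :: "('u monoid, 'u mon_arr, 'u monoid, 'u mon_arr) ftr" where
  "E = \<lparr>obj_map = idem_monoid,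
     arr_map = (\<lambda>f. \<lparr>src = idem_monoid (src f), tgt = idem_monoid (tgt f),
       fun_of = restrict (fun_of f) (idempotents (src f))\<rparr>)\<rparr>"

end

theory Submission
  imports Defs
begin

text \<open>
  A commutative inverse monoid is a semilattice of abelian groups. The pushforward of \<open>M\<close> along
  \<open>v : E(M) \<rightarrow> S\<close> is a quotient of \<open>M \<times> S\<close>, and it is the pushout of \<open>M\<close> and \<open>S\<close> over \<open>E(M)\<close>; so
  \<open>f : M \<rightarrow> N\<close> is opcartesian iff \<open>N\<close> is this pushout (\<open>idem_pushout\<close> below). That opcartesian arrows
  are closed under \<open>\<otimes>\<close> follows from the universal properties alone: a homomorphism out of \<open>A' \<otimes> B'\<close> is
  a bihomomorphism, which is assembled by extending first in the variable from \<open>A\<close> and then in the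
  variable from \<open>B\<close>.

  The map \<open>a \<otimes> b \<mapsto> aa* \<otimes> bb*\<close> gives a canonical isomorphism \<open>E(A \<otimes> B) \<cong> E(A) \<otimes> E(B)\<close>. To turn it
  into an equality, replace each \<open>A \<otimes> B\<close> by an isomorphic copy whose idempotents literally form the
  chosen \<open>E(A) \<otimes> E(B)\<close>, and the unit likewise; there is room outside the idempotents because all
  carriers are smaller than the universe. A universal bihomomorphism is all that the monoidal structure
  needs, so the new choice is again a monoidal structure on the same category, the identity functor
  is strong monoidal by comparison of universal properties, and \<open>E\<close> becomes strict.
\<close>

section \<open>Cardinality\<close>

text \<open>Two facts about idempotents shape the proof. A homomorphism out of a semilattice takes
  idempotent values, so maps \<open>E(N) -> E(Z)\<close> and maps \<open>E(N) -> Z\<close> are the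
  same thing; this is why lifting along \<open>E\<close> is a pushout problem. And the idempotent
  part is a homomorphism \<open>M -> E(M)\<close>, which controls mixed terms: a bihomomorphism
  takes the same value at \<open>(e, b)\<close> as at \<open>e\<close> and the idempotent part of
  \<open>b\<close>, for \<open>e\<close> idempotent. Hence a map prescribed on
  \<open>E(A') \<otimes> E(B')\<close> already dictates all values with one idempotent argument,
  which is what extension one variable at a time requires.

  The obstacle to strictness is that tensor products are encoded in \<open>'u\<close> by arbitrary
  injections, so nothing ties the idempotents of the chosen \<open>A \<otimes> B\<close> to the
  elements of the chosen \<open>E(A) \<otimes> E(B)\<close>.

  Uncountability of \<open>'u\<close> enters through size: the unit \<open>int0\<close> is infinite,
  whereas a countable universe would admit finite carriers only. In an uncountable one, the finite
  multisets over a smaller set again form a smaller set, and removing a smaller set leaves a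
  complement of full size.\<close>

lemma infinite_times_lepoll_self:
  assumes "infinite X"
  shows "X \<times> X \<lesssim> X"
  using card_of_Times_same_infinite[OF assms]
  by (intro eqpoll_imp_lepoll) (simp only: eqpoll_iff_card_of_ordIso)

text \<open>Folding an injection \<open>X \<times> X -> X\<close> over a list turns it into one
  element of \<open>X\<close>. The fold can be undone once the length is known, so length and code
  together determine the list, and \<open>nat\<close> embeds in \<open>X\<close>.\<close>

lemma infinite_lists_lepoll_self:
  assumes "infinite X"
  shows "lists X \<lesssim> X"
proof -
  obtain f where f: "inj_on f (X \<times> X)" "f ` (X \<times> X) \<subseteq> X"
    using infinite_times_lepoll_self[OF assms] unfolding lepoll_def by blast
  obtain x0 where x0: "x0 \<in> X"
    using assms by (metis all_not_in_conv finite.emptyI)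
  define e where "e xs = foldr (\<lambda>x y. f (x, y)) xs x0" for xs
  have eX: "e xs \<in> X" if "xs \<in> lists X" for xs
    using that f(2) x0 by (induction xs) (auto simp: e_def)
  have inj: "xs = ys" if "length xs = length ys" "xs \<in> lists X" "ys \<in> lists X" "e xs = e ys" for xs ys
    using that
  proof (induction xs ys rule: list_induct2)
    case (Cons x xs y ys)
    then have "f (x, e xs) = f (y, e ys)" "x \<in> X" "y \<in> X" "e xs \<in> X" "e ys \<in> X"
      using eX by (auto simp: e_def)
    then have "x = y \<and> e xs = e ys"
      using f(1) by (auto dest: inj_onD)
    with Cons show ?case by auto
  qed simp
  have "lists X \<lesssim> (UNIV :: nat set) \<times> X"
    unfolding lepoll_def
    by (rule exI[of _ "\<lambda>xs. (length xs, e xs)"]) (use eX inj in \<open>auto intro!: inj_onI\<close>)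
  also have "\<dots> \<lesssim> X \<times> X"
    using assms by (intro times_lepoll_mono) (auto simp: infinite_le_lepoll)
  also have "\<dots> \<lesssim> X"
    by (rule infinite_times_lepoll_self[OF assms])
  finally show ?thesis .
qed

lemma countable_lesspoll_uncountable:
  assumes "countable X" "uncountable Y"
  shows "X \<prec> Y"
proof -
  obtain f :: "_ \<Rightarrow> nat" where "inj_on f X"
    using assms(1) unfolding countable_def by blast
  then have "X \<lesssim> (UNIV :: nat set)"
    unfolding lepoll_def by blast
  also have "\<dots> \<lesssim> Y"
    using assms(2) countable_finite[of Y] infinite_le_lepoll[of Y] by blast
  finally show ?thesis
    using assms countable_eqpoll[of X Y] eqpoll_sym[of X Y] unfolding lesspoll_def by blast
qed

lemma lepoll_iff_card_of_ordLeq: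
  includes cardinal_syntax
  shows "X \<lesssim> Y \<longleftrightarrow> |X| \<le>o |Y|"
  by (simp add: lepoll_def card_of_ordLeq)

lemma lesspoll_iff_card_of_ordLess:
  includes cardinal_syntax
  shows "X \<prec> Y \<longleftrightarrow> |X| <o |Y|"
  unfolding lesspoll_def lepoll_iff_card_of_ordLeq eqpoll_iff_card_of_ordIso
  using ordLeq_iff_ordLess_or_ordIso not_ordLess_ordIso by blast

text \<open>An infinite product of nonempty sets is equipollent to its larger factor; a finite
  product is smaller than \<open>Z\<close> because \<open>Z\<close> is infinite.\<close>

lemma times_lesspoll:
  includes cardinal_syntax
  assumes "infinite Z" "X \<prec> Z" "Y \<prec> Z"
  shows "X \<times> Y \<prec> Z"
proof (cases "X = {} \<or> Y = {} \<or> finite X \<and> finite Y")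
  case True
  then have "finite (X \<times> Y)" by auto
  then show ?thesis
    by (simp add: assms(1) finite_lesspoll_infinite)
next
  case False
  moreover have "|X| \<le>o |Y| \<or> |Y| \<le>o |X|"
    by (intro ordLeq_total card_of_Well_order)
  ultimately consider "infinite X" "|Y| \<le>o |X|" "Y \<noteq> {}" | "infinite Y" "|X| \<le>o |Y|" "X \<noteq> {}"
    using card_of_ordLeq_finite[of X Y] card_of_ordLeq_finite[of Y X] by blast
  then have "|X \<times> Y| =o |X| \<or> |X \<times> Y| =o |Y|"
  proof cases
    case 1
    then show ?thesis using card_of_Times_infinite[of X Y] by simp
  next
    case 2
    then show ?thesis using card_of_Times_infinite[of Y X] by simp
  qed
  then have "X \<times> Y \<approx> X \<or> X \<times> Y \<approx> Y"
    by (simp only: eqpoll_iff_card_of_ordIso)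
  then show ?thesis
    using assms eq_lesspoll_trans[of "X \<times> Y" X Z] eq_lesspoll_trans[of "X \<times> Y" Y Z] by argo
qed

text \<open>A countable \<open>X\<close> has countably many finite multisets, and an uncountable one
  has no more of them than elements. Here \<open>Y\<close> has to be uncountable and not just
  infinite: a one-element set already has infinitely many multisets.\<close>

lemma multisets_lesspoll:
  assumes "uncountable Y" "X \<prec> Y"
  shows "{m. set_mset m \<subseteq> X} \<prec> Y"
proof -
  have *: "{m. set_mset m \<subseteq> X} = mset ` lists X"
  proof
    show "{m. set_mset m \<subseteq> X} \<subseteq> mset ` lists X"
    proof
      fix m assume m: "m \<in> {m. set_mset m \<subseteq> X}"
      obtain xs where xs: "m = mset xs" by (metis ex_mset)
      with m have "xs \<in> lists X" by auto
      with xs show "m \<in> mset ` lists X" by blast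
    qed
  qed auto
  show ?thesis
  proof (cases "countable X")
    case True
    then show ?thesis
      unfolding * by (intro countable_lesspoll_uncountable assms) auto
  next
    case False
    then have "infinite X" using countable_finite by blast
    then have "mset ` lists X \<lesssim> X"
      by (intro lepoll_trans[OF image_lepoll infinite_lists_lepoll_self])
    then show ?thesis
      unfolding * using assms(2) by (rule lesspoll_trans1)
  qed
qed

lemma Un_lesspoll:
  assumes "infinite Z" "X \<prec> Z" "Y \<prec> Z"
  shows "X \<union> Y \<prec> Z"
  using assms unfolding lesspoll_iff_card_of_ordLess by (rule card_of_Un_ordLess_infinite)

lemma not_lepoll_iff_lesspoll: "\<not> X \<lesssim> Y \<longleftrightarrow> Y \<prec> X"
  unfolding lesspoll_iff_card_of_ordLess lepoll_iff_card_of_ordLeq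
  by (rule not_ordLeq_iff_ordLess[OF card_of_Well_order card_of_Well_order])

text \<open>Were \<open>Y - X\<close> smaller than \<open>Y\<close>, then \<open>Y\<close> would be
  a union of two sets smaller than itself. With \<open>Y\<close> the universe, this is the room for
  the non-idempotent elements of a strict copy.\<close>

lemma infinite_lepoll_diff:
  assumes "infinite Y" "X \<prec> Y"
  shows "Y \<lesssim> Y - X"
proof (rule ccontr)
  assume "\<not> Y \<lesssim> Y - X"
  then have "Y - X \<prec> Y"
    by (simp only: not_lepoll_iff_lesspoll)
  then have "Y - X \<union> X \<prec> Y"
    by (intro Un_lesspoll assms)
  moreover have "Y \<lesssim> Y - X \<union> X"
    by (intro subset_imp_lepoll) auto
  ultimately show False
    by (metis lesspoll_trans1 lesspoll_not_refl)
qed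

section \<open>Homomorphisms, copies and quotients of monoids\<close>

text \<open>\<open>monoid_hom\<close> without extensionality: composites and lambda terms are
  members as they stand, and restriction to the carrier happens only when an arrow of the category
  is formed.\<close>

definition unital_hom :: "('a, 'x) monoid_scheme \<Rightarrow> ('b, 'y) monoid_scheme \<Rightarrow> ('a \<Rightarrow> 'b) set" where
  "unital_hom M N = {h \<in> hom M N. h \<one>\<^bsub>M\<^esub> = \<one>\<^bsub>N\<^esub>}"

lemma unital_homI:
  assumes "\<And>x. x \<in> carrier M \<Longrightarrow> h x \<in> carrier N"
    and "\<And>x y. x \<in> carrier M \<Longrightarrow> y \<in> carrier M \<Longrightarrow> h (x \<otimes>\<^bsub>M\<^esub> y) = h x \<otimes>\<^bsub>N\<^esub> h y"
    and "h \<one>\<^bsub>M\<^esub> = \<one>\<^bsub>N\<^esub>"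
  shows "h \<in> unital_hom M N"
  using assms by (auto simp: unital_hom_def intro: homI)

lemma unital_hom_closed: "h \<in> unital_hom M N \<Longrightarrow> x \<in> carrier M \<Longrightarrow> h x \<in> carrier N"
  by (auto simp: unital_hom_def hom_def)

lemma unital_hom_mult:
  "h \<in> unital_hom M N \<Longrightarrow> x \<in> carrier M \<Longrightarrow> y \<in> carrier M \<Longrightarrow> h (x \<otimes>\<^bsub>M\<^esub> y) = h x \<otimes>\<^bsub>N\<^esub> h y"
  by (auto simp: unital_hom_def hom_mult)

lemma unital_hom_one: "h \<in> unital_hom M N \<Longrightarrow> h \<one>\<^bsub>M\<^esub> = \<one>\<^bsub>N\<^esub>"
  by (auto simp: unital_hom_def)

lemma unital_hom_comp:
  assumes "h \<in> unital_hom M N" "k \<in> unital_hom N L"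
  shows "(\<lambda>x. k (h x)) \<in> unital_hom M L"
  by (intro unital_homI)
    (simp_all add: unital_hom_closed[OF assms(1)] unital_hom_mult[OF assms(1)] unital_hom_one[OF assms(1)]
      unital_hom_closed[OF assms(2)] unital_hom_mult[OF assms(2)] unital_hom_one[OF assms(2)])

lemma unital_hom_id: "(\<lambda>x. x) \<in> unital_hom M M"
  by (intro unital_homI) auto

lemma unital_hom_cong:
  assumes "h \<in> unital_hom M N" "monoid M" "\<And>x. x \<in> carrier M \<Longrightarrow> k x = h x"
  shows "k \<in> unital_hom M N"
  by (intro unital_homI)
    (simp_all add: assms(3) unital_hom_closed[OF assms(1)] unital_hom_mult[OF assms(1)]
      unital_hom_one[OF assms(1)] monoid.m_closed[OF assms(2)] monoid.one_closed[OF assms(2)])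

lemma monoid_hom_iff: "h \<in> monoid_hom M N \<longleftrightarrow> h \<in> unital_hom M N \<and> h \<in> extensional (carrier M)"
  unfolding monoid_hom_def unital_hom_def by blast

lemma restrict_monoid_hom:
  assumes "monoid M" "h \<in> unital_hom M N"
  shows "restrict h (carrier M) \<in> monoid_hom M N"
  unfolding monoid_hom_iff using unital_hom_cong[OF assms(2,1)] by simp

text \<open>\<open>small_copy\<close> along an arbitrary map in place of the one chosen by
  \<open>encode\<close>. The strict tensor product lives on this freedom in
  \<open>e\<close>.\<close>

definition copy :: "('a \<Rightarrow> 'u) \<Rightarrow> ('a, 'x) monoid_scheme \<Rightarrow> 'u monoid" where
  "copy e M = (let d = inv_into (carrier M) e; S = e ` carrier M in
     \<lparr>carrier = S,
      monoid.mult = (\<lambda>x y. if x \<in> S \<and> y \<in> S then e (d x \<otimes>\<^bsub>M\<^esub> d y) else undefined),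
      one = e \<one>\<^bsub>M\<^esub>\<rparr>)"

lemma small_copy_eq_copy: "small_copy M = copy (encode M) M"
  unfolding small_copy_def copy_def Let_def by simp

lemma carrier_copy [simp]: "carrier (copy e M) = e ` carrier M"
  by (simp add: copy_def Let_def)

lemma one_copy [simp]: "\<one>\<^bsub>copy e M\<^esub> = e \<one>\<^bsub>M\<^esub>"
  by (simp add: copy_def Let_def)

lemma mult_copy:
  "inj_on e (carrier M) \<Longrightarrow> x \<in> carrier M \<Longrightarrow> y \<in> carrier M \<Longrightarrow>
    e x \<otimes>\<^bsub>copy e M\<^esub> e y = e (x \<otimes>\<^bsub>M\<^esub> y)"
  by (simp add: copy_def Let_def)

lemma mult_copy_undefined:
  "x \<notin> e ` carrier M \<or> y \<notin> e ` carrier M \<Longrightarrow> x \<otimes>\<^bsub>copy e M\<^esub> y = undefined"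
  by (auto simp: copy_def Let_def)

lemma copy_hom: "inj_on e (carrier M) \<Longrightarrow> e \<in> unital_hom M (copy e M)"
  by (intro unital_homI) (auto simp: mult_copy)

lemma copy_inv_hom:
  assumes "monoid M" "inj_on e (carrier M)"
  shows "inv_into (carrier M) e \<in> unital_hom (copy e M) M"
proof -
  interpret monoid M by fact
  show ?thesis
    using assms(2) by (intro unital_homI) (auto simp: mult_copy)
qed

lemma comm_monoid_copy:
  assumes "comm_monoid M" "inj_on e (carrier M)"
  shows "comm_monoid (copy e M)"
proof -
  interpret comm_monoid M by fact
  show ?thesis
    using assms(2) by (intro comm_monoidI) (auto simp: mult_copy m_ac)
qed

lemma small_monoid_copy:
  assumes "carrier M \<prec> (UNIV :: 'u set)"
  shows "small_monoid (copy (e :: _ \<Rightarrow> 'u) M)"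
  unfolding small_monoid_def
  using assms lesspoll_trans1[OF image_lepoll[of e "carrier M"]] by (auto simp: mult_copy_undefined)

lemma inj_on_encode:
  assumes "carrier M \<lesssim> (UNIV :: 'u set)"
  shows "inj_on (encode M :: _ \<Rightarrow> 'u) (carrier M)"
  unfolding encode_def
  using assms someI_ex[of "\<lambda>e. inj_on e (carrier M)"] by (auto simp: lepoll_def)

definition rel_class :: "('a \<Rightarrow> 'a \<Rightarrow> bool) \<Rightarrow> 'a \<Rightarrow> 'a set" where
  "rel_class r x = Collect (r x)"

text \<open>The formula of \<open>ten_quot\<close> for any relation on any monoid; it serves both
  the tensor product and the pushforward along a map of idempotents.\<close>

definition quot :: "('a, 'x) monoid_scheme \<Rightarrow> ('a \<Rightarrow> 'a \<Rightarrow> bool) \<Rightarrow> 'a set monoid" where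
  "quot M r = \<lparr>carrier = rel_class r ` carrier M,
     monoid.mult = (\<lambda>X Y. \<Union>m \<in> X. \<Union>n \<in> Y. rel_class r (m \<otimes>\<^bsub>M\<^esub> n)),
     one = rel_class r \<one>\<^bsub>M\<^esub>\<rparr>"

locale monoid_congruence = comm_monoid M for M (structure) +
  fixes r :: "'a \<Rightarrow> 'a \<Rightarrow> bool"
  assumes rel_closed: "r x y \<Longrightarrow> x \<in> carrier M \<and> y \<in> carrier M"
    and rel_refl: "x \<in> carrier M \<Longrightarrow> r x x"
    and rel_sym: "r x y \<Longrightarrow> r y x"
    and rel_trans: "r x y \<Longrightarrow> r y z \<Longrightarrow> r x z"
    and rel_cong: "r x y \<Longrightarrow> r x' y' \<Longrightarrow> r (x \<otimes> x') (y \<otimes> y')"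
begin

lemma class_eq_iff: "x \<in> carrier M \<Longrightarrow> rel_class r x = rel_class r y \<longleftrightarrow> r x y"
  unfolding rel_class_def using rel_refl rel_sym rel_trans by blast

lemma carrier_quot: "carrier (quot M r) = rel_class r ` carrier M"
  by (simp add: quot_def)

lemma one_quot: "\<one>\<^bsub>quot M r\<^esub> = rel_class r \<one>"
  by (simp add: quot_def)

lemma mult_quot:
  assumes "x \<in> carrier M" "y \<in> carrier M"
  shows "rel_class r x \<otimes>\<^bsub>quot M r\<^esub> rel_class r y = rel_class r (x \<otimes> y)"
proof -
  let ?X = "rel_class r x" and ?Y = "rel_class r y"
  \<comment> \<open>The double union defining the product collapses, since all the classes in it are
    equal.\<close>
  have eq: "rel_class r (m \<otimes> n) = rel_class r (x \<otimes> y)" if "m \<in> ?X" "n \<in> ?Y" for m n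
  proof -
    have "r (x \<otimes> y) (m \<otimes> n)"
      using that rel_cong by (simp add: rel_class_def)
    then show ?thesis
      using class_eq_iff[of "x \<otimes> y" "m \<otimes> n"] assms by simp
  qed
  have "x \<in> ?X" "y \<in> ?Y"
    using assms rel_refl by (simp_all add: rel_class_def)
  have "?X \<otimes>\<^bsub>quot M r\<^esub> ?Y = (\<Union>m \<in> ?X. \<Union>n \<in> ?Y. rel_class r (m \<otimes> n))"
    by (simp add: quot_def)
  also have "\<dots> = (\<Union>m \<in> ?X. \<Union>n \<in> ?Y. rel_class r (x \<otimes> y))"
    by (rule SUP_cong[OF HOL.refl], rule SUP_cong[OF HOL.refl], rule eq)
  also have "\<dots> = rel_class r (x \<otimes> y)"
    using \<open>x \<in> ?X\<close> \<open>y \<in> ?Y\<close> by blast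
  finally show ?thesis .
qed

lemma comm_monoid_quot: "comm_monoid (quot M r)"
  by (rule comm_monoidI) (auto simp: carrier_quot one_quot mult_quot m_ac)

lemma quot_lift:
  assumes h: "h \<in> unital_hom M N" and compat: "\<And>x y. r x y \<Longrightarrow> h x = h y"
  obtains k where "k \<in> unital_hom (quot M r) N" "\<And>x. x \<in> carrier M \<Longrightarrow> k (rel_class r x) = h x"
proof
  let ?k = "\<lambda>X. h (SOME x. x \<in> X)"
  show k: "?k (rel_class r x) = h x" if "x \<in> carrier M" for x
  proof -
    have "r x (SOME y. y \<in> rel_class r x)"
      using someI[of "r x" x] rel_refl[OF that] by (simp add: rel_class_def)
    then show ?thesis using compat by metis
  qed
  show "?k \<in> unital_hom (quot M r) N"
    by (intro unital_homI)
      (auto simp: carrier_quot one_quot mult_quot k unital_hom_closed[OF h] unital_hom_mult[OF h]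
        unital_hom_one[OF h])
qed

end

section \<open>Bihomomorphisms and the tensor product\<close>

definition bihom ::
    "('a, 'x) monoid_scheme \<Rightarrow> ('b, 'y) monoid_scheme \<Rightarrow> ('c, 'z) monoid_scheme \<Rightarrow>
     ('a \<Rightarrow> 'b \<Rightarrow> 'c) set" where
  "bihom A B C = {\<beta>. (\<forall>b \<in> carrier B. (\<lambda>a. \<beta> a b) \<in> unital_hom A C) \<and>
     (\<forall>a \<in> carrier A. \<beta> a \<in> unital_hom B C)}"

lemma bihom_left: "\<beta> \<in> bihom A B C \<Longrightarrow> b \<in> carrier B \<Longrightarrow> (\<lambda>a. \<beta> a b) \<in> unital_hom A C"
  by (simp add: bihom_def)

lemma bihom_right: "\<beta> \<in> bihom A B C \<Longrightarrow> a \<in> carrier A \<Longrightarrow> \<beta> a \<in> unital_hom B C"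
  by (simp add: bihom_def)

lemma bihom_closed: "\<beta> \<in> bihom A B C \<Longrightarrow> a \<in> carrier A \<Longrightarrow> b \<in> carrier B \<Longrightarrow> \<beta> a b \<in> carrier C"
  using bihom_right unital_hom_closed by metis

lemma bihom_mult_left:
  "\<beta> \<in> bihom A B C \<Longrightarrow> a \<in> carrier A \<Longrightarrow> a' \<in> carrier A \<Longrightarrow> b \<in> carrier B \<Longrightarrow>
    \<beta> (a \<otimes>\<^bsub>A\<^esub> a') b = \<beta> a b \<otimes>\<^bsub>C\<^esub> \<beta> a' b"
  using unital_hom_mult[OF bihom_left] .

lemma bihom_mult_right:
  "\<beta> \<in> bihom A B C \<Longrightarrow> a \<in> carrier A \<Longrightarrow> b \<in> carrier B \<Longrightarrow> b' \<in> carrier B \<Longrightarrow>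
    \<beta> a (b \<otimes>\<^bsub>B\<^esub> b') = \<beta> a b \<otimes>\<^bsub>C\<^esub> \<beta> a b'"
  using unital_hom_mult[OF bihom_right] .

lemma bihom_one_left: "\<beta> \<in> bihom A B C \<Longrightarrow> b \<in> carrier B \<Longrightarrow> \<beta> \<one>\<^bsub>A\<^esub> b = \<one>\<^bsub>C\<^esub>"
  using unital_hom_one[OF bihom_left] .

lemma bihom_one_right: "\<beta> \<in> bihom A B C \<Longrightarrow> a \<in> carrier A \<Longrightarrow> \<beta> a \<one>\<^bsub>B\<^esub> = \<one>\<^bsub>C\<^esub>"
  using unital_hom_one[OF bihom_right] .

lemma bihom_comp:
  assumes "\<beta> \<in> bihom A B C" "h \<in> unital_hom C D"
  shows "(\<lambda>a b. h (\<beta> a b)) \<in> bihom A B D"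
  unfolding bihom_def
  using unital_hom_comp[OF bihom_left[OF assms(1)] assms(2)]
    unital_hom_comp[OF bihom_right[OF assms(1)] assms(2)]
  by simp

lemma bihom_precomp:
  assumes "\<beta> \<in> bihom A B C" "f \<in> unital_hom A' A" "g \<in> unital_hom B' B"
  shows "(\<lambda>a b. \<beta> (f a) (g b)) \<in> bihom A' B' C"
  unfolding bihom_def
  using unital_hom_comp[OF assms(2) bihom_left[OF assms(1)]]
    unital_hom_comp[OF assms(3) bihom_right[OF assms(1)]]
    unital_hom_closed[OF assms(2)] unital_hom_closed[OF assms(3)]
  by simp

definition word_monoid :: "('a, 'x) monoid_scheme \<Rightarrow> ('b, 'y) monoid_scheme \<Rightarrow> ('a \<times> 'b) multiset monoid"
  where "word_monoid A B = \<lparr>carrier = ten_words A B, monoid.mult = (+), one = {#}\<rparr>"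

lemma ten_quot_eq_quot: "ten_quot A B = quot (word_monoid A B) (ten_rel A B)"
  by (simp add: ten_quot_def quot_def word_monoid_def ten_class_def[abs_def] rel_class_def[abs_def])

lemma ten_class_eq: "ten_class A B = rel_class (ten_rel A B)"
  by (simp add: fun_eq_iff ten_class_def rel_class_def)

locale tensor_pair = A: comm_monoid A + B: comm_monoid B
  for A :: "('a, 'x) monoid_scheme" and B :: "('b, 'y) monoid_scheme"
begin

lemma ten_rel_words: "ten_rel A B m n \<Longrightarrow> m \<in> ten_words A B \<and> n \<in> ten_words A B"
  by (induction rule: ten_rel.induct) auto

sublocale monoid_congruence "word_monoid A B" "ten_rel A B"
proof -
  have "comm_monoid (word_monoid A B)"
    by (rule comm_monoidI) (auto simp: word_monoid_def)
  then interpret comm_monoid "word_monoid A B" .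
  show "monoid_congruence (word_monoid A B) (ten_rel A B)"
    by unfold_locales
      (use ten_rel_words in \<open>auto simp: word_monoid_def intro: ten_rel.intros\<close>)
qed

abbreviation gen :: "'a \<Rightarrow> 'b \<Rightarrow> ('a \<times> 'b) multiset set" where
  "gen a b \<equiv> ten_class A B {#(a, b)#}"

lemma comm_monoid_ten_quot: "comm_monoid (ten_quot A B)"
  unfolding ten_quot_eq_quot by (rule comm_monoid_quot)

lemma carrier_ten_quot: "carrier (ten_quot A B) = ten_class A B ` ten_words A B"
  by (simp add: ten_quot_def)

lemma one_ten_quot: "\<one>\<^bsub>ten_quot A B\<^esub> = ten_class A B {#}"
  by (simp add: ten_quot_def)

lemma mult_ten_quot:
  "m \<in> ten_words A B \<Longrightarrow> n \<in> ten_words A B \<Longrightarrow>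
    ten_class A B m \<otimes>\<^bsub>ten_quot A B\<^esub> ten_class A B n = ten_class A B (m + n)"
  using mult_quot[of m n] by (simp add: word_monoid_def ten_quot_eq_quot ten_class_eq)

lemma ten_class_eqI: "ten_rel A B m n \<Longrightarrow> ten_class A B m = ten_class A B n"
  using rel_sym rel_trans unfolding ten_class_def by blast

lemma gen_bihom: "gen \<in> bihom A B (ten_quot A B)"
proof -
  have "gen (a \<otimes>\<^bsub>A\<^esub> a') b = gen a b \<otimes>\<^bsub>ten_quot A B\<^esub> gen a' b"
    if "a \<in> carrier A" "a' \<in> carrier A" "b \<in> carrier B" for a a' b
    using that ten_class_eqI[OF ten_rel.mult_left] by (auto simp: mult_ten_quot add_mset_commute)
  moreover have "gen a (b \<otimes>\<^bsub>B\<^esub> b') = gen a b \<otimes>\<^bsub>ten_quot A B\<^esub> gen a b'"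
    if "a \<in> carrier A" "b \<in> carrier B" "b' \<in> carrier B" for a b b'
    using that ten_class_eqI[OF ten_rel.mult_right] by (auto simp: mult_ten_quot add_mset_commute)
  moreover have "gen \<one>\<^bsub>A\<^esub> b = \<one>\<^bsub>ten_quot A B\<^esub>" if "b \<in> carrier B" for b
    using ten_class_eqI[OF ten_rel.unit_left[OF that]] by (simp add: one_ten_quot)
  moreover have "gen a \<one>\<^bsub>B\<^esub> = \<one>\<^bsub>ten_quot A B\<^esub>" if "a \<in> carrier A" for a
    using ten_class_eqI[OF ten_rel.unit_right[OF that]] by (simp add: one_ten_quot)
  ultimately show ?thesis
    unfolding bihom_def by (auto intro!: unital_homI simp: carrier_ten_quot)
qed

lemma ten_quot_induct [consumes 1, case_names one gen mult]:
  assumes "x \<in> carrier (ten_quot A B)"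
    and "P \<one>\<^bsub>ten_quot A B\<^esub>"
    and "\<And>a b. a \<in> carrier A \<Longrightarrow> b \<in> carrier B \<Longrightarrow> P (gen a b)"
    and "\<And>x y. x \<in> carrier (ten_quot A B) \<Longrightarrow> y \<in> carrier (ten_quot A B) \<Longrightarrow> P x \<Longrightarrow> P y \<Longrightarrow>
      P (x \<otimes>\<^bsub>ten_quot A B\<^esub> y)"
  shows "P x"
proof -
  have "P (ten_class A B m)" if "m \<in> ten_words A B" for m
    using that
  proof (induction m)
    case empty
    then show ?case using assms(2) by (simp add: one_ten_quot)
  next
    case (add p m)
    obtain a b where p: "p = (a, b)" "a \<in> carrier A" "b \<in> carrier B"
      using add.prems by (cases p) auto
    have "P (gen a b \<otimes>\<^bsub>ten_quot A B\<^esub> ten_class A B m)"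
      using add p assms(3) by (intro assms(4)) (auto simp: carrier_ten_quot)
    then show ?case
      using add.prems p by (subst (asm) mult_ten_quot) auto
  qed
  then show ?thesis
    using assms(1) by (auto simp: carrier_ten_quot)
qed

lemma ten_quot_hom_ext:
  assumes "h \<in> unital_hom (ten_quot A B) C" "k \<in> unital_hom (ten_quot A B) C"
    and "\<And>a b. a \<in> carrier A \<Longrightarrow> b \<in> carrier B \<Longrightarrow> h (gen a b) = k (gen a b)"
    and "x \<in> carrier (ten_quot A B)"
  shows "h x = k x"
  using assms(4)
  by (induction rule: ten_quot_induct)
    (simp_all add: assms(3) unital_hom_one[OF assms(1)] unital_hom_mult[OF assms(1)]
      unital_hom_one[OF assms(2)] unital_hom_mult[OF assms(2)])

lemma ten_quot_lift:
  fixes C :: "('c, 'z) monoid_scheme"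
  assumes "comm_monoid C" and \<beta>: "\<beta> \<in> bihom A B C"
  obtains k where "k \<in> unital_hom (ten_quot A B) C"
    "\<And>a b. a \<in> carrier A \<Longrightarrow> b \<in> carrier B \<Longrightarrow> k (gen a b) = \<beta> a b"
proof -
  interpret C: comm_monoid C by fact
  \<comment> \<open>\<open>fold_mset\<close> asks that \<open>f\<close> commute with itself at all
    arguments of the type. Commutativity of \<open>C\<close> gives this inside the carriers only,
    hence the guard that makes \<open>f\<close> act as the identity elsewhere.\<close>
  define f where "f = (\<lambda>(a, b) y. if a \<in> carrier A \<and> b \<in> carrier B \<and> y \<in> carrier C then \<beta> a b \<otimes>\<^bsub>C\<^esub> y else y)"
  define F where "F = fold_mset f \<one>\<^bsub>C\<^esub>"
  interpret comp_fun_commute f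
    by unfold_locales (auto simp: f_def fun_eq_iff bihom_closed[OF \<beta>] C.m_lcomm)
  have F0: "F {#} = \<one>\<^bsub>C\<^esub>" by (simp add: F_def)
  have Fstep: "F (add_mset p m) = f p (F m)" for p m by (simp add: F_def)
  have F_closed: "F m \<in> carrier C" for m
    by (induction m) (auto simp: F0 Fstep, auto simp: f_def bihom_closed[OF \<beta>])
  have Fadd: "F (add_mset (a, b) m) = \<beta> a b \<otimes>\<^bsub>C\<^esub> F m" if "a \<in> carrier A" "b \<in> carrier B" for a b m
    using that F_closed[of m] by (simp add: Fstep f_def)
  have Fplus: "F (m + n) = F m \<otimes>\<^bsub>C\<^esub> F n" if "m \<in> ten_words A B" for m n
    using that
    by (induction m) (auto simp: F0 F_closed Fadd C.m_assoc bihom_closed[OF \<beta>])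
  have Fhom: "F \<in> unital_hom (word_monoid A B) C"
    by (intro unital_homI) (auto simp: word_monoid_def F_closed F0 Fplus)
  have Frel: "F m = F n" if "ten_rel A B m n" for m n
    using that
  proof (induction rule: ten_rel.induct)
    case (cong m n m' n')
    then show ?case using Fplus ten_rel_words by metis
  qed (auto simp: Fadd F0 bihom_closed[OF \<beta>] bihom_one_left[OF \<beta>] bihom_one_right[OF \<beta>]
      bihom_mult_left[OF \<beta>] bihom_mult_right[OF \<beta>])
  obtain k where k: "k \<in> unital_hom (quot (word_monoid A B) (ten_rel A B)) C"
    "\<And>x. x \<in> carrier (word_monoid A B) \<Longrightarrow> k (ten_class A B x) = F x"
    using quot_lift[OF Fhom Frel] unfolding ten_class_eq by blast
  show ?thesis
  proof
    show "k \<in> unital_hom (ten_quot A B) C"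
      using k(1) by (simp add: ten_quot_eq_quot)
    show "k (gen a b) = \<beta> a b" if "a \<in> carrier A" "b \<in> carrier B" for a b
      using k(2)[of "{#(a, b)#}"] that
      by (simp add: word_monoid_def Fadd F0 bihom_closed[OF \<beta>])
  qed
qed

lemma carrier_ten_quot_lesspoll:
  assumes "uncountable U" "carrier A \<prec> U" "carrier B \<prec> U"
  shows "carrier (ten_quot A B) \<prec> U"
proof -
  have "infinite U" using assms(1) countable_finite by blast
  then have "ten_words A B \<prec> U"
    using assms by (intro multisets_lesspoll times_lesspoll)
  then show ?thesis
    unfolding carrier_ten_quot by (rule lesspoll_trans1[OF image_lepoll])
qed

end

section \<open>The monoidal category defined by a choice of tensor products\<close>

lemma unital_hom_pointwise_mult:
  assumes "comm_monoid N" "h \<in> unital_hom M N" "k \<in> unital_hom M N"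
  shows "(\<lambda>x. h x \<otimes>\<^bsub>N\<^esub> k x) \<in> unital_hom M N"
proof -
  interpret comm_monoid N by fact
  show ?thesis
    by (intro unital_homI)
      (simp_all add: unital_hom_closed[OF assms(2)] unital_hom_closed[OF assms(3)]
        unital_hom_mult[OF assms(2)] unital_hom_mult[OF assms(3)]
        unital_hom_one[OF assms(2)] unital_hom_one[OF assms(3)] m_ac)
qed

lemma unital_hom_const_one: "monoid N \<Longrightarrow> (\<lambda>x. \<one>\<^bsub>N\<^esub>) \<in> unital_hom M N"
  by (intro unital_homI) (auto simp: monoid.one_closed monoid.l_one)

lemma bihom_swap: "\<beta> \<in> bihom A B C \<Longrightarrow> (\<lambda>b a. \<beta> a b) \<in> bihom B A C"
  by (simp add: bihom_def)

text \<open>Evaluates the definite descriptions by which the structure maps are defined: uniqueness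
  on the carrier comes from a universal property, uniqueness off the carrier from
  extensionality.\<close>

lemma the_monoid_hom:
  assumes "monoid M" "h \<in> unital_hom M N" "Q (restrict h (carrier M))"
    and "\<And>k x. k \<in> unital_hom M N \<Longrightarrow> Q k \<Longrightarrow> x \<in> carrier M \<Longrightarrow> k x = h x"
  shows "(THE k. k \<in> monoid_hom M N \<and> Q k) = restrict h (carrier M)"
proof (rule the_equality)
  show "restrict h (carrier M) \<in> monoid_hom M N \<and> Q (restrict h (carrier M))"
    using assms(3) restrict_monoid_hom[OF assms(1,2)] by simp
next
  fix k assume k: "k \<in> monoid_hom M N \<and> Q k"
  then have "k x = restrict h (carrier M) x" if "x \<in> carrier M" for x
    using assms(4)[of k x] that by (simp add: monoid_hom_iff)
  moreover have "k \<in> extensional (carrier M)"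
    using k by (simp add: monoid_hom_iff)
  ultimately show "k = restrict h (carrier M)"
    by (intro extensionalityI[of _ "carrier M"]) auto
qed

text \<open>\<open>tensor_category\<close> with the tensor product \<open>t\<close> and its
  universal bihomomorphism \<open>p\<close> as parameters, so that the given and the strict choice
  are instances of one construction.\<close>

definition tensor_category_on ::
    "'u monoid set \<Rightarrow> 'u monoid \<Rightarrow> 'u \<Rightarrow> ('u monoid \<Rightarrow> 'u monoid \<Rightarrow> 'u monoid) \<Rightarrow>
     ('u monoid \<Rightarrow> 'u monoid \<Rightarrow> 'u \<Rightarrow> 'u \<Rightarrow> 'u) \<Rightarrow> ('u monoid, 'u mon_arr) monoidal_cat" where
  "tensor_category_on K U u t p =
    \<lparr>Obj = K,
     Arr = {f. src f \<in> K \<and> tgt f \<in> K \<and> fun_of f \<in> monoid_hom (src f) (tgt f)},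
     Dom = src,
     Cod = tgt,
     Id = (\<lambda>A. \<lparr>src = A, tgt = A, fun_of = restrict (\<lambda>x. x) (carrier A)\<rparr>),
     Comp = (\<lambda>g f. \<lparr>src = src f, tgt = tgt g,
        fun_of = compose (carrier (src f)) (fun_of g) (fun_of f)\<rparr>),
     ten_obj = t,
     ten_arr = (\<lambda>f g.
       let A = src f; A' = tgt f; B = src g; B' = tgt g in
       \<lparr>src = t A B, tgt = t A' B',
        fun_of = (THE h. h \<in> monoid_hom (t A B) (t A' B') \<and>
          (\<forall>a \<in> carrier A. \<forall>b \<in> carrier B.
             h (p A B a b) = p A' B' (fun_of f a) (fun_of g b)))\<rparr>),
     ten_unit = U,
     assoc = (\<lambda>A B C.
       \<lparr>src = t (t A B) C, tgt = t A (t B C),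
        fun_of = (THE h. h \<in> monoid_hom (t (t A B) C) (t A (t B C)) \<and>
          (\<forall>a \<in> carrier A. \<forall>b \<in> carrier B. \<forall>c \<in> carrier C.
             h (p (t A B) C (p A B a b) c) = p A (t B C) a (p B C b c)))\<rparr>),
     lunit = (\<lambda>A. \<lparr>src = t U A, tgt = A,
        fun_of = (THE h. h \<in> monoid_hom (t U A) A \<and>
          (\<forall>a \<in> carrier A. h (p U A u a) = a))\<rparr>),
     runit = (\<lambda>A. \<lparr>src = t A U, tgt = A,
        fun_of = (THE h. h \<in> monoid_hom (t A U) A \<and>
          (\<forall>a \<in> carrier A. h (p A U a u) = a))\<rparr>)\<rparr>"

lemma tensor_category_eq: "tensor_category K U u = tensor_category_on K U u tensor pure"
  by (simp add: tensor_category_def tensor_category_on_def)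

definition mon_arr_on :: "'u monoid \<Rightarrow> 'u monoid \<Rightarrow> ('u \<Rightarrow> 'u) \<Rightarrow> 'u mon_arr" where
  "mon_arr_on A B h = \<lparr>src = A, tgt = B, fun_of = restrict h (carrier A)\<rparr>"

lemma src_mon_arr_on [simp]: "src (mon_arr_on A B h) = A"
  and tgt_mon_arr_on [simp]: "tgt (mon_arr_on A B h) = B"
  and fun_of_mon_arr_on [simp]: "x \<in> carrier A \<Longrightarrow> fun_of (mon_arr_on A B h) x = h x"
  by (simp_all add: mon_arr_on_def)

section \<open>The underlying category, which does not depend on the tensor product\<close>

context
  fixes K :: "'u monoid set" and U u t p and V :: "('u monoid, 'u mon_arr) monoidal_cat"
  defines "V \<equiv> tensor_category_on K U u t p"
begin

lemma Obj_on [simp]: "Obj V = K"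
  and Dom_on [simp]: "Dom V = src"
  and Cod_on [simp]: "Cod V = tgt"
  and ten_obj_on [simp]: "ten_obj V = t"
  and ten_unit_on [simp]: "ten_unit V = U"
  by (simp_all add: V_def tensor_category_on_def)

lemma Id_on_eq: "Id V A = mon_arr_on A A (\<lambda>x. x)"
  and Comp_on_eq: "Comp V g f = mon_arr_on (src f) (tgt g) (\<lambda>x. fun_of g (fun_of f x))"
  and ten_arr_on_eq: "ten_arr V f g = \<lparr>src = t (src f) (src g), tgt = t (tgt f) (tgt g),
    fun_of = (THE h. h \<in> monoid_hom (t (src f) (src g)) (t (tgt f) (tgt g)) \<and>
      (\<forall>a \<in> carrier (src f). \<forall>b \<in> carrier (src g).
        h (p (src f) (src g) a b) = p (tgt f) (tgt g) (fun_of f a) (fun_of g b)))\<rparr>"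
  and assoc_on_eq: "assoc V A B C = \<lparr>src = t (t A B) C, tgt = t A (t B C),
    fun_of = (THE h. h \<in> monoid_hom (t (t A B) C) (t A (t B C)) \<and>
      (\<forall>a \<in> carrier A. \<forall>b \<in> carrier B. \<forall>c \<in> carrier C.
        h (p (t A B) C (p A B a b) c) = p A (t B C) a (p B C b c)))\<rparr>"
  and lunit_on_eq: "lunit V A = \<lparr>src = t U A, tgt = A,
    fun_of = (THE h. h \<in> monoid_hom (t U A) A \<and> (\<forall>a \<in> carrier A. h (p U A u a) = a))\<rparr>"
  and runit_on_eq: "runit V A = \<lparr>src = t A U, tgt = A,
    fun_of = (THE h. h \<in> monoid_hom (t A U) A \<and> (\<forall>a \<in> carrier A. h (p A U a u) = a))\<rparr>"
  by (simp_all add: V_def tensor_category_on_def mon_arr_on_def compose_def Let_def)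

lemma src_tgt_on [simp]:
  "src (Id V A) = A" "tgt (Id V A) = A"
  "src (ten_arr V f g) = t (src f) (src g)" "tgt (ten_arr V f g) = t (tgt f) (tgt g)"
  "src (Comp V g f) = src f" "tgt (Comp V g f) = tgt g"
  "src (assoc V A B C) = t (t A B) C" "tgt (assoc V A B C) = t A (t B C)"
  "src (lunit V A) = t U A" "tgt (lunit V A) = A"
  "src (runit V A) = t A U" "tgt (runit V A) = A"
  by (simp_all add: V_def tensor_category_on_def Let_def)

lemma Arr_on_iff:
  "f \<in> Arr V \<longleftrightarrow> src f \<in> K \<and> tgt f \<in> K \<and> fun_of f \<in> monoid_hom (src f) (tgt f)"
  by (simp add: V_def tensor_category_on_def)

lemma Homset_on_iff: "f \<in> Homset V A B \<longleftrightarrow> f \<in> Arr V \<and> src f = A \<and> tgt f = B"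
  by (simp add: Homset_def)

lemma Arr_src [simp]: "f \<in> Arr V \<Longrightarrow> src f \<in> K"
  and Arr_tgt [simp]: "f \<in> Arr V \<Longrightarrow> tgt f \<in> K"
  and Arr_hom: "f \<in> Arr V \<Longrightarrow> fun_of f \<in> unital_hom (src f) (tgt f)"
  by (simp_all add: Arr_on_iff monoid_hom_iff)

lemma Arr_closed [simp]: "f \<in> Arr V \<Longrightarrow> x \<in> carrier (src f) \<Longrightarrow> fun_of f x \<in> carrier (tgt f)"
  by (rule unital_hom_closed[OF Arr_hom])

lemma Arr_eqI:
  assumes "f \<in> Arr V" "f' \<in> Arr V" "src f = src f'" "tgt f = tgt f'"
    and "\<And>x. x \<in> carrier (src f) \<Longrightarrow> fun_of f x = fun_of f' x"
  shows "f = f'"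
proof -
  have "fun_of f \<in> extensional (carrier (src f))" "fun_of f' \<in> extensional (carrier (src f))"
    using assms(1,2) unfolding Arr_on_iff monoid_hom_iff assms(3) by blast+
  then have "fun_of f = fun_of f'"
    using assms(5) by (rule extensionalityI)
  with assms(3,4) show ?thesis by (simp add: mon_arr.equality)
qed

lemma mon_arr_on_Arr:
  "monoid A \<Longrightarrow> A \<in> K \<Longrightarrow> B \<in> K \<Longrightarrow> h \<in> unital_hom A B \<Longrightarrow> mon_arr_on A B h \<in> Arr V"
  unfolding Arr_on_iff mon_arr_on_def mon_arr.select_convs
  by (intro conjI) (assumption | erule (1) restrict_monoid_hom)+

lemma Id_on_apply [simp]: "x \<in> carrier A \<Longrightarrow> fun_of (Id V A) x = x"
  by (simp add: Id_on_eq)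

lemma Comp_on_apply [simp]: "x \<in> carrier (src f) \<Longrightarrow> fun_of (Comp V g f) x = fun_of g (fun_of f x)"
  by (simp add: Comp_on_eq)

lemma Comp_on_Arr [simp]:
  assumes "f \<in> Arr V" "g \<in> Arr V" "tgt f = src g" "\<And>A. A \<in> K \<Longrightarrow> monoid A"
  shows "Comp V g f \<in> Arr V"
  unfolding Comp_on_eq
  using assms(3,4) unital_hom_comp[OF Arr_hom[OF assms(1)], of "fun_of g" "tgt g"] Arr_hom[OF assms(2)]
  by (intro mon_arr_on_Arr) (simp_all add: assms(1,2))

lemma category_on:
  assumes "\<And>A. A \<in> K \<Longrightarrow> monoid A"
  shows "category V"
proof -
  have Id_Arr: "Id V A \<in> Arr V" if "A \<in> K" for A
    unfolding Id_on_eq using that assms by (intro mon_arr_on_Arr unital_hom_id)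
  show ?thesis
    by unfold_locales
      (auto simp: Homset_on_iff Id_Arr assms intro!: Arr_eqI)
qed

end

text \<open>The data are known only through universal properties: \<open>U\<close> is free on
  \<open>u\<close>, and \<open>p\<close> is a universal bihomomorphism, both tested against targets
  in \<open>K\<close>. Existence and uniqueness are separate axioms, and uniqueness is asserted on
  carriers.\<close>

locale tensor_structure =
  fixes K :: "'u monoid set" and U :: "'u monoid" and u :: 'u
    and t :: "'u monoid \<Rightarrow> 'u monoid \<Rightarrow> 'u monoid"
    and p :: "'u monoid \<Rightarrow> 'u monoid \<Rightarrow> 'u \<Rightarrow> 'u \<Rightarrow> 'u"
  assumes comm: "A \<in> K \<Longrightarrow> comm_monoid A"
    and tensor_closed [simp]: "A \<in> K \<Longrightarrow> B \<in> K \<Longrightarrow> t A B \<in> K"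
    and unit_closed [simp]: "U \<in> K"
    and u_closed [simp]: "u \<in> carrier U"
    and free_lift: "A \<in> K \<Longrightarrow> a \<in> carrier A \<Longrightarrow> \<exists>h \<in> unital_hom U A. h u = a"
    and free_ext: "A \<in> K \<Longrightarrow> h \<in> unital_hom U A \<Longrightarrow> k \<in> unital_hom U A \<Longrightarrow> h u = k u \<Longrightarrow>
      x \<in> carrier U \<Longrightarrow> h x = k x"
    and p_bihom: "A \<in> K \<Longrightarrow> B \<in> K \<Longrightarrow> p A B \<in> bihom A B (t A B)"
    and p_lift: "A \<in> K \<Longrightarrow> B \<in> K \<Longrightarrow> C \<in> K \<Longrightarrow> \<beta> \<in> bihom A B C \<Longrightarrow>
      \<exists>h \<in> unital_hom (t A B) C. \<forall>a \<in> carrier A. \<forall>b \<in> carrier B. h (p A B a b) = \<beta> a b"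
    and p_ext: "A \<in> K \<Longrightarrow> B \<in> K \<Longrightarrow> C \<in> K \<Longrightarrow>
      h \<in> unital_hom (t A B) C \<Longrightarrow> k \<in> unital_hom (t A B) C \<Longrightarrow>
      (\<And>a b. a \<in> carrier A \<Longrightarrow> b \<in> carrier B \<Longrightarrow> h (p A B a b) = k (p A B a b)) \<Longrightarrow>
      x \<in> carrier (t A B) \<Longrightarrow> h x = k x"
begin

abbreviation V :: "('u monoid, 'u mon_arr) monoidal_cat" where
  "V \<equiv> tensor_category_on K U u t p"

lemma mon [simp]: "A \<in> K \<Longrightarrow> monoid A"
  using comm comm_monoid.axioms(1) by blast

sublocale category V
  by (rule category_on) simp

lemma p_closed [simp]:
  "A \<in> K \<Longrightarrow> B \<in> K \<Longrightarrow> a \<in> carrier A \<Longrightarrow> b \<in> carrier B \<Longrightarrow> p A B a b \<in> carrier (t A B)"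
  by (rule bihom_closed[OF p_bihom])

lemma p_left: "A \<in> K \<Longrightarrow> B \<in> K \<Longrightarrow> b \<in> carrier B \<Longrightarrow> (\<lambda>a. p A B a b) \<in> unital_hom A (t A B)"
  by (rule bihom_left[OF p_bihom])

lemma p_right: "A \<in> K \<Longrightarrow> B \<in> K \<Longrightarrow> a \<in> carrier A \<Longrightarrow> p A B a \<in> unital_hom B (t A B)"
  by (rule bihom_right[OF p_bihom])

text \<open>With the last variable fixed, \<open>h\<close> and \<open>k\<close> become homomorphisms
  on \<open>t A B\<close>, to which uniqueness applies once more. The same currying gives the
  extensionality rules for the other bracketings and for tensor factors \<open>U\<close>.\<close>

lemma p_ext_left:
  assumes "A \<in> K" "B \<in> K" "C \<in> K" "D \<in> K"
    and h: "h \<in> unital_hom (t (t A B) C) D" and k: "k \<in> unital_hom (t (t A B) C) D"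
    and eq: "\<And>a b c. a \<in> carrier A \<Longrightarrow> b \<in> carrier B \<Longrightarrow> c \<in> carrier C \<Longrightarrow>
      h (p (t A B) C (p A B a b) c) = k (p (t A B) C (p A B a b) c)"
    and "x \<in> carrier (t (t A B) C)"
  shows "h x = k x"
proof (rule p_ext[OF _ _ _ h k _ assms(8)])
  fix y c assume "y \<in> carrier (t A B)" and c: "c \<in> carrier C"
  show "h (p (t A B) C y c) = k (p (t A B) C y c)"
    by (rule p_ext[OF _ _ _ unital_hom_comp[OF p_left h] unital_hom_comp[OF p_left k]])
      (use assms c eq \<open>y \<in> carrier (t A B)\<close> in auto)
qed (use assms in auto)

lemma p_ext_right:
  assumes "A \<in> K" "B \<in> K" "C \<in> K" "D \<in> K"
    and h: "h \<in> unital_hom (t A (t B C)) D" and k: "k \<in> unital_hom (t A (t B C)) D"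
    and eq: "\<And>a b c. a \<in> carrier A \<Longrightarrow> b \<in> carrier B \<Longrightarrow> c \<in> carrier C \<Longrightarrow>
      h (p A (t B C) a (p B C b c)) = k (p A (t B C) a (p B C b c))"
    and "x \<in> carrier (t A (t B C))"
  shows "h x = k x"
proof (rule p_ext[OF _ _ _ h k _ assms(8)])
  fix a y assume "y \<in> carrier (t B C)" and a: "a \<in> carrier A"
  show "h (p A (t B C) a y) = k (p A (t B C) a y)"
    by (rule p_ext[OF _ _ _ unital_hom_comp[OF p_right h] unital_hom_comp[OF p_right k]])
      (use assms a eq \<open>y \<in> carrier (t B C)\<close> in auto)
qed (use assms in auto)

lemma p_ext_left2:
  assumes "A \<in> K" "B \<in> K" "C \<in> K" "D \<in> K" "L \<in> K"
    and h: "h \<in> unital_hom (t (t (t A B) C) D) L" and k: "k \<in> unital_hom (t (t (t A B) C) D) L"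
    and eq: "\<And>a b c d. a \<in> carrier A \<Longrightarrow> b \<in> carrier B \<Longrightarrow> c \<in> carrier C \<Longrightarrow> d \<in> carrier D \<Longrightarrow>
      h (p (t (t A B) C) D (p (t A B) C (p A B a b) c) d) =
      k (p (t (t A B) C) D (p (t A B) C (p A B a b) c) d)"
    and "x \<in> carrier (t (t (t A B) C) D)"
  shows "h x = k x"
proof (rule p_ext[OF _ _ _ h k _ assms(9)])
  fix y d assume "y \<in> carrier (t (t A B) C)" and d: "d \<in> carrier D"
  show "h (p (t (t A B) C) D y d) = k (p (t (t A B) C) D y d)"
    by (rule p_ext_left[OF _ _ _ _ unital_hom_comp[OF p_left h] unital_hom_comp[OF p_left k]])
      (use assms d eq \<open>y \<in> carrier (t (t A B) C)\<close> in auto)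
qed (use assms in auto)

lemma p_ext_lunit:
  assumes "A \<in> K" "B \<in> K" and h: "h \<in> unital_hom (t U A) B" and k: "k \<in> unital_hom (t U A) B"
    and eq: "\<And>a. a \<in> carrier A \<Longrightarrow> h (p U A u a) = k (p U A u a)"
    and "x \<in> carrier (t U A)"
  shows "h x = k x"
proof (rule p_ext[OF _ _ _ h k _ assms(6)])
  fix y a assume "y \<in> carrier U" and a: "a \<in> carrier A"
  show "h (p U A y a) = k (p U A y a)"
    by (rule free_ext[OF _ unital_hom_comp[OF p_left h] unital_hom_comp[OF p_left k]])
      (use assms a eq \<open>y \<in> carrier U\<close> in auto)
qed (use assms in auto)

lemma p_ext_runit:
  assumes "A \<in> K" "B \<in> K" and h: "h \<in> unital_hom (t A U) B" and k: "k \<in> unital_hom (t A U) B"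
    and eq: "\<And>a. a \<in> carrier A \<Longrightarrow> h (p A U a u) = k (p A U a u)"
    and "x \<in> carrier (t A U)"
  shows "h x = k x"
proof (rule p_ext[OF _ _ _ h k _ assms(6)])
  fix a y assume "y \<in> carrier U" and a: "a \<in> carrier A"
  show "h (p A U a y) = k (p A U a y)"
    by (rule free_ext[OF _ unital_hom_comp[OF p_right h] unital_hom_comp[OF p_right k]])
      (use assms a eq \<open>y \<in> carrier U\<close> in auto)
qed (use assms in auto)

lemma p_ext_unit_left:
  assumes "A \<in> K" "B \<in> K" "D \<in> K"
    and h: "h \<in> unital_hom (t (t A U) B) D" and k: "k \<in> unital_hom (t (t A U) B) D"
    and eq: "\<And>a b. a \<in> carrier A \<Longrightarrow> b \<in> carrier B \<Longrightarrow>
      h (p (t A U) B (p A U a u) b) = k (p (t A U) B (p A U a u) b)"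
    and "x \<in> carrier (t (t A U) B)"
  shows "h x = k x"
proof (rule p_ext[OF _ _ _ h k _ assms(7)])
  fix y b assume "y \<in> carrier (t A U)" and b: "b \<in> carrier B"
  show "h (p (t A U) B y b) = k (p (t A U) B y b)"
    by (rule p_ext_runit[OF _ _ unital_hom_comp[OF p_left h] unital_hom_comp[OF p_left k]])
      (use assms b eq \<open>y \<in> carrier (t A U)\<close> in auto)
qed (use assms in auto)

text \<open>Each \<open>c\<close> gives a lift to \<open>t A B\<close>. That the chosen lifts depend
  homomorphically on \<open>c\<close> follows from uniqueness: both sides of each law are
  homomorphisms on \<open>t A B\<close> with the same values on pure elements. Commutativity of
  \<open>D\<close> makes the pointwise product a homomorphism.\<close>

lemma lift_parametrized:
  assumes K: "A \<in> K" "B \<in> K" "C \<in> K" "D \<in> K"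
    and bi: "\<And>c. c \<in> carrier C \<Longrightarrow> (\<lambda>a b. \<tau> a b c) \<in> bihom A B D"
    and hom: "\<And>a b. a \<in> carrier A \<Longrightarrow> b \<in> carrier B \<Longrightarrow> \<tau> a b \<in> unital_hom C D"
  obtains \<gamma> where "\<gamma> \<in> bihom (t A B) C D"
    "\<And>a b c. a \<in> carrier A \<Longrightarrow> b \<in> carrier B \<Longrightarrow> c \<in> carrier C \<Longrightarrow> \<gamma> (p A B a b) c = \<tau> a b c"
proof -
  interpret C: monoid C using K by simp
  interpret D: comm_monoid D using K by (simp add: comm)
  have "\<forall>c \<in> carrier C. \<exists>h. h \<in> unital_hom (t A B) D \<and>
      (\<forall>a \<in> carrier A. \<forall>b \<in> carrier B. h (p A B a b) = \<tau> a b c)"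
    using p_lift[OF K(1,2,4) bi] by blast
  then obtain H where H: "\<And>c. c \<in> carrier C \<Longrightarrow> H c \<in> unital_hom (t A B) D"
    "\<And>a b c. c \<in> carrier C \<Longrightarrow> a \<in> carrier A \<Longrightarrow> b \<in> carrier B \<Longrightarrow> H c (p A B a b) = \<tau> a b c"
    by metis
  have "(\<lambda>c. H c x) \<in> unital_hom C D" if x: "x \<in> carrier (t A B)" for x
  proof (rule unital_homI)
    fix c assume "c \<in> carrier C"
    then show "H c x \<in> carrier D" using x by (intro unital_hom_closed[OF H(1)])
  next
    fix c c' assume c: "c \<in> carrier C" "c' \<in> carrier C"
    show "H (c \<otimes>\<^bsub>C\<^esub> c') x = H c x \<otimes>\<^bsub>D\<^esub> H c' x"
      by (rule p_ext[OF _ _ _ H(1) unital_hom_pointwise_mult[OF _ H(1) H(1)]])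
        (use K c x in \<open>auto simp: H(2) unital_hom_mult[OF hom] D.comm_monoid_axioms\<close>)
  next
    show "H \<one>\<^bsub>C\<^esub> x = \<one>\<^bsub>D\<^esub>"
      by (rule p_ext[OF _ _ _ H(1) unital_hom_const_one])
        (use K x in \<open>auto simp: H(2) unital_hom_one[OF hom] D.monoid_axioms\<close>)
  qed
  then show thesis
    using H by (intro that[of "\<lambda>x c. H c x"]) (auto simp: bihom_def)
qed

text \<open>The action by multiples behind both unitors: \<open>x\<close> in \<open>U\<close> acts
  on \<open>a\<close> by the homomorphism \<open>U -> A\<close> that takes \<open>u\<close> to
  \<open>a\<close>, evaluated at \<open>x\<close>. Additivity in \<open>a\<close> is uniqueness of
  homomorphisms out of the free object.\<close>

lemma free_action:
  assumes "A \<in> K"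
  obtains \<gamma> where "\<gamma> \<in> bihom U A A" "\<And>a. a \<in> carrier A \<Longrightarrow> \<gamma> u a = a"
proof -
  interpret A: comm_monoid A using assms by (simp add: comm)
  obtain H where H: "\<And>a. a \<in> carrier A \<Longrightarrow> H a \<in> unital_hom U A"
    "\<And>a. a \<in> carrier A \<Longrightarrow> H a u = a"
    using free_lift[OF assms] by metis
  have "(\<lambda>a. H a x) \<in> unital_hom A A" if x: "x \<in> carrier U" for x
  proof (rule unital_homI)
    fix a assume "a \<in> carrier A"
    then show "H a x \<in> carrier A" using x by (intro unital_hom_closed[OF H(1)])
  next
    fix a a' assume "a \<in> carrier A" "a' \<in> carrier A"
    note aa = this
    show "H (a \<otimes>\<^bsub>A\<^esub> a') x = H a x \<otimes>\<^bsub>A\<^esub> H a' x"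
      by (rule free_ext[OF assms H(1) unital_hom_pointwise_mult[OF _ H(1) H(1)]])
        (use x aa in \<open>auto simp: H(2) A.comm_monoid_axioms\<close>)
  next
    show "H \<one>\<^bsub>A\<^esub> x = \<one>\<^bsub>A\<^esub>"
      by (rule free_ext[OF assms H(1) unital_hom_const_one])
        (use x in \<open>auto simp: H(2) A.monoid_axioms\<close>)
  qed
  then show thesis
    using H by (intro that[of "\<lambda>x a. H a x"]) (auto simp: bihom_def)
qed

lemma fun_of_ten_arr:
  assumes "f \<in> Arr V" "g \<in> Arr V"
  shows "ten_arr V f g \<in> Arr V \<and> (\<forall>a \<in> carrier (src f). \<forall>b \<in> carrier (src g).
    fun_of (ten_arr V f g) (p (src f) (src g) a b) = p (tgt f) (tgt g) (fun_of f a) (fun_of g b))"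
proof -
  let ?A = "src f" and ?B = "src g" and ?A' = "tgt f" and ?B' = "tgt g"
  have K: "?A \<in> K" "?B \<in> K" "?A' \<in> K" "?B' \<in> K" using assms by simp_all
  obtain h where h: "h \<in> unital_hom (t ?A ?B) (t ?A' ?B')"
    "\<And>a b. a \<in> carrier ?A \<Longrightarrow> b \<in> carrier ?B \<Longrightarrow> h (p ?A ?B a b) = p ?A' ?B' (fun_of f a) (fun_of g b)"
    using p_lift[OF K(1,2) tensor_closed[OF K(3,4)]
        bihom_precomp[OF p_bihom[OF K(3,4)] Arr_hom[OF assms(1)] Arr_hom[OF assms(2)]]] by blast
  have "(THE h. h \<in> monoid_hom (t ?A ?B) (t ?A' ?B') \<and>
      (\<forall>a \<in> carrier ?A. \<forall>b \<in> carrier ?B. h (p ?A ?B a b) = p ?A' ?B' (fun_of f a) (fun_of g b))) =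
      restrict h (carrier (t ?A ?B))"
  proof (rule the_monoid_hom[OF _ h(1)])
    fix k x assume "k \<in> unital_hom (t ?A ?B) (t ?A' ?B')" and "x \<in> carrier (t ?A ?B)"
      and "\<forall>a \<in> carrier ?A. \<forall>b \<in> carrier ?B. k (p ?A ?B a b) = p ?A' ?B' (fun_of f a) (fun_of g b)"
    note k = this
    show "k x = h x"
      by (rule p_ext[OF _ _ _ _ h(1)]) (use K k in \<open>auto simp: h(2)\<close>)
  qed (use K in \<open>auto simp: h(2)\<close>)
  then have eq: "ten_arr V f g = mon_arr_on (t ?A ?B) (t ?A' ?B') h"
    by (simp only: ten_arr_on_eq mon_arr_on_def)
  show ?thesis
    unfolding eq using K by (simp add: h(2) mon_arr_on_Arr[OF _ _ _ h(1)])
qed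

lemma fun_of_assoc:
  assumes K: "A \<in> K" "B \<in> K" "C \<in> K"
  shows "assoc V A B C \<in> Arr V \<and> (\<forall>a \<in> carrier A. \<forall>b \<in> carrier B. \<forall>c \<in> carrier C.
    fun_of (assoc V A B C) (p (t A B) C (p A B a b) c) = p A (t B C) a (p B C b c))"
proof -
  let ?L = "t (t A B) C" and ?R = "t A (t B C)"
  have bi: "(\<lambda>a b. p A (t B C) a (p B C b c)) \<in> bihom A B ?R" if "c \<in> carrier C" for c
    using bihom_precomp[OF p_bihom unital_hom_id p_left] K that by simp
  have hom: "(\<lambda>c. p A (t B C) a (p B C b c)) \<in> unital_hom C ?R"
    if "a \<in> carrier A" "b \<in> carrier B" for a b
    using unital_hom_comp[OF p_right p_right] K that by simp
  obtain \<gamma> where \<gamma>: "\<gamma> \<in> bihom (t A B) C ?R"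
    "\<And>a b c. a \<in> carrier A \<Longrightarrow> b \<in> carrier B \<Longrightarrow> c \<in> carrier C \<Longrightarrow>
      \<gamma> (p A B a b) c = p A (t B C) a (p B C b c)"
    using lift_parametrized[of A B C ?R "\<lambda>a b c. p A (t B C) a (p B C b c)"] K bi hom by auto
  obtain h where h: "h \<in> unital_hom ?L ?R"
    "\<And>x c. x \<in> carrier (t A B) \<Longrightarrow> c \<in> carrier C \<Longrightarrow> h (p (t A B) C x c) = \<gamma> x c"
    using p_lift[OF _ _ _ \<gamma>(1)] K by auto
  have "(THE h. h \<in> monoid_hom ?L ?R \<and> (\<forall>a \<in> carrier A. \<forall>b \<in> carrier B. \<forall>c \<in> carrier C.
      h (p (t A B) C (p A B a b) c) = p A (t B C) a (p B C b c))) = restrict h (carrier ?L)"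
  proof (rule the_monoid_hom[OF _ h(1)])
    fix k x assume "k \<in> unital_hom ?L ?R" and "x \<in> carrier ?L"
      and "\<forall>a \<in> carrier A. \<forall>b \<in> carrier B. \<forall>c \<in> carrier C.
        k (p (t A B) C (p A B a b) c) = p A (t B C) a (p B C b c)"
    note k = this
    show "k x = h x"
      by (rule p_ext_left[OF K _ _ h(1)]) (use K k in \<open>auto simp: h(2) \<gamma>(2)\<close>)
  qed (use K in \<open>auto simp: h(2) \<gamma>(2)\<close>)
  then have eq: "assoc V A B C = mon_arr_on ?L ?R h"
    by (simp only: assoc_on_eq mon_arr_on_def)
  show ?thesis
    unfolding eq using K by (simp add: h(2) \<gamma>(2) mon_arr_on_Arr[OF _ _ _ h(1)])
qed

text \<open>The same lift with the roles permuted: \<open>b\<close> and \<open>c\<close> are bundled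
  first, \<open>a\<close> is the parameter, and swapping the arguments restores their order.\<close>

lemma assoc_inverse:
  assumes K: "A \<in> K" "B \<in> K" "C \<in> K"
  obtains h where "h \<in> unital_hom (t A (t B C)) (t (t A B) C)"
    "\<And>a b c. a \<in> carrier A \<Longrightarrow> b \<in> carrier B \<Longrightarrow> c \<in> carrier C \<Longrightarrow>
      h (p A (t B C) a (p B C b c)) = p (t A B) C (p A B a b) c"
proof -
  let ?L = "t (t A B) C" and ?R = "t A (t B C)"
  have bi: "(\<lambda>b c. p (t A B) C (p A B a b) c) \<in> bihom B C ?L" if "a \<in> carrier A" for a
    using bihom_precomp[OF p_bihom p_right unital_hom_id] K that by simp
  have hom: "(\<lambda>a. p (t A B) C (p A B a b) c) \<in> unital_hom A ?L"
    if "b \<in> carrier B" "c \<in> carrier C" for b c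
    using unital_hom_comp[OF p_left p_left] K that by simp
  obtain \<gamma> where \<gamma>: "\<gamma> \<in> bihom (t B C) A ?L"
    "\<And>b c a. b \<in> carrier B \<Longrightarrow> c \<in> carrier C \<Longrightarrow> a \<in> carrier A \<Longrightarrow>
      \<gamma> (p B C b c) a = p (t A B) C (p A B a b) c"
    using lift_parametrized[of B C A ?L "\<lambda>b c a. p (t A B) C (p A B a b) c"] K bi hom by auto
  obtain h where h: "h \<in> unital_hom ?R ?L"
    "\<And>a x. a \<in> carrier A \<Longrightarrow> x \<in> carrier (t B C) \<Longrightarrow> h (p A (t B C) a x) = \<gamma> x a"
    using p_lift[OF _ _ _ bihom_swap[OF \<gamma>(1)]] K by auto
  then show thesis
    using K by (intro that[OF h(1)]) (auto simp: h(2) \<gamma>(2))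
qed

lemma fun_of_lunit:
  assumes K: "A \<in> K"
  shows "lunit V A \<in> Arr V \<and> (\<forall>a \<in> carrier A. fun_of (lunit V A) (p U A u a) = a)"
proof -
  obtain \<gamma> where \<gamma>: "\<gamma> \<in> bihom U A A" "\<And>a. a \<in> carrier A \<Longrightarrow> \<gamma> u a = a"
    using free_action[OF K] by metis
  obtain h where h: "h \<in> unital_hom (t U A) A"
    "\<And>x a. x \<in> carrier U \<Longrightarrow> a \<in> carrier A \<Longrightarrow> h (p U A x a) = \<gamma> x a"
    using p_lift[OF _ _ _ \<gamma>(1)] K by auto
  have "(THE h. h \<in> monoid_hom (t U A) A \<and> (\<forall>a \<in> carrier A. h (p U A u a) = a)) =
      restrict h (carrier (t U A))"
  proof (rule the_monoid_hom[OF _ h(1)])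
    fix k x assume "k \<in> unital_hom (t U A) A" "x \<in> carrier (t U A)" "\<forall>a \<in> carrier A. k (p U A u a) = a"
    note k = this
    show "k x = h x"
      by (rule p_ext_lunit[OF K K _ h(1)]) (use K k in \<open>auto simp: h(2) \<gamma>(2)\<close>)
  qed (use K in \<open>auto simp: h(2) \<gamma>(2)\<close>)
  then have eq: "lunit V A = mon_arr_on (t U A) A h"
    by (simp only: lunit_on_eq mon_arr_on_def)
  show ?thesis
    unfolding eq using K by (simp add: h(2) \<gamma>(2) mon_arr_on_Arr[OF _ _ _ h(1)])
qed

lemma fun_of_runit:
  assumes K: "A \<in> K"
  shows "runit V A \<in> Arr V \<and> (\<forall>a \<in> carrier A. fun_of (runit V A) (p A U a u) = a)"
proof -
  obtain \<gamma> where \<gamma>: "\<gamma> \<in> bihom U A A" "\<And>a. a \<in> carrier A \<Longrightarrow> \<gamma> u a = a"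
    using free_action[OF K] by metis
  obtain h where h: "h \<in> unital_hom (t A U) A"
    "\<And>x a. x \<in> carrier U \<Longrightarrow> a \<in> carrier A \<Longrightarrow> h (p A U a x) = \<gamma> x a"
    using p_lift[OF _ _ _ bihom_swap[OF \<gamma>(1)]] K by auto
  have "(THE h. h \<in> monoid_hom (t A U) A \<and> (\<forall>a \<in> carrier A. h (p A U a u) = a)) =
      restrict h (carrier (t A U))"
  proof (rule the_monoid_hom[OF _ h(1)])
    fix k x assume "k \<in> unital_hom (t A U) A" "x \<in> carrier (t A U)" "\<forall>a \<in> carrier A. k (p A U a u) = a"
    note k = this
    show "k x = h x"
      by (rule p_ext_runit[OF K K _ h(1)]) (use K k in \<open>auto simp: h(2) \<gamma>(2)\<close>)
  qed (use K in \<open>auto simp: h(2) \<gamma>(2)\<close>)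
  then have eq: "runit V A = mon_arr_on (t A U) A h"
    by (simp only: runit_on_eq mon_arr_on_def)
  show ?thesis
    unfolding eq using K by (simp add: h(2) \<gamma>(2) mon_arr_on_Arr[OF _ _ _ h(1)])
qed

lemma Arr_simps [simp]:
  "A \<in> K \<Longrightarrow> Id V A \<in> Arr V"
  "f \<in> Arr V \<Longrightarrow> g \<in> Arr V \<Longrightarrow> tgt f = src g \<Longrightarrow> Comp V g f \<in> Arr V"
  "f \<in> Arr V \<Longrightarrow> g \<in> Arr V \<Longrightarrow> ten_arr V f g \<in> Arr V"
  "A \<in> K \<Longrightarrow> B \<in> K \<Longrightarrow> C \<in> K \<Longrightarrow> assoc V A B C \<in> Arr V"
  "A \<in> K \<Longrightarrow> lunit V A \<in> Arr V"
  "A \<in> K \<Longrightarrow> runit V A \<in> Arr V"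
  using Id_in_Homset fun_of_ten_arr fun_of_assoc fun_of_lunit fun_of_runit
  by (auto simp: Homset_def)

lemma ten_arr_apply [simp]:
  "f \<in> Arr V \<Longrightarrow> g \<in> Arr V \<Longrightarrow> src f = A \<Longrightarrow> src g = B \<Longrightarrow> a \<in> carrier A \<Longrightarrow> b \<in> carrier B \<Longrightarrow>
    fun_of (ten_arr V f g) (p A B a b) = p (tgt f) (tgt g) (fun_of f a) (fun_of g b)"
  using fun_of_ten_arr by blast

lemma assoc_apply [simp]:
  "A \<in> K \<Longrightarrow> B \<in> K \<Longrightarrow> C \<in> K \<Longrightarrow> a \<in> carrier A \<Longrightarrow> b \<in> carrier B \<Longrightarrow> c \<in> carrier C \<Longrightarrow>
    fun_of (assoc V A B C) (p (t A B) C (p A B a b) c) = p A (t B C) a (p B C b c)"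
  using fun_of_assoc by blast

lemma lunit_apply [simp]: "A \<in> K \<Longrightarrow> a \<in> carrier A \<Longrightarrow> fun_of (lunit V A) (p U A u a) = a"
  using fun_of_lunit by blast

lemma runit_apply [simp]: "A \<in> K \<Longrightarrow> a \<in> carrier A \<Longrightarrow> fun_of (runit V A) (p A U a u) = a"
  using fun_of_runit by blast

lemma Arr_unital_hom:
  "f \<in> Arr V \<Longrightarrow> src f = A \<Longrightarrow> tgt f = B \<Longrightarrow> fun_of f \<in> unital_hom A B"
  by (drule Arr_hom) simp

lemmas Arr_eq_onI = Arr_eqI[where K = K and U = U and u = u and t = t and p = p]

lemma Arr_eq_hom:
  assumes "f \<in> Arr V" "f' \<in> Arr V" "src f = A" "src f' = A" "tgt f = tgt f'"
    and "\<And>x. fun_of f \<in> unital_hom A (tgt f) \<Longrightarrow> fun_of f' \<in> unital_hom A (tgt f) \<Longrightarrow>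
      x \<in> carrier A \<Longrightarrow> fun_of f x = fun_of f' x"
  shows "f = f'"
  using assms(3-6) Arr_hom[OF assms(1)] Arr_hom[OF assms(2)]
  by (intro Arr_eq_onI[OF assms(1,2)]) auto

lemma Arr_eq_tensor:
  assumes "f \<in> Arr V" "f' \<in> Arr V" "src f = t A B" "src f' = t A B" "tgt f = tgt f'"
    and "A \<in> K" "B \<in> K"
    and "\<And>a b. a \<in> carrier A \<Longrightarrow> b \<in> carrier B \<Longrightarrow> fun_of f (p A B a b) = fun_of f' (p A B a b)"
  shows "f = f'"
  by (rule Arr_eq_hom[OF assms(1-5)]) (rule p_ext[OF assms(6,7)], use assms in auto)

lemma Arr_eq_left:
  assumes "f \<in> Arr V" "f' \<in> Arr V" "src f = t (t A B) C" "src f' = t (t A B) C" "tgt f = tgt f'"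
    and "A \<in> K" "B \<in> K" "C \<in> K"
    and "\<And>a b c. a \<in> carrier A \<Longrightarrow> b \<in> carrier B \<Longrightarrow> c \<in> carrier C \<Longrightarrow>
      fun_of f (p (t A B) C (p A B a b) c) = fun_of f' (p (t A B) C (p A B a b) c)"
  shows "f = f'"
  by (rule Arr_eq_hom[OF assms(1-5)]) (rule p_ext_left[OF assms(6,7,8)], use assms in auto)

lemma Arr_eq_left2:
  assumes "f \<in> Arr V" "f' \<in> Arr V" "src f = t (t (t A B) C) D" "src f' = t (t (t A B) C) D" "tgt f = tgt f'"
    and "A \<in> K" "B \<in> K" "C \<in> K" "D \<in> K"
    and "\<And>a b c d. a \<in> carrier A \<Longrightarrow> b \<in> carrier B \<Longrightarrow> c \<in> carrier C \<Longrightarrow> d \<in> carrier D \<Longrightarrow>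
      fun_of f (p (t (t A B) C) D (p (t A B) C (p A B a b) c) d) = fun_of f' (p (t (t A B) C) D (p (t A B) C (p A B a b) c) d)"
  shows "f = f'"
  by (rule Arr_eq_hom[OF assms(1-5)]) (rule p_ext_left2[OF assms(6,7,8,9)], use assms in auto)

lemma Arr_eq_lunit:
  assumes "f \<in> Arr V" "f' \<in> Arr V" "src f = t U A" "src f' = t U A" "tgt f = tgt f'"
    and "A \<in> K"
    and "\<And>a. a \<in> carrier A \<Longrightarrow>
      fun_of f (p U A u a) = fun_of f' (p U A u a)"
  shows "f = f'"
  by (rule Arr_eq_hom[OF assms(1-5)]) (rule p_ext_lunit[OF assms(6)], use assms in auto)

lemma Arr_eq_runit:
  assumes "f \<in> Arr V" "f' \<in> Arr V" "src f = t A U" "src f' = t A U" "tgt f = tgt f'"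
    and "A \<in> K"
    and "\<And>a. a \<in> carrier A \<Longrightarrow>
      fun_of f (p A U a u) = fun_of f' (p A U a u)"
  shows "f = f'"
  by (rule Arr_eq_hom[OF assms(1-5)]) (rule p_ext_runit[OF assms(6)], use assms in auto)

lemma Arr_eq_unit_left:
  assumes "f \<in> Arr V" "f' \<in> Arr V" "src f = t (t A U) B" "src f' = t (t A U) B" "tgt f = tgt f'"
    and "A \<in> K" "B \<in> K"
    and "\<And>a b. a \<in> carrier A \<Longrightarrow> b \<in> carrier B \<Longrightarrow>
      fun_of f (p (t A U) B (p A U a u) b) = fun_of f' (p (t A U) B (p A U a u) b)"
  shows "f = f'"
  by (rule Arr_eq_hom[OF assms(1-5)]) (rule p_ext_unit_left[OF assms(6,7)], use assms in auto)

text \<open>In the last premise the composite is abstracted to a homomorphism \<open>k\<close>, so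
  that an extensionality rule can compare it with the identity before its definition is
  used.\<close>

lemma Isoset_onI:
  assumes "f \<in> Arr V" "src f = A" "tgt f = B" "h \<in> unital_hom B A"
    and "\<And>x. x \<in> carrier B \<Longrightarrow> fun_of f (h x) = x"
    and "\<And>k x. k \<in> unital_hom A A \<Longrightarrow> x \<in> carrier A \<Longrightarrow> k = (\<lambda>x. h (fun_of f x)) \<Longrightarrow> k x = x"
  shows "f \<in> Isoset V A B"
proof -
  have K: "A \<in> K" "B \<in> K" using assms by auto
  let ?g = "mon_arr_on B A h"
  have g: "?g \<in> Arr V" using K assms(4) by (simp add: mon_arr_on_Arr)
  have hf: "h (fun_of f x) = x" if "x \<in> carrier A" for x
    using assms(6)[OF unital_hom_comp[OF Arr_unital_hom[OF assms(1-3)] assms(4)] that] by simp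
  have f_closed: "fun_of f x \<in> carrier B" if "x \<in> carrier A" for x
    using Arr_closed[OF assms(1)] that assms(2,3) by simp
  have h_closed: "h x \<in> carrier A" if "x \<in> carrier B" for x
    using unital_hom_closed[OF assms(4)] that by simp
  have "Comp V ?g f = Id V A"
    by (rule Arr_eq_onI) (use K assms(1-3) g in \<open>simp_all add: f_closed hf\<close>)
  moreover have "Comp V f ?g = Id V B"
    by (rule Arr_eq_onI) (use K assms(1-3,5) g in \<open>simp_all add: h_closed\<close>)
  ultimately show ?thesis
    using assms(1-3) g by (auto simp: Isoset_def is_iso_def Homset_def)
qed

text \<open>Every law equates two homomorphisms out of an iterated tensor product, so it is enough
  to evaluate both on pure elements, with \<open>u\<close> in each unit slot. The unitors are
  inverted by \<open>a \<mapsto> u \<otimes> a\<close> and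
  \<open>a \<mapsto> a \<otimes> u\<close>.\<close>

sublocale monoidal_category V
proof (unfold_locales, goal_cases)
  case (3 x y)
  then show ?case by - (rule Arr_eq_tensor[of _ _ x y], auto)
next
  case (4 f x x' f' x'' g y y' g' y'')
  then show ?case by - (rule Arr_eq_tensor[of _ _ x y], auto simp: Homset_def)
next
  case (6 x y z)
  obtain h where h: "h \<in> unital_hom (t x (t y z)) (t (t x y) z)"
    "\<And>a b c. a \<in> carrier x \<Longrightarrow> b \<in> carrier y \<Longrightarrow> c \<in> carrier z \<Longrightarrow>
      h (p x (t y z) a (p y z b c)) = p (t x y) z (p x y a b) c"
    using assoc_inverse[of x y z] 6 by auto
  have "assoc V x y z \<in> Isoset V (t (t x y) z) (t x (t y z))"
  proof (rule Isoset_onI[OF _ _ _ h(1)])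
    fix w assume w: "w \<in> carrier (t x (t y z))"
    have assoc_hom: "fun_of (assoc V x y z) \<in> unital_hom (t (t x y) z) (t x (t y z))"
      using 6 by (intro Arr_unital_hom) auto
    show "fun_of (assoc V x y z) (h w) = w"
      by (rule p_ext_right[OF _ _ _ _ unital_hom_comp[OF h(1) assoc_hom] unital_hom_id])
        (use 6 w in \<open>auto simp: h(2)\<close>)
  next
    fix k w assume "k \<in> unital_hom (t (t x y) z) (t (t x y) z)" "w \<in> carrier (t (t x y) z)"
      "k = (\<lambda>w. h (fun_of (assoc V x y z) w))"
    note k = this
    show "k w = w"
      by (rule p_ext_left[OF _ _ _ _ _ unital_hom_id]) (use 6 k in \<open>auto simp: h(2)\<close>)
  qed (use 6 in auto)
  then show ?case by simp
next
  case (7 f x x' g y y' h z z')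
  then have "x \<in> K" "y \<in> K" "z \<in> K" "x' \<in> K" "y' \<in> K" "z' \<in> K" by (auto simp: Homset_def)
  with 7 show ?case
    by - (rule Arr_eq_left[of _ _ x y z], auto simp: Homset_def)
next
  case (8 x)
  have "lunit V x \<in> Isoset V (t U x) x"
  proof (rule Isoset_onI[OF _ _ _ p_right[of U x u]])
    fix k w assume "k \<in> unital_hom (t U x) (t U x)" "w \<in> carrier (t U x)"
      "k = (\<lambda>w. p U x u (fun_of (lunit V x) w))"
    note k = this
    show "k w = w"
      by (rule p_ext_lunit[OF _ _ _ unital_hom_id]) (use 8 k in auto)
  qed (use 8 in auto)
  then show ?case by simp
next
  case (9 f x x')
  then have "x \<in> K" "x' \<in> K" by (auto simp: Homset_def)
  with 9 show ?case
    by - (rule Arr_eq_lunit[of _ _ x], auto simp: Homset_def)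
next
  case (10 x)
  have "runit V x \<in> Isoset V (t x U) x"
  proof (rule Isoset_onI[OF _ _ _ p_left[of x U u]])
    fix k w assume "k \<in> unital_hom (t x U) (t x U)" "w \<in> carrier (t x U)"
      "k = (\<lambda>w. p x U (fun_of (runit V x) w) u)"
    note k = this
    show "k w = w"
      by (rule p_ext_runit[OF _ _ _ unital_hom_id]) (use 10 k in auto)
  qed (use 10 in auto)
  then show ?case by simp
next
  case (11 f x x')
  then have "x \<in> K" "x' \<in> K" by (auto simp: Homset_def)
  with 11 show ?case
    by - (rule Arr_eq_runit[of _ _ x], auto simp: Homset_def)
next
  case (12 w x y z)
  then show ?case
    by - (rule Arr_eq_left2[of _ _ w x y z], auto)
next
  case (13 x y)
  then show ?case
    by - (rule Arr_eq_unit_left[of _ _ x y], auto)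
qed (auto simp: Homset_def)

end

text \<open>Universal properties survive transport along a bijection. The injections
  \<open>e A B\<close> and \<open>i\<close> may therefore be chosen at will, separately for each
  pair and for the unit.\<close>

lemma tensor_structure_copy:
  assumes K: "\<And>A. A \<in> K \<Longrightarrow> comm_monoid A"
    and inj: "\<And>A B. A \<in> K \<Longrightarrow> B \<in> K \<Longrightarrow> inj_on (e A B) (carrier (ten_quot A B))"
    and closed: "\<And>A B. A \<in> K \<Longrightarrow> B \<in> K \<Longrightarrow> copy (e A B) (ten_quot A B) \<in> K"
    and W: "monoid W" "w \<in> carrier W" and i: "inj_on i (carrier W)" "copy i W \<in> K"
    and lift: "\<And>A a. A \<in> K \<Longrightarrow> a \<in> carrier A \<Longrightarrow> \<exists>h \<in> unital_hom W A. h w = a"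
    and ext: "\<And>A h k x. A \<in> K \<Longrightarrow> h \<in> unital_hom W A \<Longrightarrow> k \<in> unital_hom W A \<Longrightarrow> h w = k w \<Longrightarrow>
      x \<in> carrier W \<Longrightarrow> h x = k x"
  shows "tensor_structure K (copy i W) (i w) (\<lambda>A B. copy (e A B) (ten_quot A B))
    (\<lambda>A B a b. e A B (ten_class A B {#(a, b)#}))"
proof (rule tensor_structure.intro, goal_cases)
  case (5 A a)
  then obtain h where h: "h \<in> unital_hom W A" "h w = a" using lift by blast
  show ?case
    by (rule bexI[OF _ unital_hom_comp[OF copy_inv_hom[OF W(1) i(1)] h(1)]]) (simp add: i(1) W(2) h(2))
next
  case (6 A h k x)
  then obtain y where y: "y \<in> carrier W" "x = i y" by auto
  have "h (i y) = k (i y)"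
    by (rule ext[OF _ unital_hom_comp[OF copy_hom[OF i(1)]] unital_hom_comp[OF copy_hom[OF i(1)]]])
      (use 6 y in auto)
  then show ?case using y by simp
next
  case (7 A B)
  interpret tensor_pair A B using 7 K by (simp add: tensor_pair_def)
  show ?case by (rule bihom_comp[OF gen_bihom copy_hom]) (use 7 inj in simp)
next
  case (8 A B C \<beta>)
  interpret tensor_pair A B using 8 K by (simp add: tensor_pair_def)
  interpret Q: comm_monoid "ten_quot A B" by (rule comm_monoid_ten_quot)
  obtain k where k: "k \<in> unital_hom (ten_quot A B) C"
    "\<And>a b. a \<in> carrier A \<Longrightarrow> b \<in> carrier B \<Longrightarrow> k (gen a b) = \<beta> a b"
    using ten_quot_lift[OF K[OF 8(3)] 8(4)] by metis
  have inj': "inj_on (e A B) (carrier (ten_quot A B))" using 8 inj by simp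
  show ?case
    by (rule bexI[OF _ unital_hom_comp[OF copy_inv_hom[OF Q.monoid_axioms inj'] k(1)]])
      (use inj' in \<open>auto simp: k(2) bihom_closed[OF gen_bihom]\<close>)
next
  case (9 A B C h k x)
  interpret tensor_pair A B using 9 K by (simp add: tensor_pair_def)
  have inj': "inj_on (e A B) (carrier (ten_quot A B))" using 9 inj by simp
  obtain y where y: "y \<in> carrier (ten_quot A B)" "x = e A B y" using 9 by auto
  have "h (e A B y) = k (e A B y)"
    by (rule ten_quot_hom_ext[OF unital_hom_comp[OF copy_hom[OF inj']] unital_hom_comp[OF copy_hom[OF inj']]])
      (use 9 y in auto)
  then show ?case using y by simp
qed (use assms in auto)

section \<open>Commutative inverse monoids\<close>

definition star :: "('a, 'x) monoid_scheme \<Rightarrow> 'a \<Rightarrow> 'a" where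
  "star M x = (THE y. y \<in> carrier M \<and> x \<otimes>\<^bsub>M\<^esub> y \<otimes>\<^bsub>M\<^esub> x = x \<and> y \<otimes>\<^bsub>M\<^esub> x \<otimes>\<^bsub>M\<^esub> y = y)"

text \<open>When \<open>M\<close> is viewed as a semilattice of groups, this is the identity of the
  group that contains \<open>x\<close>.\<close>

definition idem_part :: "('a, 'x) monoid_scheme \<Rightarrow> 'a \<Rightarrow> 'a" where
  "idem_part M x = x \<otimes>\<^bsub>M\<^esub> star M x"

text \<open>Only regularity is demanded, which passes easily to copies and quotients; in the
  commutative case the unique inverse can be recovered from it.\<close>

locale comm_inverse_monoid = comm_monoid M for M :: "'a monoid" (structure) +
  assumes regular: "x \<in> carrier M \<Longrightarrow> \<exists>y \<in> carrier M. x \<otimes> y \<otimes> x = x"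
begin

text \<open>If \<open>x y x = x\<close>, then \<open>y x y\<close> satisfies both equations. Any
  other solution \<open>z\<close> is reduced to \<open>y x y\<close> by inserting
  \<open>x = x y x\<close> into \<open>z x z\<close> and reordering.\<close>

lemma ex1_star:
  assumes x: "x \<in> carrier M"
  shows "\<exists>!y. y \<in> carrier M \<and> x \<otimes> y \<otimes> x = x \<and> y \<otimes> x \<otimes> y = y"
proof -
  obtain y where y: "y \<in> carrier M" "x \<otimes> y \<otimes> x = x" using regular x by blast
  show ?thesis
  proof
    have 1: "x \<otimes> (y \<otimes> x \<otimes> y) \<otimes> x = x \<otimes> y \<otimes> x \<otimes> y \<otimes> x"
      "y \<otimes> x \<otimes> y \<otimes> x \<otimes> (y \<otimes> x \<otimes> y) = y \<otimes> (x \<otimes> y \<otimes> x) \<otimes> y \<otimes> x \<otimes> y"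
      using x y(1) by (simp_all add: m_assoc)
    have 2: "y \<otimes> x \<otimes> y \<otimes> x \<otimes> y = y \<otimes> (x \<otimes> y \<otimes> x) \<otimes> y"
      using x y(1) by (simp add: m_assoc)
    show "y \<otimes> x \<otimes> y \<in> carrier M \<and> x \<otimes> (y \<otimes> x \<otimes> y) \<otimes> x = x \<and>
        y \<otimes> x \<otimes> y \<otimes> x \<otimes> (y \<otimes> x \<otimes> y) = y \<otimes> x \<otimes> y"
      using x y 1 2 by simp
  next
    fix z
    assume z: "z \<in> carrier M \<and> x \<otimes> z \<otimes> x = x \<and> z \<otimes> x \<otimes> z = z"
    have "z = y \<otimes> x \<otimes> y" if "y \<in> carrier M" "x \<otimes> y \<otimes> x = x" for y
    proof -
      have zc: "z \<in> carrier M" using z by simp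
      have "z = z \<otimes> x \<otimes> z" using z by simp
      also have "\<dots> = z \<otimes> (x \<otimes> y \<otimes> x) \<otimes> z" using that by simp
      also have "\<dots> = (x \<otimes> z \<otimes> x) \<otimes> (y \<otimes> z)" using that(1) zc x by (simp add: m_ac)
      also have "\<dots> = x \<otimes> (y \<otimes> z)" using z by simp
      also have "\<dots> = (x \<otimes> y \<otimes> x) \<otimes> (y \<otimes> z)" using that by simp
      also have "\<dots> = y \<otimes> (x \<otimes> z \<otimes> x) \<otimes> y" using that(1) zc x by (simp add: m_ac)
      also have "\<dots> = y \<otimes> x \<otimes> y" using z by simp
      finally show ?thesis .
    qed
    then show "z = y \<otimes> x \<otimes> y" using y by simp
  qed
qed

lemma star_props:
  assumes "x \<in> carrier M"
  shows "star M x \<in> carrier M" "x \<otimes> star M x \<otimes> x = x" "star M x \<otimes> x \<otimes> star M x = star M x"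
  using theI'[OF ex1_star[OF assms]] unfolding star_def by blast+

lemma star_eqI:
  "x \<in> carrier M \<Longrightarrow> y \<in> carrier M \<Longrightarrow> x \<otimes> y \<otimes> x = x \<Longrightarrow> y \<otimes> x \<otimes> y = y \<Longrightarrow> star M x = y"
  unfolding star_def by (rule the1_equality[OF ex1_star]) auto

lemma star_mult:
  assumes "x \<in> carrier M" "y \<in> carrier M"
  shows "star M (x \<otimes> y) = star M x \<otimes> star M y"
proof (rule star_eqI)
  let ?x = "star M x" and ?y = "star M y"
  have c: "?x \<in> carrier M" "?y \<in> carrier M" using assms star_props by auto
  have "x \<otimes> y \<otimes> (?x \<otimes> ?y) \<otimes> (x \<otimes> y) = (x \<otimes> ?x \<otimes> x) \<otimes> (y \<otimes> ?y \<otimes> y)"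
    using assms c by (simp add: m_ac)
  then show "x \<otimes> y \<otimes> (?x \<otimes> ?y) \<otimes> (x \<otimes> y) = x \<otimes> y" using assms by (simp add: star_props)
  have "?x \<otimes> ?y \<otimes> (x \<otimes> y) \<otimes> (?x \<otimes> ?y) = (?x \<otimes> x \<otimes> ?x) \<otimes> (?y \<otimes> y \<otimes> ?y)"
    using assms c by (simp add: m_ac)
  then show "?x \<otimes> ?y \<otimes> (x \<otimes> y) \<otimes> (?x \<otimes> ?y) = ?x \<otimes> ?y" using assms by (simp add: star_props)
qed (use assms star_props in auto)

lemma idempotents_iff: "x \<in> idempotents M \<longleftrightarrow> x \<in> carrier M \<and> x \<otimes> x = x"
  by (simp add: idempotents_def)

lemma idempotents_closed: "x \<in> idempotents M \<Longrightarrow> x \<in> carrier M"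
  by (simp add: idempotents_def)

lemma star_idempotent: "e \<in> idempotents M \<Longrightarrow> star M e = e"
  by (rule star_eqI) (auto simp: idempotents_def)

lemma idem_part_idempotent [simp]: "e \<in> idempotents M \<Longrightarrow> idem_part M e = e"
  unfolding idem_part_def by (simp add: star_idempotent) (simp add: idempotents_def)

lemma idem_part_closed [simp]: "x \<in> carrier M \<Longrightarrow> idem_part M x \<in> carrier M"
  by (simp add: idem_part_def star_props)

lemma idem_part_idempotents [simp]:
  assumes "x \<in> carrier M"
  shows "idem_part M x \<in> idempotents M"
proof -
  have "idem_part M x \<otimes> idem_part M x = (x \<otimes> star M x \<otimes> x) \<otimes> star M x"
    using assms star_props(1)[OF assms] unfolding idem_part_def by (simp add: m_assoc)
  then show ?thesis using assms star_props(1,2)[OF assms] by (simp add: idempotents_iff idem_part_def)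
qed

lemma idem_part_absorb [simp]: "x \<in> carrier M \<Longrightarrow> idem_part M x \<otimes> x = x"
  by (simp add: idem_part_def star_props)

lemma idem_part_absorb' [simp]: "x \<in> carrier M \<Longrightarrow> x \<otimes> idem_part M x = x"
  using idem_part_absorb[of x] m_comm[of x "idem_part M x"] by simp

lemma idem_part_mult:
  assumes "x \<in> carrier M" "y \<in> carrier M"
  shows "idem_part M (x \<otimes> y) = idem_part M x \<otimes> idem_part M y"
  unfolding idem_part_def star_mult[OF assms] using assms star_props(1) by (simp add: m_ac)

lemma one_idempotent [simp]: "\<one> \<in> idempotents M"
  by (simp add: idempotents_iff)

lemma mult_idempotents [simp]:
  assumes "e \<in> idempotents M" "f \<in> idempotents M"
  shows "e \<otimes> f \<in> idempotents M"
proof -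
  have "e \<otimes> f \<otimes> (e \<otimes> f) = (e \<otimes> e) \<otimes> (f \<otimes> f)"
    using assms idempotents_closed by (simp add: m_ac)
  then show ?thesis using assms by (simp add: idempotents_iff)
qed

lemma idem_hom: "idem_part M \<in> unital_hom M (idem_monoid M)"
  by (intro unital_homI) (auto simp: idem_monoid_def idem_part_mult)

end

lemma comm_inv_monoid_iff: "comm_inv_monoid M \<longleftrightarrow> comm_inverse_monoid M"
proof
  assume "comm_inv_monoid M"
  then show "comm_inverse_monoid M"
    unfolding comm_inv_monoid_def comm_inverse_monoid_def comm_inverse_monoid_axioms_def by metis
next
  assume "comm_inverse_monoid M"
  then interpret comm_inverse_monoid M .
  show "comm_inv_monoid M"
    unfolding comm_inv_monoid_def using ex1_star comm_monoid_axioms by blast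
qed

lemma carrier_idem_monoid [simp]: "carrier (idem_monoid M) = idempotents M"
  and one_idem_monoid [simp]: "\<one>\<^bsub>idem_monoid M\<^esub> = \<one>\<^bsub>M\<^esub>"
  and mult_idem_monoid [simp]: "x \<in> idempotents M \<Longrightarrow> y \<in> idempotents M \<Longrightarrow>
    x \<otimes>\<^bsub>idem_monoid M\<^esub> y = x \<otimes>\<^bsub>M\<^esub> y"
  by (simp_all add: idem_monoid_def)

lemma (in comm_inverse_monoid) semilattice_idem_monoid: "semilattice_monoid (idem_monoid M)"
  unfolding semilattice_monoid_def
proof
  show "comm_monoid (idem_monoid M)"
    by (rule comm_monoidI) (auto simp: idempotents_closed m_ac)
qed (simp add: idempotents_def)

lemma (in comm_inverse_monoid) idem_inclusion: "(\<lambda>x. x) \<in> unital_hom (idem_monoid M) M"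
  by (intro unital_homI) (auto simp: idempotents_closed)

lemma small_idem_monoid: "small_monoid M \<Longrightarrow> small_monoid (idem_monoid M)"
  unfolding small_monoid_def
  by (auto simp: idem_monoid_def idempotents_def intro: lesspoll_trans1[OF subset_imp_lepoll])

lemma unital_hom_idempotents:
  assumes "h \<in> unital_hom M N" "e \<in> idempotents M"
  shows "h e \<in> idempotents N"
  using assms unital_hom_closed[OF assms(1)] unital_hom_mult[OF assms(1), of e e]
  by (auto simp: idempotents_def)

lemma unital_hom_idem_monoid:
  assumes "h \<in> unital_hom M N"
  shows "h \<in> unital_hom (idem_monoid M) (idem_monoid N)"
proof (rule unital_homI)
  fix x y assume "x \<in> carrier (idem_monoid M)" "y \<in> carrier (idem_monoid M)"
  then have xy: "x \<in> idempotents M" "y \<in> idempotents M" by simp_all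
  show "h (x \<otimes>\<^bsub>idem_monoid M\<^esub> y) = h x \<otimes>\<^bsub>idem_monoid N\<^esub> h y"
    using xy unital_hom_idempotents[OF assms] unital_hom_mult[OF assms, of x y]
    by (simp add: idempotents_def)
qed (use assms in \<open>auto simp: unital_hom_one unital_hom_idempotents\<close>)

text \<open>A homomorphism preserves the two equations that characterise \<open>star M x\<close>,
  hence inverses, hence idempotent parts.\<close>

lemma unital_hom_idem_part:
  assumes "comm_inverse_monoid M" "comm_inverse_monoid N" "h \<in> unital_hom M N" "x \<in> carrier M"
  shows "h (idem_part M x) = idem_part N (h x)"
proof -
  interpret M: comm_inverse_monoid M by fact
  interpret N: comm_inverse_monoid N by fact
  let ?y = "star M x"
  note y = M.star_props[OF assms(4)]
  note hm = unital_hom_mult[OF assms(3)] and hc = unital_hom_closed[OF assms(3)]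
  have "h x \<otimes>\<^bsub>N\<^esub> h ?y \<otimes>\<^bsub>N\<^esub> h x = h x" "h ?y \<otimes>\<^bsub>N\<^esub> h x \<otimes>\<^bsub>N\<^esub> h ?y = h ?y"
    using hm[symmetric] y assms(4) by simp_all
  then have "star N (h x) = h ?y"
    using hc y(1) assms(4) by (intro N.star_eqI) auto
  then show ?thesis
    unfolding idem_part_def using hm y(1) assms(4) by simp
qed

lemma comm_inverse_monoid_copy:
  assumes "comm_inverse_monoid M" "inj_on e (carrier M)"
  shows "comm_inverse_monoid (copy e M)"
proof -
  interpret M: comm_inverse_monoid M by fact
  interpret N: comm_monoid "copy e M"
    using comm_monoid_copy[OF M.comm_monoid_axioms assms(2)] .
  show ?thesis
  proof
    fix x assume "x \<in> carrier (copy e M)"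
    then obtain a where a: "x = e a" "a \<in> carrier M" by auto
    then obtain b where "b \<in> carrier M" "a \<otimes>\<^bsub>M\<^esub> b \<otimes>\<^bsub>M\<^esub> a = a" using M.regular by blast
    with a show "\<exists>y \<in> carrier (copy e M). x \<otimes>\<^bsub>copy e M\<^esub> y \<otimes>\<^bsub>copy e M\<^esub> x = x"
      by (auto simp: mult_copy[OF assms(2)] intro!: bexI[of _ b])
  qed
qed

lemma semilattice_monoid_copy:
  assumes "semilattice_monoid M" "inj_on e (carrier M)"
  shows "semilattice_monoid (copy e M)"
  using assms comm_monoid_copy[OF _ assms(2)] by (auto simp: semilattice_monoid_def mult_copy)

text \<open>Regularity propagates from the generators: if \<open>a'\<close> is a regular inverse of
  \<open>a\<close>, then \<open>a' \<otimes> b\<close> is one of \<open>a \<otimes> b\<close> by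
  additivity in the first variable, and products of inverses are inverses of products by
  commutativity.\<close>

lemma comm_inverse_monoid_ten_quot:
  assumes "comm_inverse_monoid A" "comm_inverse_monoid B"
  shows "comm_inverse_monoid (ten_quot A B)"
proof -
  interpret A: comm_inverse_monoid A by fact
  interpret B: comm_inverse_monoid B by fact
  interpret tensor_pair A B ..
  interpret Q: comm_monoid "ten_quot A B" by (rule comm_monoid_ten_quot)
  note bi = gen_bihom
  show ?thesis
  proof
    fix x assume "x \<in> carrier (ten_quot A B)"
    then show "\<exists>y \<in> carrier (ten_quot A B). x \<otimes>\<^bsub>ten_quot A B\<^esub> y \<otimes>\<^bsub>ten_quot A B\<^esub> x = x"
    proof (induction rule: ten_quot_induct)
      case one
      then show ?case by (intro bexI[of _ "\<one>\<^bsub>ten_quot A B\<^esub>"]) auto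
    next
      case (gen a b)
      obtain a' where a': "a' \<in> carrier A" "a \<otimes>\<^bsub>A\<^esub> a' \<otimes>\<^bsub>A\<^esub> a = a" using A.regular gen by blast
      show ?case
        using gen a' bihom_mult_left[OF bi, symmetric]
        by (intro bexI[of _ "gen a' b"]) (auto simp: bihom_closed[OF bi])
    next
      case (mult x y)
      then obtain x' y' where x': "x' \<in> carrier (ten_quot A B)" "x \<otimes>\<^bsub>ten_quot A B\<^esub> x' \<otimes>\<^bsub>ten_quot A B\<^esub> x = x"
        and y': "y' \<in> carrier (ten_quot A B)" "y \<otimes>\<^bsub>ten_quot A B\<^esub> y' \<otimes>\<^bsub>ten_quot A B\<^esub> y = y" by blast
      have "x \<otimes>\<^bsub>ten_quot A B\<^esub> y \<otimes>\<^bsub>ten_quot A B\<^esub> (x' \<otimes>\<^bsub>ten_quot A B\<^esub> y') \<otimes>\<^bsub>ten_quot A B\<^esub> (x \<otimes>\<^bsub>ten_quot A B\<^esub> y) =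
          (x \<otimes>\<^bsub>ten_quot A B\<^esub> x' \<otimes>\<^bsub>ten_quot A B\<^esub> x) \<otimes>\<^bsub>ten_quot A B\<^esub> (y \<otimes>\<^bsub>ten_quot A B\<^esub> y' \<otimes>\<^bsub>ten_quot A B\<^esub> y)"
        using mult.hyps x'(1) y'(1) by (simp add: Q.m_ac)
      then show ?case using x' y' by (intro bexI[of _ "x' \<otimes>\<^bsub>ten_quot A B\<^esub> y'"]) auto
    qed
  qed
qed

lemma semilattice_monoid_ten_quot:
  assumes "semilattice_monoid A" "semilattice_monoid B"
  shows "semilattice_monoid (ten_quot A B)"
proof -
  interpret A: comm_monoid A using assms by (simp add: semilattice_monoid_def)
  interpret B: comm_monoid B using assms by (simp add: semilattice_monoid_def)
  interpret tensor_pair A B ..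
  interpret Q: comm_monoid "ten_quot A B" by (rule comm_monoid_ten_quot)
  have "x \<otimes>\<^bsub>ten_quot A B\<^esub> x = x" if "x \<in> carrier (ten_quot A B)" for x
    using that
  proof (induction rule: ten_quot_induct)
    case (gen a b)
    then show ?case
      using bihom_mult_left[OF gen_bihom, of a a b] assms by (simp add: semilattice_monoid_def)
  next
    case (mult x y)
    have "x \<otimes>\<^bsub>ten_quot A B\<^esub> y \<otimes>\<^bsub>ten_quot A B\<^esub> (x \<otimes>\<^bsub>ten_quot A B\<^esub> y) =
        (x \<otimes>\<^bsub>ten_quot A B\<^esub> x) \<otimes>\<^bsub>ten_quot A B\<^esub> (y \<otimes>\<^bsub>ten_quot A B\<^esub> y)"
      using mult.hyps by (simp add: Q.m_ac)
    then show ?case using mult.IH by simp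
  qed simp
  then show ?thesis by (simp add: semilattice_monoid_def Q.comm_monoid_axioms)
qed

section \<open>Free objects on one generator\<close>

lemma int0_simps [simp]:
  "carrier int0 = UNIV" "\<one>\<^bsub>int0\<^esub> = None"
  "None \<otimes>\<^bsub>int0\<^esub> x = x" "x \<otimes>\<^bsub>int0\<^esub> None = x"
  "Some m \<otimes>\<^bsub>int0\<^esub> Some n = Some (m + n)"
  by (simp_all add: int0_def split: option.split)

lemma comm_inverse_monoid_int0: "comm_inverse_monoid int0"
proof -
  have "comm_monoid int0"
  proof (rule comm_monoidI)
    show "x \<otimes>\<^bsub>int0\<^esub> y \<otimes>\<^bsub>int0\<^esub> z = x \<otimes>\<^bsub>int0\<^esub> (y \<otimes>\<^bsub>int0\<^esub> z)" for x y z
      by (cases x; cases y; cases z) auto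
    show "x \<otimes>\<^bsub>int0\<^esub> y = y \<otimes>\<^bsub>int0\<^esub> x" for x y
      by (cases x; cases y) auto
  qed auto
  moreover have "\<exists>y. x \<otimes>\<^bsub>int0\<^esub> y \<otimes>\<^bsub>int0\<^esub> x = x" for x
  proof (cases x)
    case None
    then show ?thesis by auto
  next
    case (Some n)
    then show ?thesis by (intro exI[of _ "Some (- n)"]) simp
  qed
  ultimately show ?thesis
    by (simp add: comm_inverse_monoid_def comm_inverse_monoid_axioms_def)
qed

lemma idempotents_int0: "idempotents int0 = {None, Some 0}"
proof -
  have "x \<in> idempotents int0 \<longleftrightarrow> x \<in> {None, Some 0}" for x
    by (cases x) (auto simp: idempotents_def)
  then show ?thesis by blast
qed

text \<open>The elements absorbing the idempotent part \<open>e\<close> of \<open>a\<close> form a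
  monoid \<open>N\<close> with identity \<open>e\<close>, in which \<open>a\<close> is a unit with
  inverse \<open>star M a\<close>. So \<open>Some n\<close> can go to the integer power taken among
  the units of \<open>N\<close>. In particular \<open>Some 0\<close> goes to \<open>e\<close>,
  whereas \<open>None\<close> goes to the identity of \<open>M\<close>.\<close>

lemma (in comm_inverse_monoid) int0_lift:
  assumes a: "a \<in> carrier M"
  shows "\<exists>h \<in> unital_hom int0 M. h (Some 1) = a"
proof -
  define e where "e = idem_part M a"
  have e: "e \<in> carrier M" "e \<otimes> e = e"
    using idem_part_idempotents[OF a] by (auto simp: e_def idempotents_iff)
  define N where "N = \<lparr>carrier = {x \<in> carrier M. x \<otimes> e = x}, monoid.mult = (\<otimes>), one = e\<rparr>"
  have N_simps: "carrier N = {x \<in> carrier M. x \<otimes> e = x}" "monoid.mult N = (\<otimes>)" "\<one>\<^bsub>N\<^esub> = e"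
    by (simp_all add: N_def)
  interpret N: comm_monoid N
    by (rule comm_monoidI) (use e in \<open>auto simp: N_simps m_ac\<close>)
  have star_a: "a \<otimes> star M a = e" "star M a \<otimes> a = e" "star M a \<otimes> e = star M a" "a \<otimes> e = a"
  proof -
    note s = star_props[OF a]
    show "a \<otimes> star M a = e" "star M a \<otimes> a = e"
      using m_comm[OF a s(1)] by (simp_all add: e_def idem_part_def)
    show "star M a \<otimes> e = star M a"
      using s(3) m_assoc[OF s(1) a s(1)] by (simp add: e_def idem_part_def)
    show "a \<otimes> e = a"
      using a by (simp add: e_def)
  qed
  have aN: "a \<in> Units N"
    using a star_props(1)[OF a] star_a by (auto simp: Units_def N_simps intro!: bexI[of _ "star M a"])
  interpret G: group "units_of N" by (rule N.units_group)
  let ?G = "units_of N"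
  have aG: "a \<in> carrier ?G" using aN by (simp add: units_of_carrier)
  have pow: "a [^]\<^bsub>?G\<^esub> (n :: int) \<in> carrier M" for n
    using G.int_pow_closed[OF aG, of n] N.Units_closed by (auto simp: units_of_carrier N_simps)
  have pow_add: "a [^]\<^bsub>?G\<^esub> (m + n) = a [^]\<^bsub>?G\<^esub> m \<otimes> a [^]\<^bsub>?G\<^esub> n" for m n :: int
    using G.int_pow_mult[OF aG, of m n] by (simp add: units_of_mult N_simps)
  define h where "h x = (case x of None \<Rightarrow> \<one> | Some n \<Rightarrow> a [^]\<^bsub>?G\<^esub> (n :: int))" for x
  have "h \<in> unital_hom int0 M"
  proof (rule unital_homI)
    show "h (x \<otimes>\<^bsub>int0\<^esub> y) = h x \<otimes> h y" for x y
      by (cases x; cases y) (simp_all add: h_def pow pow_add)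
  qed (auto simp: h_def pow split: option.split)
  moreover have "h (Some 1) = a"
    using aG by (simp add: h_def G.int_pow_1)
  ultimately show ?thesis by blast
qed

lemma (in comm_inverse_monoid) int0_ext:
  assumes h: "h \<in> unital_hom int0 M" and k: "k \<in> unital_hom int0 M" and eq: "h (Some 1) = k (Some 1)"
  shows "h x = k x"
proof (cases x)
  case None
  then show ?thesis using unital_hom_one[OF h] unital_hom_one[OF k] by simp
next
  case (Some n)
  \<comment> \<open>\<open>Some (- 1)\<close> is the inverse of \<open>Some 1\<close> in the sense
    of \<open>star\<close>, so its image is forced by that of the generator.\<close>
  have neg: "star M (f (Some 1)) = f (Some (- 1))" if "f \<in> unital_hom int0 M" for f
    using unital_hom_closed[OF that] unital_hom_mult[OF that, symmetric] by (intro star_eqI) auto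
  have neg_eq: "h (Some (- 1)) = k (Some (- 1))" using neg[OF h] neg[OF k] eq by simp
  note hm = unital_hom_mult[OF h, simplified] and km = unital_hom_mult[OF k, simplified]
  have "h (Some n) = k (Some n)"
  proof (induction n rule: int_induct[where k = 0])
    case base
    \<comment> \<open>\<open>Some 0\<close> is not the identity of \<open>int0\<close>; its image is
      determined by writing it as the product of \<open>Some 1\<close> and
      \<open>Some (- 1)\<close>.\<close>
    then show ?case using hm[of "Some 1" "Some (- 1)"] km[of "Some 1" "Some (- 1)"] eq neg_eq by simp
  next
    case (step1 i)
    then show ?case using hm[of "Some i" "Some 1"] km[of "Some i" "Some 1"] eq by simp
  next
    case (step2 i)
    then show ?case using hm[of "Some i" "Some (- 1)"] km[of "Some i" "Some (- 1)"] neg_eq by simp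
  qed
  then show ?thesis using Some by simp
qed

lemma free_slat_simps [simp]:
  "carrier free_slat = UNIV" "\<one>\<^bsub>free_slat\<^esub> = False" "x \<otimes>\<^bsub>free_slat\<^esub> y \<longleftrightarrow> x \<or> y"
  by (simp_all add: free_slat_def)

lemma semilattice_free_slat: "semilattice_monoid free_slat"
  unfolding semilattice_monoid_def by (auto intro: comm_monoidI)

lemma free_slat_lift:
  assumes "semilattice_monoid A" "a \<in> carrier A"
  shows "\<exists>h \<in> unital_hom free_slat A. h True = a"
proof -
  interpret comm_monoid A using assms by (simp add: semilattice_monoid_def)
  show ?thesis
    by (rule bexI[of _ "\<lambda>b. if b then a else \<one>\<^bsub>A\<^esub>"], simp, rule unital_homI)
      (use assms in \<open>auto simp: semilattice_monoid_def\<close>)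
qed

lemma free_slat_ext:
  assumes "h \<in> unital_hom free_slat A" "k \<in> unital_hom free_slat A" "h True = k True"
  shows "h x = k x"
  using assms unital_hom_one[OF assms(1)] unital_hom_one[OF assms(2)] by (cases x) auto

section \<open>The tensor structures on commutative inverse monoids and on semilattices\<close>

abbreviation cinv :: "'u monoid set" where
  "cinv \<equiv> {M. small_monoid M \<and> comm_inv_monoid M}"

abbreviation slat :: "'u monoid set" where
  "slat \<equiv> {M. small_monoid M \<and> semilattice_monoid M}"

lemma semilattice_comm_monoid: "semilattice_monoid M \<Longrightarrow> comm_monoid M"
  by (simp add: semilattice_monoid_def)

lemma cinvD: "M \<in> cinv \<Longrightarrow> comm_inverse_monoid M"
  by (simp add: comm_inv_monoid_iff)

lemma cinv_comm_monoid: "M \<in> cinv \<Longrightarrow> comm_monoid M"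
  by (simp add: comm_inv_monoid_def)

lemma ten_quot_lesspoll:
  fixes A B :: "'u monoid"
  assumes "uncountable (UNIV :: 'u set)" "comm_monoid A" "comm_monoid B" "small_monoid A" "small_monoid B"
  shows "carrier (ten_quot A B) \<prec> (UNIV :: 'u set)"
  using tensor_pair.carrier_ten_quot_lesspoll[OF _ assms(1)] assms
  by (auto simp: tensor_pair_def small_monoid_def)

text \<open>The injections stay arbitrary because two instances are required: \<open>encode\<close>
  yields the structure of \<open>CInvMon\<close>, another choice the strict one.\<close>

lemma tensor_structure_cinv:
  fixes e :: "'u monoid \<Rightarrow> 'u monoid \<Rightarrow> ('u \<times> 'u) multiset set \<Rightarrow> 'u"
  assumes unc: "uncountable (UNIV :: 'u set)"
    and inj: "\<And>A B. A \<in> cinv \<Longrightarrow> B \<in> cinv \<Longrightarrow> inj_on (e A B) (carrier (ten_quot A B))"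
    and i: "inj i"
  shows "tensor_structure cinv (copy i int0) (i (Some 1)) (\<lambda>A B. copy (e A B) (ten_quot A B))
    (\<lambda>A B a b. e A B (ten_class A B {#(a, b)#}))"
proof (rule tensor_structure_copy)
  interpret comm_inverse_monoid int0 by (rule comm_inverse_monoid_int0)
  show "monoid int0" by (rule monoid_axioms)
  have "carrier int0 \<prec> (UNIV :: 'u set)"
    using unc by (intro countable_lesspoll_uncountable) auto
  then show "copy i int0 \<in> cinv"
    using comm_inverse_monoid_copy[OF comm_inverse_monoid_int0, of i] i small_monoid_copy[of int0 i]
    by (simp add: comm_inv_monoid_iff)
next
  fix A B :: "'u monoid" assume AB: "A \<in> cinv" "B \<in> cinv"
  have "small_monoid (copy (e A B) (ten_quot A B))"
    using AB by (intro small_monoid_copy ten_quot_lesspoll[OF unc]) (auto simp: comm_inv_monoid_def)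
  moreover have "comm_inverse_monoid (copy (e A B) (ten_quot A B))"
    using AB by (intro comm_inverse_monoid_copy comm_inverse_monoid_ten_quot cinvD inj)
  ultimately show "copy (e A B) (ten_quot A B) \<in> cinv"
    by (simp add: comm_inv_monoid_iff)
next
  fix A :: "'u monoid" and a assume "A \<in> cinv" "a \<in> carrier A"
  then show "\<exists>h \<in> unital_hom int0 A. h (Some 1) = a"
    by (intro comm_inverse_monoid.int0_lift cinvD)
next
  fix A :: "'u monoid" and h k x
  assume "A \<in> cinv" "h \<in> unital_hom int0 A" "k \<in> unital_hom int0 A" "h (Some 1) = k (Some 1)"
  then show "h x = k x"
    by - (rule comm_inverse_monoid.int0_ext[OF cinvD])
qed (use inj i cinv_comm_monoid in auto)

lemma tensor_structure_slat:
  assumes unc: "uncountable (UNIV :: 'u set)"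
  shows "tensor_structure slat (small_copy free_slat) (encode free_slat True)
    (tensor :: 'u monoid \<Rightarrow> 'u monoid \<Rightarrow> 'u monoid) pure"
proof -
  have small: "carrier free_slat \<prec> (UNIV :: 'u set)"
    using unc by (intro countable_lesspoll_uncountable) auto
  have enc: "inj_on (encode M :: _ \<Rightarrow> 'u) (carrier M)" if "carrier M \<prec> (UNIV :: 'u set)" for M
    using that by (intro inj_on_encode lesspoll_imp_lepoll)
  have inj: "inj_on (encode (ten_quot A B) :: _ \<Rightarrow> 'u) (carrier (ten_quot A B))"
    and cl: "copy (encode (ten_quot A B) :: _ \<Rightarrow> 'u) (ten_quot A B) \<in> slat"
    if AB: "A \<in> slat" "B \<in> slat" for A B :: "'u monoid"
  proof -
    have l: "carrier (ten_quot A B) \<prec> (UNIV :: 'u set)"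
      using AB by (intro ten_quot_lesspoll unc) (auto simp: semilattice_comm_monoid)
    then show "inj_on (encode (ten_quot A B) :: _ \<Rightarrow> 'u) (carrier (ten_quot A B))"
      by (rule enc)
    then have "semilattice_monoid (copy (encode (ten_quot A B) :: _ \<Rightarrow> 'u) (ten_quot A B))"
      using AB by (intro semilattice_monoid_copy semilattice_monoid_ten_quot) auto
    then show "copy (encode (ten_quot A B) :: _ \<Rightarrow> 'u) (ten_quot A B) \<in> slat"
      using small_monoid_copy[OF l] by simp
  qed
  have "tensor_structure slat (copy (encode free_slat) free_slat) (encode free_slat True)
    (\<lambda>A B. copy (encode (ten_quot A B) :: _ \<Rightarrow> 'u) (ten_quot A B))
    (\<lambda>A B a b. encode (ten_quot A B) (ten_class A B {#(a, b)#}))"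
  proof (rule tensor_structure_copy)
    show "monoid free_slat"
      by (rule comm_monoid.axioms(1)[OF semilattice_comm_monoid[OF semilattice_free_slat]])
    show "copy (encode free_slat) free_slat \<in> (slat :: 'u monoid set)"
      using semilattice_monoid_copy[OF semilattice_free_slat enc[OF small]] small_monoid_copy[OF small]
      by simp
  next
    fix A :: "'u monoid" and a assume "A \<in> slat" "a \<in> carrier A"
    then show "\<exists>h \<in> unital_hom free_slat A. h True = a"
      by (intro free_slat_lift) auto
  next
    fix A :: "'u monoid" and h k x
    assume "h \<in> unital_hom free_slat A" "k \<in> unital_hom free_slat A" "h True = k True"
    then show "h x = k x" by (rule free_slat_ext)
  qed (use inj cl semilattice_comm_monoid enc[OF small] in auto)
  then show ?thesis
    by (simp add: small_copy_eq_copy tensor_def[abs_def] pure_def[abs_def])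
qed

section \<open>The opfibration of idempotents\<close>

text \<open>The encoding is \<open>\<sigma>\<close> on idempotents and an injection into the
  complement of \<open>carrier S\<close> elsewhere; such an injection exists since \<open>S\<close>
  is smaller than the universe. The idempotents of the copy are then the elements of
  \<open>S\<close> themselves, not merely in bijection with them.\<close>

lemma strict_copy:
  fixes Q :: "'a monoid" and S :: "'u monoid"
  assumes "comm_inverse_monoid Q" "carrier Q \<prec> (UNIV :: 'u set)" "infinite (UNIV :: 'u set)"
    and S: "small_monoid S"
    and \<sigma>: "\<sigma> \<in> unital_hom (idem_monoid Q) S" "bij_betw \<sigma> (idempotents Q) (carrier S)"
  obtains e where "inj_on e (carrier Q)" "\<And>x. x \<in> idempotents Q \<Longrightarrow> e x = \<sigma> x"
    "idem_monoid (copy e Q) = S"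
proof -
  interpret Q: comm_inverse_monoid Q by fact
  have "carrier Q \<lesssim> (UNIV :: 'u set)" using assms(2) by (rule lesspoll_imp_lepoll)
  also have "\<dots> \<lesssim> UNIV - carrier S"
    using S assms(3) by (intro infinite_lepoll_diff) (auto simp: small_monoid_def)
  finally obtain g where g: "inj_on g (carrier Q)" "g ` carrier Q \<subseteq> UNIV - carrier S"
    unfolding lepoll_def by blast
  define e where "e x = (if x \<in> idempotents Q then \<sigma> x else g x)" for x
  have \<sigma>_inj: "inj_on \<sigma> (idempotents Q)" and \<sigma>_im: "\<sigma> ` idempotents Q = carrier S"
    using \<sigma>(2) by (auto simp: bij_betw_def)
  have e_idem: "e x = \<sigma> x" if "x \<in> idempotents Q" for x using that by (simp add: e_def)
  have inj: "inj_on e (carrier Q)"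
  proof (rule inj_onI)
    fix x y assume xy: "x \<in> carrier Q" "y \<in> carrier Q" "e x = e y"
    have *: "\<sigma> x \<in> carrier S" if "x \<in> idempotents Q" for x using \<sigma>_im that by blast
    have **: "g x \<notin> carrier S" if "x \<in> carrier Q" for x using g(2) that by blast
    show "x = y"
      using xy *[of x] *[of y] **[of x] **[of y] inj_onD[OF \<sigma>_inj, of x y] inj_onD[OF g(1), of x y]
      unfolding e_def by (cases "x \<in> idempotents Q"; cases "y \<in> idempotents Q") simp_all
  qed
  have idem: "idempotents (copy e Q) = carrier S"
  proof -
    have "e x \<in> idempotents (copy e Q) \<longleftrightarrow> x \<in> idempotents Q" if "x \<in> carrier Q" for x
      using that inj_onD[OF inj, of "x \<otimes>\<^bsub>Q\<^esub> x" x] by (auto simp: idempotents_def mult_copy[OF inj])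
    then have "idempotents (copy e Q) = e ` idempotents Q"
      by (auto simp: idempotents_def)
    then show ?thesis using \<sigma>_im e_idem by simp
  qed
  have "idem_monoid (copy e Q) = S"
  proof (rule monoid.equality)
    show "carrier (idem_monoid (copy e Q)) = carrier S" by (simp add: idem)
    show "\<one>\<^bsub>idem_monoid (copy e Q)\<^esub> = \<one>\<^bsub>S\<^esub>"
      using unital_hom_one[OF \<sigma>(1)] by (simp add: e_idem)
    show "monoid.mult (idem_monoid (copy e Q)) = monoid.mult S"
    proof (intro HOL.ext)
      fix x y
      show "x \<otimes>\<^bsub>idem_monoid (copy e Q)\<^esub> y = x \<otimes>\<^bsub>S\<^esub> y"
      proof (cases "x \<in> carrier S \<and> y \<in> carrier S")
        case True
        then obtain a b where ab: "a \<in> idempotents Q" "b \<in> idempotents Q" "x = \<sigma> a" "y = \<sigma> b"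
          using \<sigma>_im by blast
        then have "x \<otimes>\<^bsub>copy e Q\<^esub> y = e (a \<otimes>\<^bsub>Q\<^esub> b)"
          using mult_copy[OF inj, of a b] Q.idempotents_closed by (simp add: e_idem)
        also have "\<dots> = x \<otimes>\<^bsub>S\<^esub> y"
          using ab unital_hom_mult[OF \<sigma>(1), of a b] by (simp add: e_idem)
        finally show ?thesis using True by (simp add: idem)
      next
        case False
        \<comment> \<open>Off the carrier both operations are \<open>undefined\<close>, which turns
          an isomorphism that is the identity into an equality of records.\<close>
        then show ?thesis using S by (auto simp: idem_monoid_def idem small_monoid_def)
      qed
    qed
  qed simp
  with inj e_idem show thesis by (intro that[of e]) auto
qed

section \<open>Pushforward of a commutative inverse monoid along a map of its idempotents\<close>

locale pushforward =
  M: comm_inverse_monoid M + S: comm_monoid S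
  for M :: "'a monoid" and S :: "'b monoid" +
  fixes v :: "'a \<Rightarrow> 'b"
  assumes S_idem: "s \<in> carrier S \<Longrightarrow> s \<otimes>\<^bsub>S\<^esub> s = s"
    and v_hom: "v \<in> unital_hom (idem_monoid M) S"
begin

definition lev :: "'a \<times> 'b \<Rightarrow> 'b" where
  "lev p = v (idem_part M (fst p)) \<otimes>\<^bsub>S\<^esub> snd p"

text \<open>Writing \<open>M\<close> as a functor from its semilattice of idempotents to abelian groups, the
  pushforward along \<open>v\<close> is the left Kan extension: its value at \<open>s\<close> is the filtered colimit of the
  groups \<open>M\<^sub>k\<close> over all \<open>k\<close> with \<open>v k\<close> below \<open>s\<close>, and the pair \<open>(m, s)\<close> represents the image
  of \<open>m\<close> at level \<open>lev (m, s)\<close>.\<close>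

definition rel :: "'a \<times> 'b \<Rightarrow> 'a \<times> 'b \<Rightarrow> bool" where
  "rel p q \<longleftrightarrow> p \<in> carrier (M \<times>\<times> S) \<and> q \<in> carrier (M \<times>\<times> S) \<and> lev p = lev q \<and>
     (\<exists>k \<in> idempotents M. v k \<otimes>\<^bsub>S\<^esub> lev p = lev p \<and> fst p \<otimes>\<^bsub>M\<^esub> k = fst q \<otimes>\<^bsub>M\<^esub> k)"

lemma v_closed [simp]: "e \<in> idempotents M \<Longrightarrow> v e \<in> carrier S"
  using unital_hom_closed[OF v_hom] by simp

lemma v_mult: "e \<in> idempotents M \<Longrightarrow> f \<in> idempotents M \<Longrightarrow> v (e \<otimes>\<^bsub>M\<^esub> f) = v e \<otimes>\<^bsub>S\<^esub> v f"
  using unital_hom_mult[OF v_hom, of e f] by simp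

lemma v_one [simp]: "v \<one>\<^bsub>M\<^esub> = \<one>\<^bsub>S\<^esub>"
  using unital_hom_one[OF v_hom] by simp

lemma comm_monoid_prod: "comm_monoid (M \<times>\<times> S)"
proof -
  have "monoid (M \<times>\<times> S)"
    by (rule DirProd_monoid[OF M.monoid_axioms S.monoid_axioms])
  then show ?thesis
    by (rule monoid.monoid_comm_monoidI) (auto simp: DirProd_def M.m_comm S.m_comm)
qed

lemmas [simp] = mem_Times_iff

lemma prod_simps:
  "p \<in> carrier (M \<times>\<times> S) \<longleftrightarrow> fst p \<in> carrier M \<and> snd p \<in> carrier S"
  "fst (p \<otimes>\<^bsub>M \<times>\<times> S\<^esub> q) = fst p \<otimes>\<^bsub>M\<^esub> fst q" "snd (p \<otimes>\<^bsub>M \<times>\<times> S\<^esub> q) = snd p \<otimes>\<^bsub>S\<^esub> snd q"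
  by (auto simp: DirProd_def split: prod.splits)

lemma lev_closed [simp]: "p \<in> carrier (M \<times>\<times> S) \<Longrightarrow> lev p \<in> carrier S"
  by (simp add: lev_def prod_simps)

lemma lev_mult:
  "p \<in> carrier (M \<times>\<times> S) \<Longrightarrow> q \<in> carrier (M \<times>\<times> S) \<Longrightarrow>
    lev (p \<otimes>\<^bsub>M \<times>\<times> S\<^esub> q) = lev p \<otimes>\<^bsub>S\<^esub> lev q"
  by (simp add: lev_def prod_simps M.idem_part_mult v_mult S.m_ac)

text \<open>Two witnesses \<open>k\<close> and \<open>l\<close> combine to their product, both for
  transitivity and for compatibility with multiplication; levels agree because \<open>lev\<close> is
  multiplicative.\<close>

sublocale monoid_congruence "M \<times>\<times> S" rel
proof (rule monoid_congruence.intro[OF comm_monoid_prod], rule monoid_congruence_axioms.intro)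
  show "p \<in> carrier (M \<times>\<times> S) \<and> q \<in> carrier (M \<times>\<times> S)" if "rel p q" for p q
    using that by (simp add: rel_def)
  show "rel p p" if "p \<in> carrier (M \<times>\<times> S)" for p
    using that unfolding rel_def by (auto intro!: bexI[of _ "\<one>\<^bsub>M\<^esub>"])
  show "rel q p" if "rel p q" for p q
  proof -
    from that obtain k where k: "k \<in> idempotents M" "v k \<otimes>\<^bsub>S\<^esub> lev p = lev p"
      "fst p \<otimes>\<^bsub>M\<^esub> k = fst q \<otimes>\<^bsub>M\<^esub> k" "lev p = lev q"
      "p \<in> carrier (M \<times>\<times> S)" "q \<in> carrier (M \<times>\<times> S)" unfolding rel_def by blast
    then show ?thesis unfolding rel_def by (intro conjI bexI[of _ k]) simp_all
  qed
  show "rel p z" if pq: "rel p q" and qz: "rel q z" for p q z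
  proof -
    from pq obtain k where k: "k \<in> idempotents M" "v k \<otimes>\<^bsub>S\<^esub> lev p = lev p"
      "fst p \<otimes>\<^bsub>M\<^esub> k = fst q \<otimes>\<^bsub>M\<^esub> k" "lev p = lev q"
      "p \<in> carrier (M \<times>\<times> S)" "q \<in> carrier (M \<times>\<times> S)" unfolding rel_def by blast
    from qz obtain l where l: "l \<in> idempotents M" "v l \<otimes>\<^bsub>S\<^esub> lev q = lev q"
      "fst q \<otimes>\<^bsub>M\<^esub> l = fst z \<otimes>\<^bsub>M\<^esub> l" "lev q = lev z"
      "z \<in> carrier (M \<times>\<times> S)" unfolding rel_def by blast
    have c: "k \<in> carrier M" "l \<in> carrier M" "fst p \<in> carrier M" "fst q \<in> carrier M" "fst z \<in> carrier M"
      using k l M.idempotents_closed prod_simps by auto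
    have "v (k \<otimes>\<^bsub>M\<^esub> l) \<otimes>\<^bsub>S\<^esub> lev p = v k \<otimes>\<^bsub>S\<^esub> (v l \<otimes>\<^bsub>S\<^esub> lev p)"
      using k l by (simp add: v_mult S.m_assoc)
    then have 1: "v (k \<otimes>\<^bsub>M\<^esub> l) \<otimes>\<^bsub>S\<^esub> lev p = lev p" using k l by simp
    have "fst p \<otimes>\<^bsub>M\<^esub> (k \<otimes>\<^bsub>M\<^esub> l) = (fst p \<otimes>\<^bsub>M\<^esub> k) \<otimes>\<^bsub>M\<^esub> l" using c by (simp add: M.m_assoc)
    also have "\<dots> = (fst q \<otimes>\<^bsub>M\<^esub> l) \<otimes>\<^bsub>M\<^esub> k" using c unfolding k(3) by (simp add: M.m_ac)
    also have "\<dots> = fst z \<otimes>\<^bsub>M\<^esub> (k \<otimes>\<^bsub>M\<^esub> l)" using c unfolding l(3) by (simp add: M.m_ac)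
    finally have 2: "fst p \<otimes>\<^bsub>M\<^esub> (k \<otimes>\<^bsub>M\<^esub> l) = fst z \<otimes>\<^bsub>M\<^esub> (k \<otimes>\<^bsub>M\<^esub> l)" .
    show ?thesis
      unfolding rel_def using k l 1 2 by (intro conjI bexI[of _ "k \<otimes>\<^bsub>M\<^esub> l"]) simp_all
  qed
  show "rel (p \<otimes>\<^bsub>M \<times>\<times> S\<^esub> p') (q \<otimes>\<^bsub>M \<times>\<times> S\<^esub> q')" if pq: "rel p q" and pq': "rel p' q'" for p q p' q'
  proof -
    interpret P: comm_monoid "M \<times>\<times> S" by (rule comm_monoid_prod)
    from pq obtain k where k: "k \<in> idempotents M" "v k \<otimes>\<^bsub>S\<^esub> lev p = lev p"
      "fst p \<otimes>\<^bsub>M\<^esub> k = fst q \<otimes>\<^bsub>M\<^esub> k" "lev p = lev q"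
      "p \<in> carrier (M \<times>\<times> S)" "q \<in> carrier (M \<times>\<times> S)" unfolding rel_def by blast
    from pq' obtain l where l: "l \<in> idempotents M" "v l \<otimes>\<^bsub>S\<^esub> lev p' = lev p'"
      "fst p' \<otimes>\<^bsub>M\<^esub> l = fst q' \<otimes>\<^bsub>M\<^esub> l" "lev p' = lev q'"
      "p' \<in> carrier (M \<times>\<times> S)" "q' \<in> carrier (M \<times>\<times> S)" unfolding rel_def by blast
    have c: "k \<in> carrier M" "l \<in> carrier M" "fst p \<in> carrier M" "fst q \<in> carrier M"
      "fst p' \<in> carrier M" "fst q' \<in> carrier M"
      using k l M.idempotents_closed prod_simps by auto
    have "v (k \<otimes>\<^bsub>M\<^esub> l) \<otimes>\<^bsub>S\<^esub> (lev p \<otimes>\<^bsub>S\<^esub> lev p') = (v k \<otimes>\<^bsub>S\<^esub> lev p) \<otimes>\<^bsub>S\<^esub> (v l \<otimes>\<^bsub>S\<^esub> lev p')"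
      using k(1,5) l(1,5) by (simp add: v_mult S.m_ac)
    then have 1: "v (k \<otimes>\<^bsub>M\<^esub> l) \<otimes>\<^bsub>S\<^esub> lev (p \<otimes>\<^bsub>M \<times>\<times> S\<^esub> p') = lev (p \<otimes>\<^bsub>M \<times>\<times> S\<^esub> p')"
      using k l by (simp add: lev_mult)
    have "fst p \<otimes>\<^bsub>M\<^esub> fst p' \<otimes>\<^bsub>M\<^esub> (k \<otimes>\<^bsub>M\<^esub> l) = (fst p \<otimes>\<^bsub>M\<^esub> k) \<otimes>\<^bsub>M\<^esub> (fst p' \<otimes>\<^bsub>M\<^esub> l)"
      using c by (simp add: M.m_ac)
    also have "\<dots> = fst q \<otimes>\<^bsub>M\<^esub> fst q' \<otimes>\<^bsub>M\<^esub> (k \<otimes>\<^bsub>M\<^esub> l)"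
      unfolding k(3) l(3) using c by (simp add: M.m_ac)
    finally have 2: "fst (p \<otimes>\<^bsub>M \<times>\<times> S\<^esub> p') \<otimes>\<^bsub>M\<^esub> (k \<otimes>\<^bsub>M\<^esub> l) = fst (q \<otimes>\<^bsub>M \<times>\<times> S\<^esub> q') \<otimes>\<^bsub>M\<^esub> (k \<otimes>\<^bsub>M\<^esub> l)"
      by (simp add: prod_simps)
    have 3: "lev (p \<otimes>\<^bsub>M \<times>\<times> S\<^esub> p') = lev (q \<otimes>\<^bsub>M \<times>\<times> S\<^esub> q')"
      using k l by (simp add: lev_mult)
    show ?thesis
      unfolding rel_def using k l 1 2 3
      by (intro conjI bexI[of _ "k \<otimes>\<^bsub>M\<^esub> l"]) (simp_all add: prod_simps)
  qed
qed

abbreviation push :: "('a \<times> 'b) set monoid" where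
  "push \<equiv> quot (M \<times>\<times> S) rel"

abbreviation cls :: "'a \<Rightarrow> 'b \<Rightarrow> ('a \<times> 'b) set" where
  "cls m s \<equiv> rel_class rel (m, s)"

lemma carrier_push: "x \<in> carrier push \<longleftrightarrow> (\<exists>m \<in> carrier M. \<exists>s \<in> carrier S. x = cls m s)"
  by (auto simp: carrier_quot prod_simps)

lemma cls_closed [simp]: "m \<in> carrier M \<Longrightarrow> s \<in> carrier S \<Longrightarrow> cls m s \<in> carrier push"
  using carrier_push by blast

lemma cls_mult:
  "m \<in> carrier M \<Longrightarrow> n \<in> carrier M \<Longrightarrow> s \<in> carrier S \<Longrightarrow> t \<in> carrier S \<Longrightarrow>
    cls m s \<otimes>\<^bsub>push\<^esub> cls n t = cls (m \<otimes>\<^bsub>M\<^esub> n) (s \<otimes>\<^bsub>S\<^esub> t)"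
  by (subst mult_quot) (auto simp: prod_simps)

lemma one_push: "\<one>\<^bsub>push\<^esub> = cls \<one>\<^bsub>M\<^esub> \<one>\<^bsub>S\<^esub>"
  by (simp add: one_quot)

lemma cls_eq_iff: "m \<in> carrier M \<Longrightarrow> s \<in> carrier S \<Longrightarrow> cls m s = cls n t \<longleftrightarrow> rel (m, s) (n, t)"
  by (rule class_eq_iff) (simp add: prod_simps)

lemma comm_inverse_monoid_push: "comm_inverse_monoid push"
proof -
  interpret Q: comm_monoid push by (rule comm_monoid_quot)
  show ?thesis
  proof
    fix x assume "x \<in> carrier push"
    then obtain m s where x: "x = cls m s" "m \<in> carrier M" "s \<in> carrier S"
      using carrier_push by blast
    have "x \<otimes>\<^bsub>push\<^esub> cls (star M m) s \<otimes>\<^bsub>push\<^esub> x = x"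
      using x M.star_props[OF x(2)] by (simp add: cls_mult S_idem)
    then show "\<exists>y \<in> carrier push. x \<otimes>\<^bsub>push\<^esub> y \<otimes>\<^bsub>push\<^esub> x = x"
      using x M.star_props(1)[OF x(2)] by (intro bexI) auto
  qed
qed

text \<open>Idempotency of the class gives a \<open>k\<close> with \<open>m m k = m k\<close>, and
  multiplying by the inverse of \<open>m\<close> gives \<open>m k = e k\<close> with
  \<open>e\<close> the idempotent part of \<open>m\<close>. So \<open>e k\<close> witnesses that
  \<open>m\<close> may be replaced by the identity once the level is kept.\<close>

lemma cls_idempotent:
  assumes m: "m \<in> carrier M" and s: "s \<in> carrier S" and idem: "cls m s \<in> idempotents push"
  shows "cls m s = cls \<one>\<^bsub>M\<^esub> (lev (m, s))"
proof -
  have "cls (m \<otimes>\<^bsub>M\<^esub> m) (s \<otimes>\<^bsub>S\<^esub> s) = cls m s"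
    using idem m s by (simp add: idempotents_def cls_mult)
  then have "rel (m \<otimes>\<^bsub>M\<^esub> m, s) (m, s)"
    using m s by (simp add: cls_eq_iff S_idem)
  then obtain k where k: "k \<in> idempotents M" "v k \<otimes>\<^bsub>S\<^esub> lev (m, s) = lev (m, s)"
    "m \<otimes>\<^bsub>M\<^esub> m \<otimes>\<^bsub>M\<^esub> k = m \<otimes>\<^bsub>M\<^esub> k"
    unfolding rel_def by auto
  let ?e = "idem_part M m"
  have kc: "k \<in> carrier M" using k M.idempotents_closed by simp
  have star: "star M m \<in> carrier M" "star M m \<otimes>\<^bsub>M\<^esub> m = ?e"
    using M.star_props[OF m] M.m_comm m by (auto simp: idem_part_def)
  have "m \<otimes>\<^bsub>M\<^esub> k = ?e \<otimes>\<^bsub>M\<^esub> m \<otimes>\<^bsub>M\<^esub> k" using m by simp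
  also have "\<dots> = star M m \<otimes>\<^bsub>M\<^esub> (m \<otimes>\<^bsub>M\<^esub> m \<otimes>\<^bsub>M\<^esub> k)"
    unfolding star(2)[symmetric] using m kc star(1) by (simp add: M.m_assoc)
  also have "\<dots> = ?e \<otimes>\<^bsub>M\<^esub> k"
    unfolding k(3) star(2)[symmetric] using m kc star(1) by (simp add: M.m_assoc)
  finally have mk: "m \<otimes>\<^bsub>M\<^esub> k = ?e \<otimes>\<^bsub>M\<^esub> k" .
  have lev: "lev (m, s) \<in> carrier S" using m s by (simp add: prod_simps)
  have 1: "lev (\<one>\<^bsub>M\<^esub>, lev (m, s)) = lev (m, s)"
    using lev unfolding lev_def[of "(\<one>\<^bsub>M\<^esub>, _)"] by simp
  have "v ?e \<otimes>\<^bsub>S\<^esub> lev (m, s) = lev (m, s)"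
    unfolding lev_def using m s by (simp add: S.m_assoc[symmetric] S_idem)
  then have 2: "v (?e \<otimes>\<^bsub>M\<^esub> k) \<otimes>\<^bsub>S\<^esub> lev (m, s) = lev (m, s)"
    using m k(1,2) lev by (simp add: v_mult S.m_assoc)
  have 3: "m \<otimes>\<^bsub>M\<^esub> (?e \<otimes>\<^bsub>M\<^esub> k) = \<one>\<^bsub>M\<^esub> \<otimes>\<^bsub>M\<^esub> (?e \<otimes>\<^bsub>M\<^esub> k)"
    using m kc mk by (simp add: M.m_assoc[symmetric])
  have "rel (m, s) (\<one>\<^bsub>M\<^esub>, lev (m, s))"
    unfolding rel_def using m s k(1) lev 1 2 3
    by (intro conjI bexI[of _ "?e \<otimes>\<^bsub>M\<^esub> k"]) (simp_all add: prod_simps)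
  then show ?thesis using m s by (simp add: cls_eq_iff)
qed

lemma cls_one_idempotent: "s \<in> carrier S \<Longrightarrow> cls \<one>\<^bsub>M\<^esub> s \<in> idempotents push"
  by (simp add: idempotents_def cls_mult S_idem)

text \<open>The level of \<open>(1, s)\<close> is \<open>s\<close>, and related pairs have equal
  levels. Together with \<open>cls_idempotent\<close> this identifies the idempotents of
  \<open>push\<close> with \<open>S\<close>.\<close>

lemma cls_one_inject:
  assumes "s \<in> carrier S" "t \<in> carrier S" "cls \<one>\<^bsub>M\<^esub> s = cls \<one>\<^bsub>M\<^esub> t"
  shows "s = t"
  using assms by (simp add: cls_eq_iff rel_def lev_def)

text \<open>The commuting square of the pushout: the image of an idempotent \<open>e\<close> from
  \<open>M\<close> agrees with the image of \<open>v e\<close> from \<open>S\<close>.\<close>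

lemma cls_v:
  assumes "e \<in> idempotents M"
  shows "cls e \<one>\<^bsub>S\<^esub> = cls \<one>\<^bsub>M\<^esub> (v e)"
proof -
  have e: "e \<in> carrier M" "e \<otimes>\<^bsub>M\<^esub> e = e" using assms by (auto simp: idempotents_def)
  have "cls e \<one>\<^bsub>S\<^esub> = cls \<one>\<^bsub>M\<^esub> (lev (e, \<one>\<^bsub>S\<^esub>))"
    using e by (intro cls_idempotent) (auto simp: idempotents_def cls_mult)
  then show ?thesis using assms by (simp add: lev_def)
qed

lemma push_lift:
  fixes Z :: "'c monoid"
  assumes Z: "comm_inverse_monoid Z" and h: "h \<in> unital_hom M Z" and w: "w \<in> unital_hom S (idem_monoid Z)"
    and eq: "\<And>e. e \<in> idempotents M \<Longrightarrow> w (v e) = h e"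
  obtains k where "k \<in> unital_hom push Z"
    "\<And>m s. m \<in> carrier M \<Longrightarrow> s \<in> carrier S \<Longrightarrow> k (cls m s) = h m \<otimes>\<^bsub>Z\<^esub> w s"
proof -
  interpret Z: comm_inverse_monoid Z by fact
  have w': "w \<in> unital_hom S Z"
    using unital_hom_comp[OF w Z.idem_inclusion] .
  note hs = unital_hom_closed[OF h] unital_hom_mult[OF h] unital_hom_one[OF h]
  note ws = unital_hom_closed[OF w'] unital_hom_mult[OF w'] unital_hom_one[OF w']
  let ?H = "\<lambda>p. h (fst p) \<otimes>\<^bsub>Z\<^esub> w (snd p)"
  have H: "?H \<in> unital_hom (M \<times>\<times> S) Z"
    by (rule unital_homI) (auto simp: prod_simps hs ws Z.m_ac)
  \<comment> \<open>A form of the value that depends only on what \<open>rel\<close> fixes, namely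
    the level and the product with \<open>k\<close>. The idempotent part of the first component
    moves into the level by \<open>eq\<close>, and \<open>w (lev p)\<close> absorbs
    \<open>h k\<close> since \<open>v k\<close> is absorbed by \<open>lev p\<close>.\<close>
  have H_lev: "?H p = h (fst p \<otimes>\<^bsub>M\<^esub> k) \<otimes>\<^bsub>Z\<^esub> w (lev p)"
    if p: "p \<in> carrier (M \<times>\<times> S)" and k: "k \<in> idempotents M" "v k \<otimes>\<^bsub>S\<^esub> lev p = lev p" for p k
  proof -
    obtain m s where ms: "p = (m, s)" "m \<in> carrier M" "s \<in> carrier S"
      using p by (cases p) (auto simp: prod_simps)
    have c: "h m \<in> carrier Z" "h (idem_part M m) \<in> carrier Z" "h k \<in> carrier Z" "w s \<in> carrier Z"
      "w (lev p) \<in> carrier Z" "lev p \<in> carrier S"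
      using ms k p M.idempotents_closed by (auto simp: hs ws)
    have "h m = h m \<otimes>\<^bsub>Z\<^esub> h (idem_part M m)" using ms by (simp add: hs(2)[symmetric])
    moreover have "w (lev p) = h (idem_part M m) \<otimes>\<^bsub>Z\<^esub> w s"
      using ms by (simp add: lev_def ws eq)
    ultimately have 1: "h m \<otimes>\<^bsub>Z\<^esub> w s = h m \<otimes>\<^bsub>Z\<^esub> w (lev p)"
      using c Z.m_assoc[of "h m" "h (idem_part M m)" "w s"] by simp
    have "w (lev p) = h k \<otimes>\<^bsub>Z\<^esub> w (lev p)"
      using ws(2)[of "v k" "lev p"] k c by (simp add: eq)
    then have "h m \<otimes>\<^bsub>Z\<^esub> w (lev p) = h (m \<otimes>\<^bsub>M\<^esub> k) \<otimes>\<^bsub>Z\<^esub> w (lev p)"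
      using ms k c M.idempotents_closed Z.m_assoc[of "h m" "h k" "w (lev p)"] by (simp add: hs(2))
    with 1 show ?thesis by (simp add: ms(1))
  qed
  have "?H p = ?H q" if "rel p q" for p q
  proof -
    from that obtain k where k: "k \<in> idempotents M" "v k \<otimes>\<^bsub>S\<^esub> lev p = lev p"
      "fst p \<otimes>\<^bsub>M\<^esub> k = fst q \<otimes>\<^bsub>M\<^esub> k" "lev p = lev q"
      "p \<in> carrier (M \<times>\<times> S)" "q \<in> carrier (M \<times>\<times> S)" unfolding rel_def by blast
    then show ?thesis using H_lev[of p k] H_lev[of q k] by simp
  qed
  from quot_lift[OF H this] obtain k where "k \<in> unital_hom push Z"
    "\<And>p. p \<in> carrier (M \<times>\<times> S) \<Longrightarrow> k (rel_class rel p) = ?H p" by metis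
  then show thesis by (intro that[of k]) (auto simp: prod_simps)
qed

lemma push_ext:
  assumes h: "h \<in> unital_hom push Z" and k: "k \<in> unital_hom push Z"
    and "\<And>m. m \<in> carrier M \<Longrightarrow> h (cls m \<one>\<^bsub>S\<^esub>) = k (cls m \<one>\<^bsub>S\<^esub>)"
    and "\<And>s. s \<in> carrier S \<Longrightarrow> h (cls \<one>\<^bsub>M\<^esub> s) = k (cls \<one>\<^bsub>M\<^esub> s)"
    and "x \<in> carrier push"
  shows "h x = k x"
proof -
  obtain m s where ms: "m \<in> carrier M" "s \<in> carrier S" "x = cls m s"
    using assms(5) carrier_push by blast
  then have "x = cls m \<one>\<^bsub>S\<^esub> \<otimes>\<^bsub>push\<^esub> cls \<one>\<^bsub>M\<^esub> s" by (simp add: cls_mult)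
  then show ?thesis
    using ms assms(3,4) unital_hom_mult[OF h] unital_hom_mult[OF k] by simp
qed

lemma cls_hom: "(\<lambda>m. cls m \<one>\<^bsub>S\<^esub>) \<in> unital_hom M push"
  by (rule unital_homI) (auto simp: cls_mult one_push)

lemma push_lepoll: "carrier push \<lesssim> carrier M \<times> carrier S"
  unfolding carrier_quot by (simp add: DirProd_def image_lepoll)

end

text \<open>The universal property of the pushout of \<open>M\<close> and \<open>E(N)\<close> over
  \<open>E(M)\<close>, tested against commutative inverse monoids. Taking \<open>w\<close> with
  values in \<open>E(Z)\<close> loses nothing and matches arrows of the base. Uniqueness is kept
  apart from existence because it is mostly used alone, to compare homomorphisms.\<close>

definition idem_pushout :: "'u monoid \<Rightarrow> 'u monoid \<Rightarrow> ('u \<Rightarrow> 'u) \<Rightarrow> bool" where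
  "idem_pushout M N f \<longleftrightarrow>
    (\<forall>Z \<in> (cinv :: 'u monoid set). \<forall>h \<in> unital_hom M Z. \<forall>w \<in> unital_hom (idem_monoid N) (idem_monoid Z).
      (\<forall>e \<in> idempotents M. w (f e) = h e) \<longrightarrow>
      (\<exists>k \<in> unital_hom N Z. (\<forall>x \<in> carrier M. k (f x) = h x) \<and> (\<forall>e \<in> idempotents N. k e = w e))) \<and>
    (\<forall>Z \<in> (cinv :: 'u monoid set). \<forall>k \<in> unital_hom N Z. \<forall>k' \<in> unital_hom N Z.
      (\<forall>x \<in> carrier M. k (f x) = k' (f x)) \<longrightarrow> (\<forall>e \<in> idempotents N. k e = k' e) \<longrightarrow>
      (\<forall>x \<in> carrier N. k x = k' x))"

lemma idem_pushoutE:
  fixes M N Z :: "'u monoid"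
  assumes po: "idem_pushout M N f" and Z: "Z \<in> cinv" and h: "h \<in> unital_hom M Z"
    and w: "w \<in> unital_hom (idem_monoid N) (idem_monoid Z)"
    and eq: "\<And>e. e \<in> idempotents M \<Longrightarrow> w (f e) = h e"
  obtains k where "k \<in> unital_hom N Z" "\<And>x. x \<in> carrier M \<Longrightarrow> k (f x) = h x"
    "\<And>e. e \<in> idempotents N \<Longrightarrow> k e = w e"
proof -
  have "\<exists>k \<in> unital_hom N Z. (\<forall>x \<in> carrier M. k (f x) = h x) \<and> (\<forall>e \<in> idempotents N. k e = w e)"
    using po Z h w eq unfolding idem_pushout_def by blast
  then show thesis using that by blast
qed

lemma idem_pushout_ext:
  fixes M N Z :: "'u monoid"
  assumes po: "idem_pushout M N f" and Z: "Z \<in> cinv"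
    and k: "k \<in> unital_hom N Z" and k': "k' \<in> unital_hom N Z"
    and 1: "\<And>x. x \<in> carrier M \<Longrightarrow> k (f x) = k' (f x)"
    and 2: "\<And>e. e \<in> idempotents N \<Longrightarrow> k e = k' e"
    and x: "x \<in> carrier N"
  shows "k x = k' x"
  using po Z k k' 1 2 x unfolding idem_pushout_def by blast

lemma ex_idem_pushout:
  fixes M S :: "'u monoid"
  assumes inf: "infinite (UNIV :: 'u set)" and M: "M \<in> cinv" and S: "S \<in> slat"
    and v: "v \<in> unital_hom (idem_monoid M) S"
  shows "\<exists>N \<in> cinv. \<exists>f \<in> unital_hom M N. idem_monoid N = S \<and>
    (\<forall>e \<in> idempotents M. f e = v e) \<and> idem_pushout M N f"
proof -
  interpret M: comm_inverse_monoid M using M by (rule cinvD)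
  interpret pushforward M S v
    using S v by (intro pushforward.intro pushforward_axioms.intro M.comm_inverse_monoid_axioms)
      (auto simp: semilattice_monoid_def)
  interpret Q: comm_inverse_monoid push by (rule comm_inverse_monoid_push)
  have small: "carrier push \<prec> (UNIV :: 'u set)"
    using times_lesspoll[OF inf, of "carrier M" "carrier S"] M S
    by (auto simp: small_monoid_def intro: lesspoll_trans1[OF push_lepoll])
  let ?i = "cls \<one>\<^bsub>M\<^esub>"
  have i_inj: "inj_on ?i (carrier S)" using cls_one_inject by (rule inj_onI)
  have i_im: "?i ` carrier S = idempotents push"
  proof
    show "?i ` carrier S \<subseteq> idempotents push" using cls_one_idempotent by blast
    show "idempotents push \<subseteq> ?i ` carrier S"
    proof
      fix x assume x: "x \<in> idempotents push"
      then obtain m s where ms: "m \<in> carrier M" "s \<in> carrier S" "x = cls m s"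
        using Q.idempotents_closed carrier_push by blast
      then have "x = ?i (lev (m, s))" using cls_idempotent x by simp
      then show "x \<in> ?i ` carrier S" using ms by (simp add: prod_simps)
    qed
  qed
  define \<sigma> where "\<sigma> = inv_into (carrier S) ?i"
  have \<sigma>_i: "\<sigma> (?i s) = s" if "s \<in> carrier S" for s
    unfolding \<sigma>_def by (rule inv_into_f_f[OF i_inj that])
  have "bij_betw \<sigma> (idempotents push) (carrier S)"
    unfolding \<sigma>_def using i_inj i_im by (intro bij_betw_inv_into) (simp add: bij_betw_def)
  moreover have "\<sigma> \<in> unital_hom (idem_monoid push) S"
    by (rule unital_homI) (auto simp: i_im[symmetric] \<sigma>_i cls_mult one_push)
  moreover have "small_monoid S" using S by simp
  ultimately obtain e where e: "inj_on e (carrier push)" "\<And>x. x \<in> idempotents push \<Longrightarrow> e x = \<sigma> x"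
    "idem_monoid (copy e push) = S"
    using strict_copy[OF comm_inverse_monoid_push small inf] by metis
  let ?N = "copy e push" and ?f = "\<lambda>m. e (cls m \<one>\<^bsub>S\<^esub>)"
  have e_i: "e (?i s) = s" if "s \<in> carrier S" for s
    using e(2)[OF cls_one_idempotent[OF that]] \<sigma>_i[OF that] by simp
  have idem_N: "idempotents ?N = carrier S"
    using e(3) carrier_idem_monoid[of ?N] by simp
  have N: "?N \<in> cinv"
    using small_monoid_copy[OF small, of e] comm_inverse_monoid_copy[OF comm_inverse_monoid_push e(1)]
    by (simp add: comm_inv_monoid_iff)
  have f: "?f \<in> unital_hom M ?N"
    by (rule unital_hom_comp[OF cls_hom copy_hom[OF e(1)]])
  have f_idem: "?f x = v x" if "x \<in> idempotents M" for x
    using that by (simp add: cls_v e_i)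
  have po: "idem_pushout M ?N ?f"
    unfolding idem_pushout_def
  proof (intro conjI ballI impI)
    fix Z h w
    assume Z: "Z \<in> (cinv :: 'u monoid set)" and h: "h \<in> unital_hom M Z"
      and w: "w \<in> unital_hom (idem_monoid ?N) (idem_monoid Z)"
      and eq: "\<forall>x \<in> idempotents M. w (?f x) = h x"
    interpret Z: comm_inverse_monoid Z using Z by (rule cinvD)
    have w': "w \<in> unital_hom S (idem_monoid Z)" using w e(3) by simp
    have "w (v x) = h x" if "x \<in> idempotents M" for x
      using eq f_idem that by metis
    then obtain k where k: "k \<in> unital_hom push Z"
      "\<And>m s. m \<in> carrier M \<Longrightarrow> s \<in> carrier S \<Longrightarrow> k (cls m s) = h m \<otimes>\<^bsub>Z\<^esub> w s"
      using push_lift[OF Z.comm_inverse_monoid_axioms h w'] by metis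
    let ?k = "\<lambda>x. k (inv_into (carrier push) e x)"
    have k1: "?k \<in> unital_hom ?N Z"
      by (rule unital_hom_comp[OF copy_inv_hom[OF Q.monoid_axioms e(1)] k(1)])
    have k2: "?k (?f x) = h x" if "x \<in> carrier M" for x
      using that e(1) unital_hom_one[OF w'] unital_hom_closed[OF h] by (simp add: k(2))
    have k3: "?k x = w x" if "x \<in> idempotents ?N" for x
    proof -
      have x: "x \<in> carrier S" using that idem_N by simp
      have "inv_into (carrier push) e x = ?i x"
        using inv_into_f_f[OF e(1), of "?i x"] x e_i by simp
      then show ?thesis
        using x unital_hom_one[OF h] unital_hom_closed[OF w' x] Z.idempotents_closed by (simp add: k(2))
    qed
    show "\<exists>k \<in> unital_hom ?N Z. (\<forall>x \<in> carrier M. k (?f x) = h x) \<and> (\<forall>x \<in> idempotents ?N. k x = w x)"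
      by (rule bexI[OF _ k1], intro conjI ballI) (fact k2 k3)+
  next
    fix Z k k' x
    assume Z: "Z \<in> (cinv :: 'u monoid set)" and k: "k \<in> unital_hom ?N Z" and k': "k' \<in> unital_hom ?N Z"
      and 1: "\<forall>x \<in> carrier M. k (?f x) = k' (?f x)" and 2: "\<forall>x \<in> idempotents ?N. k x = k' x"
      and "x \<in> carrier ?N"
    then obtain y where y: "y \<in> carrier push" "x = e y" by auto
    have "k (e y) = k' (e y)"
      by (rule push_ext[OF unital_hom_comp[OF copy_hom[OF e(1)] k] unital_hom_comp[OF copy_hom[OF e(1)] k']])
        (use 1 2 y in \<open>auto simp: e_i idem_N\<close>)
    then show "k x = k' x" using y by simp
  qed
  show ?thesis
    by (rule bexI[OF _ N], rule bexI[OF _ f]) (use e(3) f_idem po in blast)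
qed

section \<open>The functor \<open>E\<close> and its opcartesian arrows\<close>

lemma obj_map_E [simp]: "obj_map E M = idem_monoid M"
  and arr_map_E: "arr_map E f = mon_arr_on (idem_monoid (src f)) (idem_monoid (tgt f)) (fun_of f)"
  by (simp_all add: E_def mon_arr_on_def)

lemma src_tgt_E [simp]:
  "src (arr_map E f) = idem_monoid (src f)" "tgt (arr_map E f) = idem_monoid (tgt f)"
  by (simp_all add: arr_map_E)

lemma E_apply [simp]: "e \<in> idempotents (src f) \<Longrightarrow> fun_of (arr_map E f) e = fun_of f e"
  by (simp add: arr_map_E)

lemma idem_monoid_slat [simp]: "M \<in> cinv \<Longrightarrow> idem_monoid M \<in> slat"
  using comm_inverse_monoid.semilattice_idem_monoid[OF cinvD] small_idem_monoid by auto

lemma slat_monoid: "M \<in> slat \<Longrightarrow> monoid M"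
  by (simp add: semilattice_monoid_def comm_monoid.axioms(1))

lemma cinv_monoid: "M \<in> cinv \<Longrightarrow> monoid M"
  by (simp add: comm_inv_monoid_def comm_monoid.axioms(1))

text \<open>Nothing is assumed about the tensor data, since functoriality and lifting concern the
  underlying categories only. The results thus hold for the given structure and for the strict
  one.\<close>

locale idem_functor =
  fixes U :: "'u monoid" and u :: 'u
    and t :: "'u monoid \<Rightarrow> 'u monoid \<Rightarrow> 'u monoid"
    and p :: "'u monoid \<Rightarrow> 'u monoid \<Rightarrow> 'u \<Rightarrow> 'u \<Rightarrow> 'u"
    and U' :: "'u monoid" and u' :: 'u
    and t' :: "'u monoid \<Rightarrow> 'u monoid \<Rightarrow> 'u monoid"
    and p' :: "'u monoid \<Rightarrow> 'u monoid \<Rightarrow> 'u \<Rightarrow> 'u \<Rightarrow> 'u"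
begin

abbreviation C :: "('u monoid, 'u mon_arr) monoidal_cat" where
  "C \<equiv> tensor_category_on cinv U u t p"

abbreviation S :: "('u monoid, 'u mon_arr) monoidal_cat" where
  "S \<equiv> tensor_category_on slat U' u' t' p'"

lemmas C_eqI = Arr_eqI[where K = cinv and U = U and u = u and t = t and p = p]
lemmas S_eqI = Arr_eqI[where K = slat and U = U' and u = u' and t = t' and p = p']

sublocale C: category C
  by (rule category_on) (rule cinv_monoid)

sublocale S: category S
  by (rule category_on) (rule slat_monoid)

lemma C_Comp_Arr: "f \<in> Arr C \<Longrightarrow> g \<in> Arr C \<Longrightarrow> tgt f = src g \<Longrightarrow> Comp C g f \<in> Arr C"
  by (rule Comp_on_Arr[OF _ _ _ cinv_monoid])

lemma S_Comp_Arr: "f \<in> Arr S \<Longrightarrow> g \<in> Arr S \<Longrightarrow> tgt f = src g \<Longrightarrow> Comp S g f \<in> Arr S"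
  by (rule Comp_on_Arr[OF _ _ _ slat_monoid])

lemma C_Id_Arr: "A \<in> cinv \<Longrightarrow> Id C A \<in> Arr C"
  using C.Id_in_Homset[of A] by (simp add: Homset_def)

lemma S_Id_Arr: "A \<in> slat \<Longrightarrow> Id S A \<in> Arr S"
  using S.Id_in_Homset[of A] by (simp add: Homset_def)

lemma C_mon_arr: "A \<in> cinv \<Longrightarrow> B \<in> cinv \<Longrightarrow> h \<in> unital_hom A B \<Longrightarrow> mon_arr_on A B h \<in> Arr C"
  by (rule mon_arr_on_Arr[OF cinv_monoid])

lemma S_mon_arr: "A \<in> slat \<Longrightarrow> B \<in> slat \<Longrightarrow> h \<in> unital_hom A B \<Longrightarrow> mon_arr_on A B h \<in> Arr S"
  by (rule mon_arr_on_Arr[OF slat_monoid])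

lemma E_Arr:
  assumes "f \<in> Arr C"
  shows "arr_map E f \<in> Arr S"
  unfolding arr_map_E
  by (intro S_mon_arr idem_monoid_slat unital_hom_idem_monoid Arr_hom[OF assms] Arr_src[OF assms]
      Arr_tgt[OF assms])

lemma fun_of_idempotents:
  assumes "f \<in> Arr C" "e \<in> idempotents (src f)"
  shows "fun_of f e \<in> idempotents (tgt f)"
  by (rule unital_hom_idempotents[OF Arr_hom[OF assms(1)] assms(2)])

lemma idem_sub: "e \<in> idempotents M \<Longrightarrow> e \<in> carrier M"
  by (simp add: idempotents_def)

lemma is_functor_E: "is_functor C S E"
proof (intro is_functor.intro is_functor_axioms.intro C.category_axioms S.category_axioms)
  fix A assume "A \<in> Obj C"
  then have A: "A \<in> cinv" by simp
  then show "obj_map E A \<in> Obj S" using idem_monoid_slat by simp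
  show "arr_map E (Id C A) = Id S (obj_map E A)"
    by (rule S_eqI[OF E_Arr[OF C_Id_Arr[OF A]] S_Id_Arr])
      (use idem_monoid_slat[OF A] in \<open>simp_all add: idem_sub del: mem_Collect_eq\<close>)
next
  fix f A B assume "f \<in> Homset C A B"
  then show "arr_map E f \<in> Homset S (obj_map E A) (obj_map E B)"
    using E_Arr by (simp add: Homset_def)
next
  fix f g A B D assume fg: "f \<in> Homset C A B" "g \<in> Homset C B D"
  then have *: "f \<in> Arr C" "g \<in> Arr C" "tgt f = src g" by (simp_all add: Homset_def)
  show "arr_map E (Comp C g f) = Comp S (arr_map E g) (arr_map E f)"
    by (rule S_eqI[OF E_Arr[OF C_Comp_Arr[OF *]] S_Comp_Arr[OF E_Arr[OF *(1)] E_Arr[OF *(2)]]])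
      (use * fun_of_idempotents[OF *(1)] in \<open>simp_all add: idem_sub\<close>)
qed

text \<open>A pair \<open>(h, w)\<close> that agrees on \<open>E(M)\<close> is exactly a lifting
  problem: \<open>h\<close> is the arrow to be factored through \<open>f\<close>, and
  \<open>w\<close> the prescribed base arrow of the factor.\<close>

lemma opcartesian_imp_idem_pushout:
  assumes op: "opcartesian C S E f"
  shows "idem_pushout (src f) (tgt f) (fun_of f)"
proof -
  have f: "f \<in> Arr C" using op by (simp add: opcartesian_def)
  note K = Arr_src[OF f] Arr_tgt[OF f]
  have lift: "\<exists>!h. h \<in> Homset C (tgt f) Z \<and> arr_map E h = w \<and> Comp C h f = g"
    if "g \<in> Arr C" "src g = src f" "tgt g = Z" "w \<in> Arr S" "src w = idem_monoid (tgt f)" "tgt w = idem_monoid Z"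
      "Comp S w (arr_map E f) = arr_map E g" for g w Z
    using op that Arr_tgt[OF that(1)] by (simp add: opcartesian_def Homset_def)
  show ?thesis
    unfolding idem_pushout_def
  proof (intro conjI ballI impI)
    fix Z h w
    assume Z: "Z \<in> (cinv :: 'u monoid set)" and h: "h \<in> unital_hom (src f) Z"
      and w: "w \<in> unital_hom (idem_monoid (tgt f)) (idem_monoid Z)"
      and eq: "\<forall>e \<in> idempotents (src f). w (fun_of f e) = h e"
    let ?g = "mon_arr_on (src f) Z h" and ?w = "mon_arr_on (idem_monoid (tgt f)) (idem_monoid Z) w"
    have g: "?g \<in> Arr C" by (rule C_mon_arr[OF K(1) Z h])
    have w': "?w \<in> Arr S" by (rule S_mon_arr[OF idem_monoid_slat[OF K(2)] idem_monoid_slat[OF Z] w])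
    have "Comp S ?w (arr_map E f) = arr_map E ?g"
      by (rule S_eqI[OF S_Comp_Arr[OF E_Arr[OF f] w'] E_Arr[OF g]])
        (use eq fun_of_idempotents[OF f] in \<open>simp_all add: idem_sub\<close>)
    then obtain k where k: "k \<in> Homset C (tgt f) Z" "arr_map E k = ?w" "Comp C k f = ?g"
      using lift[of ?g Z ?w] g w' by auto
    have kA: "k \<in> Arr C" "src k = tgt f" "tgt k = Z" using k(1) by (simp_all add: Homset_def)
    show "\<exists>k \<in> unital_hom (tgt f) Z. (\<forall>x \<in> carrier (src f). k (fun_of f x) = h x) \<and>
        (\<forall>e \<in> idempotents (tgt f). k e = w e)"
    proof (rule bexI[of _ "fun_of k"], intro conjI ballI)
      show "fun_of k (fun_of f x) = h x" if "x \<in> carrier (src f)" for x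
        using arg_cong[OF k(3), of "\<lambda>a. fun_of a x"] that by simp
      show "fun_of k e = w e" if "e \<in> idempotents (tgt f)" for e
        using arg_cong[OF k(2), of "\<lambda>a. fun_of a e"] that kA(2) by simp
      show "fun_of k \<in> unital_hom (tgt f) Z" using Arr_hom[OF kA(1)] kA(2,3) by simp
    qed
  next
    fix Z k k' x
    assume Z: "Z \<in> (cinv :: 'u monoid set)" and k: "k \<in> unital_hom (tgt f) Z" and k': "k' \<in> unital_hom (tgt f) Z"
      and 1: "\<forall>x \<in> carrier (src f). k (fun_of f x) = k' (fun_of f x)"
      and 2: "\<forall>e \<in> idempotents (tgt f). k e = k' e" and x: "x \<in> carrier (tgt f)"
    let ?k = "mon_arr_on (tgt f) Z k" and ?k' = "mon_arr_on (tgt f) Z k'"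
    have kA: "?k \<in> Arr C" "?k' \<in> Arr C" by (rule C_mon_arr[OF K(2) Z k], rule C_mon_arr[OF K(2) Z k'])
    have eq: "Comp C ?k' f = Comp C ?k f"
      by (rule C_eqI[OF C_Comp_Arr[OF f kA(2)] C_Comp_Arr[OF f kA(1)]])
        (use 1 Arr_closed[OF f] in simp_all)
    have eqE: "arr_map E ?k' = arr_map E ?k"
      by (rule S_eqI[OF E_Arr[OF kA(2)] E_Arr[OF kA(1)]]) (use 2 in \<open>simp_all add: idem_sub\<close>)
    have compE: "Comp S (arr_map E ?k) (arr_map E f) = arr_map E (Comp C ?k f)"
      by (rule S_eqI[OF S_Comp_Arr[OF E_Arr[OF f] E_Arr[OF kA(1)]] E_Arr[OF C_Comp_Arr[OF f kA(1)]]])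
        (use fun_of_idempotents[OF f] in \<open>simp_all add: idem_sub\<close>)
    \<comment> \<open>Both \<open>?k\<close> and \<open>?k'\<close> solve the lifting problem posed
      by \<open>?k\<close> itself, so they coincide.\<close>
    have ex1: "\<exists>!h. h \<in> Homset C (tgt f) Z \<and> arr_map E h = arr_map E ?k \<and> Comp C h f = Comp C ?k f"
      by (rule lift[OF C_Comp_Arr[OF f kA(1)] _ _ E_Arr[OF kA(1)] _ _ compE]) simp_all
    have "?k \<in> Homset C (tgt f) Z" "?k' \<in> Homset C (tgt f) Z"
      using kA by (simp_all add: Homset_def)
    then have "?k = ?k'"
      using ex1 eq eqE by blast
    then show "k x = k' x"
      using x fun_of_mon_arr_on[of x "tgt f" Z k] fun_of_mon_arr_on[of x "tgt f" Z k'] by simp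
  qed
qed

lemma idem_pushout_imp_opcartesian:
  assumes f: "f \<in> Arr C" and po: "idem_pushout (src f) (tgt f) (fun_of f)"
  shows "opcartesian C S E f"
  unfolding opcartesian_def
proof (intro conjI f ballI impI)
  fix Z g w
  assume "Z \<in> Obj C" "g \<in> Homset C (Dom C f) Z"
    and "w \<in> Homset S (obj_map E (Cod C f)) (obj_map E Z)"
    and eq: "Comp S w (arr_map E f) = arr_map E g"
  then have Z: "Z \<in> cinv" and g: "g \<in> Arr C" "src g = src f" "tgt g = Z"
    and w: "w \<in> Arr S" "src w = idem_monoid (tgt f)" "tgt w = idem_monoid Z"
    by (simp_all add: Homset_def)
  note K = Arr_src[OF f] Arr_tgt[OF f]
  have h: "fun_of g \<in> unital_hom (src f) Z" using Arr_hom[OF g(1)] g by simp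
  have wh: "fun_of w \<in> unital_hom (idem_monoid (tgt f)) (idem_monoid Z)" using Arr_hom[OF w(1)] w by simp
  have "fun_of w (fun_of f e) = fun_of g e" if "e \<in> idempotents (src f)" for e
    using arg_cong[OF eq, of "\<lambda>a. fun_of a e"] that g(2) by simp
  then obtain k where k: "k \<in> unital_hom (tgt f) Z" "\<And>x. x \<in> carrier (src f) \<Longrightarrow> k (fun_of f x) = fun_of g x"
    "\<And>e. e \<in> idempotents (tgt f) \<Longrightarrow> k e = fun_of w e"
    using idem_pushoutE[OF po Z h wh] by metis
  let ?k = "mon_arr_on (tgt f) Z k"
  have kA: "?k \<in> Arr C" by (rule C_mon_arr[OF K(2) Z k(1)])
  show "\<exists>!h. h \<in> Homset C (Cod C f) Z \<and> arr_map E h = w \<and> Comp C h f = g"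
  proof (rule ex1I[of _ ?k], intro conjI)
    show "?k \<in> Homset C (Cod C f) Z" using kA by (simp add: Homset_def)
    show "arr_map E ?k = w"
      by (rule S_eqI[OF E_Arr[OF kA] w(1)]) (use w k(3) in \<open>simp_all add: idem_sub\<close>)
    show "Comp C ?k f = g"
      by (rule C_eqI[OF C_Comp_Arr[OF f kA] g(1)]) (use g k(2) Arr_closed[OF f] in simp_all)
  next
    fix l assume l: "l \<in> Homset C (Cod C f) Z \<and> arr_map E l = w \<and> Comp C l f = g"
    then have lA: "l \<in> Arr C" "src l = tgt f" "tgt l = Z" by (simp_all add: Homset_def)
    have lh: "fun_of l \<in> unital_hom (tgt f) Z" using Arr_hom[OF lA(1)] lA by simp
    have "fun_of l x = k x" if "x \<in> carrier (tgt f)" for x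
    proof (rule idem_pushout_ext[OF po Z lh k(1) _ _ that])
      show "fun_of l (fun_of f x) = k (fun_of f x)" if "x \<in> carrier (src f)" for x
        using l that k(2)[OF that] Comp_on_apply[of x f] by metis
      show "fun_of l e = k e" if "e \<in> idempotents (tgt f)" for e
        using l that k(3)[OF that] lA(2) E_apply[of e l] by metis
    qed
    then show "l = ?k"
      by (intro C_eqI[OF lA(1) kA]) (use lA in simp_all)
  qed
qed

lemma opcartesian_E_iff:
  "opcartesian C S E f \<longleftrightarrow> f \<in> Arr C \<and> idem_pushout (src f) (tgt f) (fun_of f)"
proof -
  have "f \<in> Arr C" if "opcartesian C S E f"
    using that unfolding opcartesian_def by (rule conjunct1)
  then show ?thesis
    using opcartesian_imp_idem_pushout[of f] idem_pushout_imp_opcartesian[of f] by argo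
qed

lemma opfibration_E:
  assumes inf: "infinite (UNIV :: 'u set)"
  shows "opfibration C S E"
proof (intro opfibration.intro opfibration_axioms.intro is_functor_E)
  fix M v assume "M \<in> Obj C" "v \<in> Arr S" "Dom S v = obj_map E M"
  then have M: "M \<in> cinv" and v: "v \<in> Arr S" "src v = idem_monoid M" by simp_all
  have "fun_of v \<in> unital_hom (idem_monoid M) (tgt v)" using Arr_hom[OF v(1)] v(2) by simp
  then obtain N f where N: "N \<in> cinv" and f: "f \<in> unital_hom M N" "idem_monoid N = tgt v"
    "\<And>e. e \<in> idempotents M \<Longrightarrow> f e = fun_of v e" and po: "idem_pushout M N f"
    using ex_idem_pushout[OF inf M Arr_tgt[OF v(1)]] by blast
  let ?f = "mon_arr_on M N f"
  have fA: "?f \<in> Arr C" by (rule C_mon_arr[OF M N f(1)])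
  have "arr_map E ?f = v"
    by (rule S_eqI[OF E_Arr[OF fA] v(1)]) (use v f in \<open>simp_all add: idem_sub\<close>)
  moreover have "idem_pushout M N (fun_of ?f)"
    using po unfolding idem_pushout_def by (simp add: idem_sub)
  ultimately show "\<exists>f. opcartesian C S E f \<and> Dom C f = M \<and> arr_map E f = v"
    using fA idem_pushout_imp_opcartesian[OF fA] by (intro exI[of _ ?f]) simp
qed

end

section \<open>Comparison of two choices of tensor products\<close>

locale tensor_comparison = X: tensor_structure K U u t p + Y: tensor_structure K U' u' t' p'
  for K :: "'u monoid set" and U u t p U' u' t' p'
begin

text \<open>The two monoidal categories differ only in their tensor data. Rewriting arrows,
  composition and identities of \<open>X.V\<close> to those of \<open>Y.V\<close> allows the
  coherence laws to be verified in one category.\<close>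

lemma Arr_X [simp]: "Arr X.V = Arr Y.V"
  by (rule Set.set_eqI) (simp only: Arr_on_iff)

lemma Comp_X [simp]: "Comp X.V = Comp Y.V"
  by (intro HOL.ext) (simp only: Comp_on_eq)

lemma Id_X [simp]: "Id X.V = Id Y.V"
  by (intro HOL.ext) (simp only: Id_on_eq)

lemmas X_Arr_simps [simp] = X.Arr_simps[unfolded Arr_X]

text \<open>The direction is that of the structure maps of the identity functor
  \<open>X.V -> Y.V\<close>: from the tensor product of the target category to that of the
  source.\<close>

definition comparison :: "'u monoid \<Rightarrow> 'u monoid \<Rightarrow> 'u mon_arr" where
  "comparison A B = mon_arr_on (t' A B) (t A B) (SOME h. h \<in> unital_hom (t' A B) (t A B) \<and>
     (\<forall>a \<in> carrier A. \<forall>b \<in> carrier B. h (p' A B a b) = p A B a b))"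

definition unit_comparison :: "'u mon_arr" where
  "unit_comparison = mon_arr_on U' U (SOME h. h \<in> unital_hom U' U \<and> h u' = u)"

lemma src_tgt_comparison [simp]:
  "src (comparison A B) = t' A B" "tgt (comparison A B) = t A B"
  "src unit_comparison = U'" "tgt unit_comparison = U"
  by (simp_all add: comparison_def unit_comparison_def)

lemma comparison:
  assumes K: "A \<in> K" "B \<in> K"
  shows "comparison A B \<in> Arr Y.V \<and>
    (\<forall>a \<in> carrier A. \<forall>b \<in> carrier B. fun_of (comparison A B) (p' A B a b) = p A B a b)"
proof -
  have "\<exists>h. h \<in> unital_hom (t' A B) (t A B) \<and>
      (\<forall>a \<in> carrier A. \<forall>b \<in> carrier B. h (p' A B a b) = p A B a b)"
    using Y.p_lift[OF K X.tensor_closed[OF K] X.p_bihom[OF K]] by blast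
  from someI_ex[OF this] show ?thesis
    unfolding comparison_def using K by (simp add: mon_arr_on_Arr)
qed

lemma unit_comparison: "unit_comparison \<in> Arr Y.V \<and> fun_of unit_comparison u' = u"
proof -
  have "\<exists>h. h \<in> unital_hom U' U \<and> h u' = u"
    using Y.free_lift[OF X.unit_closed X.u_closed] by blast
  from someI_ex[OF this] show ?thesis
    unfolding unit_comparison_def by (simp add: mon_arr_on_Arr)
qed

lemma comparison_Arr [simp]: "A \<in> K \<Longrightarrow> B \<in> K \<Longrightarrow> comparison A B \<in> Arr Y.V"
  and comparison_apply [simp]: "A \<in> K \<Longrightarrow> B \<in> K \<Longrightarrow> a \<in> carrier A \<Longrightarrow> b \<in> carrier B \<Longrightarrow>
    fun_of (comparison A B) (p' A B a b) = p A B a b"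
  and unit_comparison_Arr [simp]: "unit_comparison \<in> Arr Y.V"
  and unit_comparison_apply [simp]: "fun_of unit_comparison u' = u"
  using comparison unit_comparison by blast+

lemma comparison_Isoset:
  assumes K: "A \<in> K" "B \<in> K"
  shows "comparison A B \<in> Isoset Y.V (t' A B) (t A B)"
proof -
  obtain g where g: "g \<in> unital_hom (t A B) (t' A B)"
    "\<And>a b. a \<in> carrier A \<Longrightarrow> b \<in> carrier B \<Longrightarrow> g (p A B a b) = p' A B a b"
    using X.p_lift[OF K Y.tensor_closed[OF K] Y.p_bihom[OF K]] by blast
  have c: "fun_of (comparison A B) \<in> unital_hom (t' A B) (t A B)"
    using K by (intro Y.Arr_unital_hom) auto
  show ?thesis
  proof (rule Y.Isoset_onI[OF _ _ _ g(1)])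
    show "fun_of (comparison A B) (g x) = x" if "x \<in> carrier (t A B)" for x
      by (rule X.p_ext[OF K _ unital_hom_comp[OF g(1) c] unital_hom_id _ that])
        (use K in \<open>auto simp: g(2)\<close>)
    show "k x = x" if k: "k \<in> unital_hom (t' A B) (t' A B)" "k = (\<lambda>x. g (fun_of (comparison A B) x))"
      and x: "x \<in> carrier (t' A B)" for k x
      by (rule Y.p_ext[OF K _ k(1) unital_hom_id _ x]) (use K k(2) in \<open>auto simp: g(2)\<close>)
  qed (use K in auto)
qed

lemma unit_comparison_Isoset: "unit_comparison \<in> Isoset Y.V U' U"
proof -
  obtain g where g: "g \<in> unital_hom U U'" "g u = u'"
    using X.free_lift[OF Y.unit_closed Y.u_closed] by blast
  have c: "fun_of unit_comparison \<in> unital_hom U' U"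
    by (intro Y.Arr_unital_hom) auto
  show ?thesis
  proof (rule Y.Isoset_onI[OF _ _ _ g(1)])
    show "fun_of unit_comparison (g x) = x" if "x \<in> carrier U" for x
      by (rule X.free_ext[OF _ unital_hom_comp[OF g(1) c] unital_hom_id _ that]) (simp_all add: g(2))
    show "k x = x" if k: "k \<in> unital_hom U' U'" "k = (\<lambda>x. g (fun_of unit_comparison x))"
      and x: "x \<in> carrier U'" for k x
      by (rule Y.free_ext[OF _ k(1) unital_hom_id _ x]) (simp_all add: k(2) g(2))
  qed auto
qed

lemma is_functor_id: "is_functor X.V Y.V id_ftr"
  by (intro is_functor.intro is_functor_axioms.intro X.category_axioms Y.category_axioms)
    (simp_all add: id_ftr_def Homset_def)

lemma strong_monoidal_functor_id: "strong_monoidal_functor X.V Y.V id_ftr comparison unit_comparison"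
proof (intro strong_monoidal_functor.intro strong_monoidal_functor_axioms.intro
    X.monoidal_category_axioms Y.monoidal_category_axioms is_functor_id, goal_cases)
  case (1 x y)
  then show ?case using comparison_Isoset by (simp add: id_ftr_def)
next
  case (2 f x x' g y y')
  then have "x \<in> K" "y \<in> K" "x' \<in> K" "y' \<in> K" by (auto simp: Homset_def)
  with 2 show ?case
    by - (rule Y.Arr_eq_tensor[of _ _ x y], auto simp: Homset_def id_ftr_def)
next
  case 3
  then show ?case using unit_comparison_Isoset by (simp add: id_ftr_def)
next
  case (4 x y z)
  then show ?case
    by - (rule Y.Arr_eq_left[of _ _ x y z], auto simp: id_ftr_def)
next
  case (5 x)
  then show ?case
    by - (rule Y.Arr_eq_lunit[of _ _ x], auto simp: id_ftr_def)
next
  case (6 x)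
  then show ?case
    by - (rule Y.Arr_eq_runit[of _ _ x], auto simp: id_ftr_def)
qed

end

section \<open>Strict tensor products and the monoidal opfibration\<close>

text \<open>A bihomomorphism is a homomorphism in each variable, so the idempotent part of a value
  can be taken in the first argument, in the second, or in both. This makes \<open>E\<close>
  compatible with tensor products.\<close>

lemma bihom_idem_part:
  fixes A :: "'a monoid" and B :: "'b monoid" and C :: "'c monoid"
  assumes A: "comm_inverse_monoid A" and B: "comm_inverse_monoid B" and C: "comm_inverse_monoid C"
    and \<beta>: "\<beta> \<in> bihom A B C" and a: "a \<in> carrier A" and b: "b \<in> carrier B"
  shows "\<beta> (idem_part A a) b = idem_part C (\<beta> a b)"
    and "\<beta> a (idem_part B b) = idem_part C (\<beta> a b)"
    and "\<beta> (idem_part A a) (idem_part B b) = idem_part C (\<beta> a b)"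
proof -
  interpret A: comm_inverse_monoid A by fact
  interpret C: comm_inverse_monoid C by fact
  have 1: "\<beta> (idem_part A a) b = idem_part C (\<beta> a b)" if "b \<in> carrier B" for b
    by (rule unital_hom_idem_part[OF A C bihom_left[OF \<beta> that] a])
  have 2: "\<beta> a (idem_part B b) = idem_part C (\<beta> a b)" if "a \<in> carrier A" for a
    by (rule unital_hom_idem_part[OF B C bihom_right[OF \<beta> that] b])
  show "\<beta> (idem_part A a) b = idem_part C (\<beta> a b)" by (rule 1[OF b])
  show "\<beta> a (idem_part B b) = idem_part C (\<beta> a b)" by (rule 2[OF a])
  show "\<beta> (idem_part A a) (idem_part B b) = idem_part C (\<beta> a b)"
    using 2[OF A.idem_part_closed[OF a]] 1[OF b] bihom_closed[OF \<beta> a b] by simp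
qed

text \<open>The strict situation: idempotents of tensor products, pure elements of idempotents and
  the unit agree literally with their counterparts over \<open>slat\<close>. The generators can
  match only after taking the idempotent part, as the generator \<open>Some 1\<close> of
  \<open>int0\<close> is not idempotent.\<close>

locale strict_tensor_structure =
  T: tensor_structure cinv U u t p + S: tensor_structure slat U' u' t' p' +
  idem_functor U u t p U' u' t' p'
  for U :: "'u monoid" and u t p and U' :: "'u monoid" and u' t' p' +
  assumes idem_tensor: "A \<in> cinv \<Longrightarrow> B \<in> cinv \<Longrightarrow>
      idem_monoid (t A B) = t' (idem_monoid A) (idem_monoid B)"
    and idem_p: "A \<in> cinv \<Longrightarrow> B \<in> cinv \<Longrightarrow> e \<in> idempotents A \<Longrightarrow> f \<in> idempotents B \<Longrightarrow>
      p' (idem_monoid A) (idem_monoid B) e f = p A B e f"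
    and idem_U: "idem_monoid U = U'"
    and idem_u: "idem_part U u = u'"
begin

lemma idempotents_tensor:
  "A \<in> cinv \<Longrightarrow> B \<in> cinv \<Longrightarrow> idempotents (t A B) = carrier (t' (idem_monoid A) (idem_monoid B))"
  using idem_tensor[of A B] carrier_idem_monoid[of "t A B"] by simp

lemma p_idempotent:
  assumes "A \<in> cinv" "B \<in> cinv" "e \<in> idempotents A" "b \<in> carrier B"
  shows "p A B e b \<in> idempotents (t A B)"
  by (rule unital_hom_idempotents[OF T.p_left[OF assms(1,2,4)] assms(3)])

lemma p_idempotent':
  assumes "A \<in> cinv" "B \<in> cinv" "a \<in> carrier A" "f \<in> idempotents B"
  shows "p A B a f \<in> idempotents (t A B)"
  by (rule unital_hom_idempotents[OF T.p_right[OF assms(1,2,3)] assms(4)])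

lemma p_idem_part:
  assumes "A \<in> cinv" "B \<in> cinv" "a \<in> carrier A" "b \<in> carrier B"
  shows "p A B a (idem_part B b) = idem_part (t A B) (p A B a b)"
    and "p A B (idem_part A a) b = idem_part (t A B) (p A B a b)"
  by (rule bihom_idem_part[OF cinvD[OF assms(1)] cinvD[OF assms(2)]
        cinvD[OF T.tensor_closed[OF assms(1,2)]] T.p_bihom[OF assms(1,2)] assms(3,4)])+

lemma idem_part_tensor:
  "A \<in> cinv \<Longrightarrow> B \<in> cinv \<Longrightarrow> x \<in> idempotents (t A B) \<Longrightarrow> idem_part (t A B) x = x"
  by (rule comm_inverse_monoid.idem_part_idempotent[OF cinvD[OF T.tensor_closed]])

text \<open>\<open>e \<otimes> b\<close> is idempotent because \<open>e\<close> is, hence equal to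
  its own idempotent part, which may be computed in the second variable.\<close>

lemma p_idem_part_right:
  assumes "A \<in> cinv" "B \<in> cinv" "e \<in> idempotents A" "b \<in> carrier B"
  shows "p A B e (idem_part B b) = p A B e b"
  using p_idem_part(1)[OF assms(1,2) idem_sub[OF assms(3)] assms(4)]
  by (simp only: idem_part_tensor[OF assms(1,2) p_idempotent[OF assms]])

lemma p_idem_part_left:
  assumes "A \<in> cinv" "B \<in> cinv" "a \<in> carrier A" "f \<in> idempotents B"
  shows "p A B (idem_part A a) f = p A B a f"
  using p_idem_part(2)[OF assms(1,2,3) idem_sub[OF assms(4)]]
  by (simp only: idem_part_tensor[OF assms(1,2) p_idempotent'[OF assms]])

text \<open>Each one-variable extension needs prescribed values on idempotents; these are supplied
  by \<open>w\<close> after the other variable is replaced by its idempotent part. The existence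
  half of the pushout property produces the extensions, and its uniqueness half shows that they are
  homomorphic in the remaining variable.\<close>

lemma idem_pushout_tensor:
  assumes K: "A \<in> cinv" "A' \<in> cinv" "B \<in> cinv" "B' \<in> cinv"
    and f: "f \<in> unital_hom A A'" and g: "g \<in> unital_hom B B'"
    and pf: "idem_pushout A A' f" and pg: "idem_pushout B B' g"
    and F: "F \<in> unital_hom (t A B) (t A' B')"
    and Fp: "\<And>a b. a \<in> carrier A \<Longrightarrow> b \<in> carrier B \<Longrightarrow> F (p A B a b) = p A' B' (f a) (g b)"
  shows "idem_pushout (t A B) (t A' B') F"
  unfolding idem_pushout_def
proof (intro conjI ballI impI)
  fix Z h w
  assume Z: "Z \<in> (cinv :: 'u monoid set)" and h: "h \<in> unital_hom (t A B) Z"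
    and w: "w \<in> unital_hom (idem_monoid (t A' B')) (idem_monoid Z)"
    and eq: "\<forall>x \<in> idempotents (t A B). w (F x) = h x"
  interpret A: comm_inverse_monoid A using K(1) by (rule cinvD)
  interpret B: comm_inverse_monoid B using K(3) by (rule cinvD)
  interpret A': comm_inverse_monoid A' using K(2) by (rule cinvD)
  interpret B': comm_inverse_monoid B' using K(4) by (rule cinvD)
  interpret Z: comm_inverse_monoid Z using Z by (rule cinvD)
  note E = idem_monoid_slat[OF K(2)] idem_monoid_slat[OF K(4)]
  \<comment> \<open>\<open>w\<close> read as a bihomomorphism on idempotents; this is legitimate
    since the idempotents of \<open>t A' B'\<close> are literally the semilattice tensor
    product.\<close>
  define W where "W e e' = w (p' (idem_monoid A') (idem_monoid B') e e')" for e e'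
  have W: "W \<in> bihom (idem_monoid A') (idem_monoid B') (idem_monoid Z)"
    unfolding W_def by (rule bihom_comp[OF S.p_bihom[OF E]]) (use w idem_tensor[OF K(2,4)] in simp)
  have W': "W \<in> bihom (idem_monoid A') (idem_monoid B') Z"
    using bihom_comp[OF W Z.idem_inclusion] by simp
  have W_p: "W e e' = w (p A' B' e e')" if "e \<in> idempotents A'" "e' \<in> idempotents B'" for e e'
    unfolding W_def using idem_p[OF K(2,4) that] by simp
  note fh = unital_hom_idempotents[OF f] unital_hom_closed[OF f]
  note gh = unital_hom_idempotents[OF g] unital_hom_closed[OF g]
  have f_ip: "idem_part A' (f a) = f (idem_part A a)" if "a \<in> carrier A" for a
    using unital_hom_idem_part[OF A.comm_inverse_monoid_axioms A'.comm_inverse_monoid_axioms f that] by simp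
  have W_fg: "W (f e) (g e') = h (p A B e e')" if "e \<in> idempotents A" "e' \<in> idempotents B" for e e'
    using bspec[OF eq p_idempotent[OF K(1,3) that(1) idem_sub[OF that(2)]]]
      Fp[OF idem_sub[OF that(1)] idem_sub[OF that(2)]] W_p[OF fh(1)[OF that(1)] gh(1)[OF that(2)]]
    by simp
  \<comment> \<open>For fixed \<open>b\<close>, extension along \<open>f\<close>. The value at an
    idempotent \<open>e\<close> is forced: \<open>e \<otimes> g b\<close> is idempotent, so
    \<open>g b\<close> may be replaced by its idempotent part, which is
    \<open>g (idem_part B b)\<close>.\<close>
  have "\<exists>k. k \<in> unital_hom A' Z \<and> (\<forall>a \<in> carrier A. k (f a) = h (p A B a b)) \<and>
      (\<forall>e \<in> idempotents A'. k e = W e (g (idem_part B b)))" if b: "b \<in> carrier B" for b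
  proof -
    have gb: "g (idem_part B b) \<in> idempotents B'" using b gh(1) by simp
    have wb: "(\<lambda>e. W e (g (idem_part B b))) \<in> unital_hom (idem_monoid A') (idem_monoid Z)"
      using bihom_left[OF W] gb by simp
    have hb: "(\<lambda>a. h (p A B a b)) \<in> unital_hom A Z"
      by (rule unital_hom_comp[OF T.p_left[OF K(1,3) b] h])
    have "W (f e) (g (idem_part B b)) = h (p A B e b)" if "e \<in> idempotents A" for e
      using that b by (simp add: W_fg p_idem_part_right[OF K(1,3)])
    from idem_pushoutE[OF pf Z hb wb this] show ?thesis by metis
  qed
  then obtain k where k: "\<And>b. b \<in> carrier B \<Longrightarrow> k b \<in> unital_hom A' Z"
    "\<And>a b. b \<in> carrier B \<Longrightarrow> a \<in> carrier A \<Longrightarrow> k b (f a) = h (p A B a b)"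
    "\<And>b e. b \<in> carrier B \<Longrightarrow> e \<in> idempotents A' \<Longrightarrow> k b e = W e (g (idem_part B b))"
    by metis
  have ig: "(\<lambda>b. g (idem_part B b)) \<in> unital_hom B (idem_monoid B')"
    by (rule unital_hom_comp[OF B.idem_hom unital_hom_idem_monoid[OF g]])
  \<comment> \<open>The extensions were chosen for each \<open>b\<close> independently. Each law in
    \<open>b\<close> compares two homomorphisms on \<open>A'\<close>, which agree on the image of
    \<open>f\<close> and on idempotents.\<close>
  have k_hom: "(\<lambda>b. k b x) \<in> unital_hom B Z" if x: "x \<in> carrier A'" for x
  proof (rule unital_homI)
    show "k b x \<in> carrier Z" if "b \<in> carrier B" for b
      by (rule unital_hom_closed[OF k(1)[OF that] x])
    show "k (b \<otimes>\<^bsub>B\<^esub> b') x = k b x \<otimes>\<^bsub>Z\<^esub> k b' x" if b: "b \<in> carrier B" "b' \<in> carrier B" for b b'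
    proof (rule idem_pushout_ext[OF pf Z k(1) unital_hom_pointwise_mult[OF Z.comm_monoid_axioms k(1) k(1)] _ _ x])
      show "k (b \<otimes>\<^bsub>B\<^esub> b') (f a) = k b (f a) \<otimes>\<^bsub>Z\<^esub> k b' (f a)" if "a \<in> carrier A" for a
        using that b unital_hom_mult[OF unital_hom_comp[OF T.p_right[OF K(1,3) that] h]] by (simp add: k(2))
      show "k (b \<otimes>\<^bsub>B\<^esub> b') e = k b e \<otimes>\<^bsub>Z\<^esub> k b' e" if e: "e \<in> idempotents A'" for e
        using e b unital_hom_mult[OF unital_hom_comp[OF ig bihom_right[OF W', of e]]] by (simp add: k(3))
    qed (use b in simp_all)
    show "k \<one>\<^bsub>B\<^esub> x = \<one>\<^bsub>Z\<^esub>"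
    proof (rule idem_pushout_ext[OF pf Z k(1) unital_hom_const_one[OF Z.monoid_axioms] _ _ x])
      show "k \<one>\<^bsub>B\<^esub> (f a) = \<one>\<^bsub>Z\<^esub>" if "a \<in> carrier A" for a
        using that unital_hom_one[OF unital_hom_comp[OF T.p_right[OF K(1,3) that] h]] by (simp add: k(2))
      show "k \<one>\<^bsub>B\<^esub> e = \<one>\<^bsub>Z\<^esub>" if e: "e \<in> idempotents A'" for e
        using e unital_hom_one[OF unital_hom_comp[OF ig bihom_right[OF W', of e]]] by (simp add: k(3))
    qed simp
  qed
  \<comment> \<open>For fixed \<open>x\<close> in \<open>A'\<close>, extension of
    \<open>b \<mapsto> k b x\<close> along \<open>g\<close>, with values on idempotents given by
    \<open>W\<close> at the idempotent part of \<open>x\<close>.\<close>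
  have "\<exists>l. l \<in> unital_hom B' Z \<and> (\<forall>b \<in> carrier B. l (g b) = k b x) \<and>
      (\<forall>e \<in> idempotents B'. l e = W (idem_part A' x) e)" if x: "x \<in> carrier A'" for x
  proof -
    have ix: "idem_part A' x \<in> idempotents A'" using x by simp
    have wx: "W (idem_part A' x) \<in> unital_hom (idem_monoid B') (idem_monoid Z)"
      using bihom_right[OF W] ix by simp
    \<comment> \<open>The compatibility that this second extension presupposes. Both sides are
      homomorphisms in \<open>x\<close>, so the pushout property of \<open>f\<close> reduces the
      claim to the image of \<open>f\<close> and to idempotents.\<close>
    have "W (idem_part A' x) (g e) = k e x" if e: "e \<in> idempotents B" for e
    proof (rule idem_pushout_ext[OF pf Z _ k(1) _ _ x])
      have ge: "g e \<in> idempotents B'" "e \<in> carrier B" using e gh(1) idem_sub by auto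
      then show "e \<in> carrier B" by simp
      show "(\<lambda>x. W (idem_part A' x) (g e)) \<in> unital_hom A' Z"
        by (rule unital_hom_comp[OF A'.idem_hom bihom_left[OF W']]) (use ge in simp)
      show "W (idem_part A' (f a)) (g e) = k e (f a)" if a: "a \<in> carrier A" for a
        using a e ge by (simp add: f_ip W_fg k(2) p_idem_part_left[OF K(1,3)])
      show "W (idem_part A' e') (g e) = k e e'" if "e' \<in> idempotents A'" for e'
        using that e ge by (simp add: k(3))
    qed
    from idem_pushoutE[OF pg Z k_hom[OF x] wx this] show ?thesis by metis
  qed
  then obtain l where l: "\<And>x. x \<in> carrier A' \<Longrightarrow> l x \<in> unital_hom B' Z"
    "\<And>x b. x \<in> carrier A' \<Longrightarrow> b \<in> carrier B \<Longrightarrow> l x (g b) = k b x"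
    "\<And>x e. x \<in> carrier A' \<Longrightarrow> e \<in> idempotents B' \<Longrightarrow> l x e = W (idem_part A' x) e"
    by metis
  have iW: "(\<lambda>x. W (idem_part A' x) e) \<in> unital_hom A' Z" if "e \<in> idempotents B'" for e
    by (rule unital_hom_comp[OF A'.idem_hom bihom_left[OF W']]) (use that in simp)
  have l_hom: "(\<lambda>x. l x y) \<in> unital_hom A' Z" if y: "y \<in> carrier B'" for y
  proof (rule unital_homI)
    show "l x y \<in> carrier Z" if "x \<in> carrier A'" for x
      by (rule unital_hom_closed[OF l(1)[OF that] y])
    show "l (x \<otimes>\<^bsub>A'\<^esub> x') y = l x y \<otimes>\<^bsub>Z\<^esub> l x' y" if x: "x \<in> carrier A'" "x' \<in> carrier A'" for x x'
    proof (rule idem_pushout_ext[OF pg Z l(1) unital_hom_pointwise_mult[OF Z.comm_monoid_axioms l(1) l(1)] _ _ y])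
      show "l (x \<otimes>\<^bsub>A'\<^esub> x') (g b) = l x (g b) \<otimes>\<^bsub>Z\<^esub> l x' (g b)" if "b \<in> carrier B" for b
        using that x unital_hom_mult[OF k(1)] by (simp add: l(2))
      show "l (x \<otimes>\<^bsub>A'\<^esub> x') e = l x e \<otimes>\<^bsub>Z\<^esub> l x' e" if "e \<in> idempotents B'" for e
        using that x unital_hom_mult[OF iW] by (simp add: l(3))
    qed (use x in simp_all)
    show "l \<one>\<^bsub>A'\<^esub> y = \<one>\<^bsub>Z\<^esub>"
    proof (rule idem_pushout_ext[OF pg Z l(1) unital_hom_const_one[OF Z.monoid_axioms] _ _ y])
      show "l \<one>\<^bsub>A'\<^esub> (g b) = \<one>\<^bsub>Z\<^esub>" if "b \<in> carrier B" for b
        using that unital_hom_one[OF k(1)] by (simp add: l(2))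
      show "l \<one>\<^bsub>A'\<^esub> e = \<one>\<^bsub>Z\<^esub>" if "e \<in> idempotents B'" for e
        using that unital_hom_one[OF iW] by (simp add: l(3))
    qed simp
  qed
  have "l \<in> bihom A' B' Z" unfolding bihom_def using l(1) l_hom by simp
  from T.p_lift[OF K(2,4) Z this] obtain r where r: "r \<in> unital_hom (t A' B') Z"
    "\<And>x y. x \<in> carrier A' \<Longrightarrow> y \<in> carrier B' \<Longrightarrow> r (p A' B' x y) = l x y" by blast
  show "\<exists>r \<in> unital_hom (t A' B') Z. (\<forall>x \<in> carrier (t A B). r (F x) = h x) \<and>
      (\<forall>e \<in> idempotents (t A' B'). r e = w e)"
  proof (rule bexI[OF _ r(1)], intro conjI ballI)
    fix x assume x: "x \<in> carrier (t A B)"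
    show "r (F x) = h x"
    proof (rule T.p_ext[OF K(1,3) Z unital_hom_comp[OF F r(1)] h _ x])
      fix a b assume "a \<in> carrier A" "b \<in> carrier B"
      then show "r (F (p A B a b)) = h (p A B a b)"
        using fh(2) gh(2) by (simp add: Fp r(2) l(2) k(2))
    qed
  next
    fix x assume "x \<in> idempotents (t A' B')"
    then have x: "x \<in> carrier (t' (idem_monoid A') (idem_monoid B'))"
      using idempotents_tensor[OF K(2,4)] by simp
    have r': "r \<in> unital_hom (t' (idem_monoid A') (idem_monoid B')) (idem_monoid Z)"
      using unital_hom_idem_monoid[OF r(1)] idem_tensor[OF K(2,4)] by simp
    have w': "w \<in> unital_hom (t' (idem_monoid A') (idem_monoid B')) (idem_monoid Z)"
      using w idem_tensor[OF K(2,4)] by simp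
    \<comment> \<open>Every idempotent of \<open>t A' B'\<close> lies in the semilattice tensor
      product, so it suffices to compare at pure elements of idempotents, where \<open>r\<close> was
      built from \<open>W\<close>.\<close>
    show "r x = w x"
    proof (rule S.p_ext[OF E idem_monoid_slat[OF Z] r' w' _ x])
      fix e e' assume "e \<in> carrier (idem_monoid A')" "e' \<in> carrier (idem_monoid B')"
      then have e: "e \<in> idempotents A'" "e' \<in> idempotents B'" by simp_all
      then show "r (p' (idem_monoid A') (idem_monoid B') e e') = w (p' (idem_monoid A') (idem_monoid B') e e')"
        using idem_p[OF K(2,4) e] W_p[OF e] idem_sub[OF e(1)] idem_sub[OF e(2)] e
        by (simp add: r(2) l(3))
    qed
  qed
next
  fix Z k k' x
  assume Z: "Z \<in> (cinv :: 'u monoid set)" and k: "k \<in> unital_hom (t A' B') Z" and k': "k' \<in> unital_hom (t A' B') Z"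
    and 1: "\<forall>x \<in> carrier (t A B). k (F x) = k' (F x)"
    and 2: "\<forall>e \<in> idempotents (t A' B'). k e = k' e" and x: "x \<in> carrier (t A' B')"
  note gh = unital_hom_closed[OF g]
  \<comment> \<open>Uniqueness is peeled off one variable at a time. Whenever an idempotent argument
    remains, the pure element itself is idempotent and the second hypothesis applies.\<close>
  show "k x = k' x"
  proof (rule T.p_ext[OF K(2,4) Z k k' _ x])
    fix a' b' assume a': "a' \<in> carrier A'" and b': "b' \<in> carrier B'"
    show "k (p A' B' a' b') = k' (p A' B' a' b')"
    proof (rule idem_pushout_ext[OF pg Z unital_hom_comp[OF T.p_right[OF K(2,4) a'] k]
          unital_hom_comp[OF T.p_right[OF K(2,4) a'] k'] _ _ b'])
      fix b assume b: "b \<in> carrier B"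
      show "k (p A' B' a' (g b)) = k' (p A' B' a' (g b))"
      proof (rule idem_pushout_ext[OF pf Z unital_hom_comp[OF T.p_left[OF K(2,4) gh[OF b]] k]
            unital_hom_comp[OF T.p_left[OF K(2,4) gh[OF b]] k'] _ _ a'])
        fix a assume a: "a \<in> carrier A"
        show "k (p A' B' (f a) (g b)) = k' (p A' B' (f a) (g b))"
          using 1 T.p_closed[OF K(1,3) a b] Fp[OF a b] by metis
      next
        fix e assume "e \<in> idempotents A'"
        then show "k (p A' B' e (g b)) = k' (p A' B' e (g b))"
          using 2 p_idempotent[OF K(2,4) _ gh[OF b]] by blast
      qed
    next
      fix e assume "e \<in> idempotents B'"
      then show "k (p A' B' a' e) = k' (p A' B' a' e)"
        using 2 p_idempotent'[OF K(2,4) a'] by blast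
    qed
  qed
qed

text \<open>\<open>u' \<otimes> a\<close> is the idempotent part of \<open>u \<otimes> a\<close>,
  and the left unitor preserves idempotent parts; so it sends \<open>u' \<otimes> a\<close> to the
  idempotent part of \<open>a\<close>, which is \<open>a\<close>.\<close>

lemma E_strict_lunit:
  assumes A: "A \<in> cinv" and a: "a \<in> idempotents A"
  shows "fun_of (lunit C A) (p U A u' a) = a"
proof -
  interpret A: comm_inverse_monoid A using A by (rule cinvD)
  have ac: "a \<in> carrier A" using a by (rule idem_sub)
  have "p U A u' a = idem_part (t U A) (p U A u a)"
    unfolding idem_u[symmetric] by (rule p_idem_part(2)[OF T.unit_closed A T.u_closed ac])
  then have "fun_of (lunit C A) (p U A u' a) = idem_part A (fun_of (lunit C A) (p U A u a))"
    using unital_hom_idem_part[OF cinvD[OF T.tensor_closed[OF T.unit_closed A]] cinvD[OF A]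
        T.Arr_unital_hom[OF T.Arr_simps(5)[OF A] src_tgt_on(9) src_tgt_on(10)]
        T.p_closed[OF T.unit_closed A T.u_closed ac]] by simp
  then show ?thesis using T.lunit_apply[OF A ac] a by simp
qed

lemma E_strict_runit:
  assumes A: "A \<in> cinv" and a: "a \<in> idempotents A"
  shows "fun_of (runit C A) (p A U a u') = a"
proof -
  interpret A: comm_inverse_monoid A using A by (rule cinvD)
  have ac: "a \<in> carrier A" using a by (rule idem_sub)
  have "p A U a u' = idem_part (t A U) (p A U a u)"
    unfolding idem_u[symmetric] by (rule p_idem_part(1)[OF A T.unit_closed ac T.u_closed])
  then have "fun_of (runit C A) (p A U a u') = idem_part A (fun_of (runit C A) (p A U a u))"
    using unital_hom_idem_part[OF cinvD[OF T.tensor_closed[OF A T.unit_closed]] cinvD[OF A]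
        T.Arr_unital_hom[OF T.Arr_simps(6)[OF A] src_tgt_on(11) src_tgt_on(12)]
        T.p_closed[OF A T.unit_closed ac T.u_closed]] by simp
  then show ?thesis using T.runit_apply[OF A ac] a by simp
qed

lemma p'_E:
  "A \<in> cinv \<Longrightarrow> B \<in> cinv \<Longrightarrow> e \<in> idempotents A \<Longrightarrow> f \<in> idempotents B \<Longrightarrow>
    p' (idem_monoid A) (idem_monoid B) e f = p A B e f \<and> p A B e f \<in> idempotents (t A B)"
  by (intro conjI idem_p p_idempotent idem_sub)

text \<open>Both sides of each equation of arrows start at a tensor product of semilattices. They
  are compared at its pure elements, which are also pure elements of the tensor product over
  \<open>cinv\<close>, where the structure maps of \<open>C\<close> can be evaluated.\<close>

lemma strict_monoidal_functor_E: "strict_monoidal_functor C S E"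
proof (intro strict_monoidal_functor.intro strict_monoidal_functor_axioms.intro
    T.monoidal_category_axioms S.monoidal_category_axioms is_functor_E)
  fix A B assume "A \<in> Obj C" "B \<in> Obj C"
  then show "obj_map E (ten_obj C A B) = ten_obj S (obj_map E A) (obj_map E B)"
    using idem_tensor by simp
next
  fix f g assume f: "f \<in> Arr C" and g: "g \<in> Arr C"
  note K = Arr_src[OF f] Arr_tgt[OF f] Arr_src[OF g] Arr_tgt[OF g]
  note fE = E_Arr[OF f] fun_of_idempotents[OF f] and gE = E_Arr[OF g] fun_of_idempotents[OF g]
  show "arr_map E (ten_arr C f g) = ten_arr S (arr_map E f) (arr_map E g)"
  proof (rule S.Arr_eq_tensor[of _ _ "idem_monoid (src f)" "idem_monoid (src g)"])
    fix a b assume "a \<in> carrier (idem_monoid (src f))" "b \<in> carrier (idem_monoid (src g))"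
    then have a: "a \<in> idempotents (src f)" and b: "b \<in> idempotents (src g)" by simp_all
    have "fun_of (ten_arr S (arr_map E f) (arr_map E g)) (p' (idem_monoid (src f)) (idem_monoid (src g)) a b) =
        p' (idem_monoid (tgt f)) (idem_monoid (tgt g)) (fun_of f a) (fun_of g b)"
      using fE(1) gE(1) a b by simp
    also have "\<dots> = p (tgt f) (tgt g) (fun_of f a) (fun_of g b)"
      using p'_E[OF K(2,4) fE(2)[OF a] gE(2)[OF b]] by simp
    also have "\<dots> = fun_of (ten_arr C f g) (p (src f) (src g) a b)"
      using f g idem_sub[OF a] idem_sub[OF b] by simp
    finally show "fun_of (arr_map E (ten_arr C f g)) (p' (idem_monoid (src f)) (idem_monoid (src g)) a b) =
        fun_of (ten_arr S (arr_map E f) (arr_map E g)) (p' (idem_monoid (src f)) (idem_monoid (src g)) a b)"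
      using p'_E[OF K(1,3) a b] by simp
  qed (use E_Arr[OF T.Arr_simps(3)[OF f g]] S.Arr_simps(3)[OF fE(1) gE(1)] idem_tensor[OF K(1,3)] idem_tensor[OF K(2,4)]
      idem_monoid_slat[OF K(1)] idem_monoid_slat[OF K(3)] in \<open>simp_all del: mem_Collect_eq\<close>)
next
  show "obj_map E (ten_unit C) = ten_unit S" by (simp add: idem_U)
next
  fix A B D assume "A \<in> Obj C" "B \<in> Obj C" "D \<in> Obj C"
  then have K: "A \<in> cinv" "B \<in> cinv" "D \<in> cinv" by simp_all
  note KE = idem_monoid_slat[OF K(1)] idem_monoid_slat[OF K(2)] idem_monoid_slat[OF K(3)]
  note KT = T.tensor_closed[OF K(1,2)] T.tensor_closed[OF K(2,3)]
  have "arr_map E (assoc C A B D) = assoc S (idem_monoid A) (idem_monoid B) (idem_monoid D)"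
  proof (rule S.Arr_eq_left[of _ _ "idem_monoid A" "idem_monoid B" "idem_monoid D"])
    fix a b d assume "a \<in> carrier (idem_monoid A)" "b \<in> carrier (idem_monoid B)" "d \<in> carrier (idem_monoid D)"
    then have a: "a \<in> idempotents A" and b: "b \<in> idempotents B" and d: "d \<in> idempotents D" by simp_all
    let ?x = "p' (t' (idem_monoid A) (idem_monoid B)) (idem_monoid D) (p' (idem_monoid A) (idem_monoid B) a b) d"
    note ab = p'_E[OF K(1,2) a b] and bd = p'_E[OF K(2,3) b d]
    note abd = p'_E[OF KT(1) K(3) conjunct2[OF ab] d] and abd' = p'_E[OF K(1) KT(2) a conjunct2[OF bd]]
    have x: "?x = p (t A B) D (p A B a b) d" "?x \<in> idempotents (t (t A B) D)"
      using ab abd idem_tensor[OF K(1,2)] by simp_all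
    have "fun_of (assoc S (idem_monoid A) (idem_monoid B) (idem_monoid D)) ?x =
        p' (idem_monoid A) (t' (idem_monoid B) (idem_monoid D)) a (p' (idem_monoid B) (idem_monoid D) b d)"
      using KE a b d by (simp del: mem_Collect_eq)
    also have "\<dots> = p A (t B D) a (p B D b d)"
      using bd abd' idem_tensor[OF K(2,3)] by simp
    also have "\<dots> = fun_of (assoc C A B D) ?x"
      using K idem_sub[OF a] idem_sub[OF b] idem_sub[OF d] by (simp add: x(1) del: mem_Collect_eq)
    finally show "fun_of (arr_map E (assoc C A B D)) ?x =
        fun_of (assoc S (idem_monoid A) (idem_monoid B) (idem_monoid D)) ?x"
      using x(2) by simp
  qed (use E_Arr[OF T.Arr_simps(4)[OF K]] S.Arr_simps(4)[OF KE] KE K idem_tensor[OF K(1,2)] idem_tensor[OF K(2,3)]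
      idem_tensor[OF KT(1) K(3)] idem_tensor[OF K(1) KT(2)] in \<open>simp_all del: mem_Collect_eq\<close>)
  then show "arr_map E (assoc C A B D) = assoc S (obj_map E A) (obj_map E B) (obj_map E D)" by simp
next
  fix A assume "A \<in> Obj C"
  then have K: "A \<in> cinv" by simp
  have u: "u' \<in> idempotents U" using S.u_closed unfolding idem_U[symmetric] carrier_idem_monoid .
  have "arr_map E (lunit C A) = lunit S (idem_monoid A)"
  proof (rule S.Arr_eq_lunit[of _ _ "idem_monoid A"])
    fix a assume "a \<in> carrier (idem_monoid A)"
    then have a: "a \<in> idempotents A" by simp
    have "p' U' (idem_monoid A) u' a = p U A u' a \<and> p U A u' a \<in> idempotents (t U A)"
      using p'_E[OF T.unit_closed K u a] idem_U by simp
    then show "fun_of (arr_map E (lunit C A)) (p' U' (idem_monoid A) u' a) =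
        fun_of (lunit S (idem_monoid A)) (p' U' (idem_monoid A) u' a)"
      using E_strict_lunit[OF K a] S.lunit_apply[OF idem_monoid_slat[OF K], of a] a by simp
  qed (use E_Arr[OF T.Arr_simps(5)[OF K]] S.Arr_simps(5)[OF idem_monoid_slat[OF K]] idem_monoid_slat[OF K]
      idem_tensor[OF T.unit_closed K] idem_U in \<open>simp_all del: mem_Collect_eq\<close>)
  then show "arr_map E (lunit C A) = lunit S (obj_map E A)" by simp
  have "arr_map E (runit C A) = runit S (idem_monoid A)"
  proof (rule S.Arr_eq_runit[of _ _ "idem_monoid A"])
    fix a assume "a \<in> carrier (idem_monoid A)"
    then have a: "a \<in> idempotents A" by simp
    have "p' (idem_monoid A) U' a u' = p A U a u' \<and> p A U a u' \<in> idempotents (t A U)"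
      using p'_E[OF K T.unit_closed a u] idem_U by simp
    then show "fun_of (arr_map E (runit C A)) (p' (idem_monoid A) U' a u') =
        fun_of (runit S (idem_monoid A)) (p' (idem_monoid A) U' a u')"
      using E_strict_runit[OF K a] S.runit_apply[OF idem_monoid_slat[OF K], of a] a by simp
  qed (use E_Arr[OF T.Arr_simps(6)[OF K]] S.Arr_simps(6)[OF idem_monoid_slat[OF K]] idem_monoid_slat[OF K]
      idem_tensor[OF K T.unit_closed] idem_U in \<open>simp_all del: mem_Collect_eq\<close>)
  then show "arr_map E (runit C A) = runit S (obj_map E A)" by simp
qed

lemma monoidal_opfibration_E:
  assumes "infinite (UNIV :: 'u set)"
  shows "monoidal_opfibration C S E"
proof (intro monoidal_opfibration.intro monoidal_opfibration_axioms.intro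
    strict_monoidal_functor_E opfibration_E assms)
  fix f g assume "opcartesian C S E f" "opcartesian C S E g"
  then have f: "f \<in> Arr C" "idem_pushout (src f) (tgt f) (fun_of f)"
    and g: "g \<in> Arr C" "idem_pushout (src g) (tgt g) (fun_of g)"
    by (simp_all only: opcartesian_E_iff)
  note fg = T.Arr_simps(3)[OF f(1) g(1)]
  have "idem_pushout (t (src f) (src g)) (t (tgt f) (tgt g)) (fun_of (ten_arr C f g))"
    by (rule idem_pushout_tensor[OF Arr_src[OF f(1)] Arr_tgt[OF f(1)] Arr_src[OF g(1)] Arr_tgt[OF g(1)]
          Arr_hom[OF f(1)] Arr_hom[OF g(1)] f(2) g(2)])
      (use T.Arr_unital_hom[OF fg] T.ten_arr_apply[OF f(1) g(1)] in simp_all)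
  then show "opcartesian C S E (ten_arr C f g)"
    using fg by (simp add: opcartesian_E_iff)
qed

end

lemma CInvMon_eq:
  "CInvMon = tensor_category_on cinv (copy (encode int0) int0) (encode int0 (Some 1))
    (\<lambda>A B. copy (encode (ten_quot A B)) (ten_quot A B))
    (\<lambda>A B a b. encode (ten_quot A B) (ten_class A B {#(a, b)#}))"
  unfolding CInvMon_def tensor_category_eq tensor_def[abs_def] pure_def[abs_def] small_copy_eq_copy ..

lemma SLat_eq:
  "SLat = tensor_category_on slat (small_copy free_slat) (encode free_slat True) tensor pure"
  unfolding SLat_def tensor_category_eq ..

text \<open>The isomorphism is \<open>\<rho>\<close>, with inverse induced by the inclusions of
  idempotents. Following \<open>\<rho>\<close> by the encoding that \<open>tensor\<close> itself
  uses makes the idempotents of the copy equal to the tensor product already fixed in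
  \<open>SLat\<close>.\<close>

lemma ex_strict_tensor:
  fixes A B :: "'u monoid"
  assumes unc: "uncountable (UNIV :: 'u set)" and K: "A \<in> cinv" "B \<in> cinv"
  shows "\<exists>e :: _ \<Rightarrow> 'u. inj_on e (carrier (ten_quot A B)) \<and>
    (\<forall>a \<in> idempotents A. \<forall>b \<in> idempotents B.
      e (ten_class A B {#(a, b)#}) = pure (idem_monoid A) (idem_monoid B) a b) \<and>
    idem_monoid (copy e (ten_quot A B)) = tensor (idem_monoid A) (idem_monoid B)"
proof -
  let ?EA = "idem_monoid A" and ?EB = "idem_monoid B"
  let ?Q = "ten_quot A B" and ?Q' = "ten_quot ?EA ?EB"
  have inf: "infinite (UNIV :: 'u set)" using unc countable_finite by blast
  interpret A: comm_inverse_monoid A using K(1) by (rule cinvD)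
  interpret B: comm_inverse_monoid B using K(2) by (rule cinvD)
  interpret EA: comm_monoid ?EA by (rule semilattice_comm_monoid[OF A.semilattice_idem_monoid])
  interpret EB: comm_monoid ?EB by (rule semilattice_comm_monoid[OF B.semilattice_idem_monoid])
  interpret P: tensor_pair A B ..
  interpret P': tensor_pair ?EA ?EB ..
  interpret Q: comm_inverse_monoid ?Q
    by (rule comm_inverse_monoid_ten_quot[OF A.comm_inverse_monoid_axioms B.comm_inverse_monoid_axioms])
  have Q'_slat: "semilattice_monoid ?Q'"
    by (rule semilattice_monoid_ten_quot[OF A.semilattice_idem_monoid B.semilattice_idem_monoid])
  interpret Q': comm_monoid ?Q' by (rule semilattice_comm_monoid[OF Q'_slat])
  have small: "small_monoid A" "small_monoid B" "small_monoid ?EA" "small_monoid ?EB"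
    using K small_idem_monoid by auto
  have lQ: "carrier ?Q \<prec> (UNIV :: 'u set)"
    by (rule ten_quot_lesspoll[OF unc A.comm_monoid_axioms B.comm_monoid_axioms small(1,2)])
  have lQ': "carrier ?Q' \<prec> (UNIV :: 'u set)"
    by (rule ten_quot_lesspoll[OF unc EA.comm_monoid_axioms EB.comm_monoid_axioms small(3,4)])
  let ?enc = "encode ?Q' :: _ \<Rightarrow> 'u"
  have enc: "inj_on ?enc (carrier ?Q')"
    by (rule inj_on_encode[OF lesspoll_imp_lepoll[OF lQ']])
  obtain \<rho> where \<rho>: "\<rho> \<in> unital_hom ?Q ?Q'"
    "\<And>a b. a \<in> carrier A \<Longrightarrow> b \<in> carrier B \<Longrightarrow> \<rho> (P.gen a b) = P'.gen (idem_part A a) (idem_part B b)"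
    using P.ten_quot_lift[OF Q'.comm_monoid_axioms bihom_precomp[OF P'.gen_bihom A.idem_hom B.idem_hom]]
    by metis
  obtain \<iota> where \<iota>: "\<iota> \<in> unital_hom ?Q' ?Q"
    "\<And>a b. a \<in> idempotents A \<Longrightarrow> b \<in> idempotents B \<Longrightarrow> \<iota> (P'.gen a b) = P.gen a b"
    using P'.ten_quot_lift[OF Q.comm_monoid_axioms bihom_precomp[OF P.gen_bihom A.idem_inclusion B.idem_inclusion]]
    by (metis carrier_idem_monoid)
  have \<rho>\<iota>: "\<rho> (\<iota> x) = x" if "x \<in> carrier ?Q'" for x
    by (rule P'.ten_quot_hom_ext[OF unital_hom_comp[OF \<iota>(1) \<rho>(1)] unital_hom_id _ that])
      (simp add: \<iota>(2) \<rho>(2) A.idempotents_closed B.idempotents_closed)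
  have \<iota>\<rho>: "\<iota> (\<rho> x) = x" if "x \<in> idempotents ?Q" for x
  proof -
    \<comment> \<open>On the whole of \<open>?Q\<close> the composite is the idempotent part, as
      both are homomorphisms with equal values on generators. It therefore fixes exactly what is
      needed, the idempotents.\<close>
    have "\<iota> (\<rho> x) = idem_part ?Q x"
    proof (rule P.ten_quot_hom_ext[OF unital_hom_comp[OF \<rho>(1) \<iota>(1)]
          unital_hom_comp[OF Q.idem_hom Q.idem_inclusion] _ Q.idempotents_closed[OF that]])
      fix a b assume ab: "a \<in> carrier A" "b \<in> carrier B"
      then show "\<iota> (\<rho> (P.gen a b)) = idem_part ?Q (P.gen a b)"
        using bihom_idem_part(3)[OF A.comm_inverse_monoid_axioms B.comm_inverse_monoid_axioms
            Q.comm_inverse_monoid_axioms P.gen_bihom ab]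
        by (simp add: \<rho>(2) \<iota>(2))
    qed
    then show ?thesis using that by simp
  qed
  have "bij_betw \<rho> (idempotents ?Q) (carrier ?Q')"
  proof (rule bij_betw_byWitness[where f' = \<iota>])
    show "\<rho> ` idempotents ?Q \<subseteq> carrier ?Q'"
      using unital_hom_closed[OF \<rho>(1)] Q.idempotents_closed by blast
    have "x \<in> idempotents ?Q'" if "x \<in> carrier ?Q'" for x
      using Q'_slat that by (simp add: semilattice_monoid_def idempotents_def)
    then show "\<iota> ` carrier ?Q' \<subseteq> idempotents ?Q"
      using unital_hom_idempotents[OF \<iota>(1)] by blast
  qed (use \<rho>\<iota> \<iota>\<rho> in auto)
  moreover have "bij_betw ?enc (carrier ?Q') (carrier (copy ?enc ?Q'))"
    using enc by (simp add: bij_betw_def)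
  ultimately have "bij_betw (?enc \<circ> \<rho>) (idempotents ?Q) (carrier (copy ?enc ?Q'))"
    by (rule bij_betw_trans)
  then have bij: "bij_betw (\<lambda>x. ?enc (\<rho> x)) (idempotents ?Q) (carrier (copy ?enc ?Q'))"
    by (simp only: comp_def)
  have hom: "(\<lambda>x. ?enc (\<rho> x)) \<in> unital_hom (idem_monoid ?Q) (copy ?enc ?Q')"
    by (rule unital_hom_comp[OF unital_hom_comp[OF Q.idem_inclusion \<rho>(1)] copy_hom[OF enc]])
  obtain e where e: "inj_on e (carrier ?Q)" "\<And>x. x \<in> idempotents ?Q \<Longrightarrow> e x = ?enc (\<rho> x)"
    "idem_monoid (copy e ?Q) = copy ?enc ?Q'"
    using strict_copy[OF Q.comm_inverse_monoid_axioms lQ inf small_monoid_copy[OF lQ'] hom bij] by metis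
  have "e (P.gen a b) = pure ?EA ?EB a b" if ab: "a \<in> idempotents A" "b \<in> idempotents B" for a b
  proof -
    have c: "a \<in> carrier A" "b \<in> carrier B"
      using ab A.idempotents_closed B.idempotents_closed by auto
    have "P.gen a b \<in> idempotents ?Q"
      by (rule unital_hom_idempotents[OF bihom_left[OF P.gen_bihom c(2)] ab(1)])
    then show ?thesis using ab c by (simp add: e(2) \<rho>(2) pure_def)
  qed
  then show ?thesis
    using e(1,3) by (auto simp: tensor_def small_copy_eq_copy)
qed

lemma idem_part_int0: "idem_part int0 (Some 1) = Some 0"
proof -
  interpret comm_inverse_monoid int0 by (rule comm_inverse_monoid_int0)
  have "star int0 (Some 1) = Some (- 1)" by (rule star_eqI) simp_all
  then show ?thesis by (simp add: idem_part_def)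
qed

lemma ex_strict_unit:
  assumes unc: "uncountable (UNIV :: 'u set)"
  shows "\<exists>i :: int option \<Rightarrow> 'u. inj i \<and> idem_monoid (copy i int0) = small_copy free_slat \<and>
    idem_part (copy i int0) (i (Some 1)) = encode free_slat True"
proof -
  interpret comm_inverse_monoid int0 by (rule comm_inverse_monoid_int0)
  have inf: "infinite (UNIV :: 'u set)" using unc countable_finite by blast
  have l: "carrier int0 \<prec> (UNIV :: 'u set)" "carrier free_slat \<prec> (UNIV :: 'u set)"
    using unc by (auto intro!: countable_lesspoll_uncountable)
  let ?enc = "encode free_slat :: bool \<Rightarrow> 'u"
  have enc: "inj_on ?enc (carrier free_slat)"
    by (rule inj_on_encode[OF lesspoll_imp_lepoll[OF l(2)]])
  \<comment> \<open>The idempotents \<open>None\<close> and \<open>Some 0\<close> of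
    \<open>int0\<close> go to \<open>False\<close> and \<open>True\<close>. The idempotent part
    \<open>Some 0\<close> of the generator thus becomes the generator of the free
    semilattice.\<close>
  let ?\<sigma> = "\<lambda>x :: int option. ?enc (x \<noteq> None)"
  have "bij_betw ?\<sigma> (idempotents int0) (carrier (copy ?enc free_slat))"
  proof (rule bij_betw_imageI)
    show "inj_on ?\<sigma> (idempotents int0)"
      using enc by (auto simp: idempotents_int0 inj_on_def)
    show "?\<sigma> ` idempotents int0 = carrier (copy ?enc free_slat)"
      by (auto simp: idempotents_int0 UNIV_bool)
  qed
  moreover have "?\<sigma> \<in> unital_hom (idem_monoid int0) (copy ?enc free_slat)"
    by (rule unital_hom_comp[OF _ copy_hom[OF enc]], rule unital_homI)
      (auto simp: idempotents_int0)
  ultimately obtain i where i: "inj_on i (carrier int0)" "\<And>x. x \<in> idempotents int0 \<Longrightarrow> i x = ?\<sigma> x"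
    "idem_monoid (copy i int0) = copy ?enc free_slat"
    using strict_copy[OF comm_inverse_monoid_int0 l(1) inf small_monoid_copy[OF l(2)]] by metis
  have "idem_part (copy i int0) (i (Some 1)) = i (idem_part int0 (Some 1))"
    by (rule unital_hom_idem_part[OF comm_inverse_monoid_int0
          comm_inverse_monoid_copy[OF comm_inverse_monoid_int0 i(1)] copy_hom[OF i(1)], symmetric]) simp
  then show ?thesis
    using i by (intro exI[of _ i]) (simp add: idem_part_int0 small_copy_eq_copy idempotents_int0)
qed

lemma (in category) natural_iso_id: "natural_iso C C id_ftr id_ftr (Id C)"
proof -
  have "Id C x \<in> Isoset C x x" if "x \<in> Obj C" for x
    using Id_in_Homset[OF that] Comp_Id[OF Id_in_Homset[OF that]]
    by (auto simp: Isoset_def is_iso_def Homset_def)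
  moreover have "Id C (Cod C f) \<cdot> f = f \<cdot> Id C (Dom C f)" if "f \<in> Arr C" for f
    using Comp_Id[of f "Dom C f" "Cod C f"] Id_Comp[of f "Dom C f" "Cod C f"] that
    by (simp add: Homset_def)
  ultimately show ?thesis by (simp add: natural_iso_def id_ftr_def)
qed

text \<open>Stated for two records \<open>T\<close> and \<open>C\<close>, since the strict category
  and \<open>CInvMon\<close> share their underlying category but differ as monoidal categories. That
  the identity is a functor in both directions expresses the sharing.\<close>

lemma equivalence_over_id:
  assumes P: "is_functor T B P" and Q: "is_functor C B P"
    and F: "is_functor T C id_ftr" and G: "is_functor C T id_ftr"
  shows "equivalence_over B T P C P id_ftr"
proof -
  interpret P: is_functor T B P by fact
  interpret Q: is_functor C B P by fact
  have comp: "comp_ftr id_ftr id_ftr = id_ftr" "comp_ftr P id_ftr = P"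
    by (simp_all add: comp_ftr_def id_ftr_def comp_def)
  show ?thesis
    unfolding equivalence_over_def
  proof (intro conjI P Q F, goal_cases)
    case 1
    show ?case by (simp add: comp ftr_eq_def)
  next
    case 2
    show ?case
    proof (rule exI[of _ id_ftr], rule exI[of _ "Id T"], rule exI[of _ "Id C"], intro conjI ballI G)
      show "natural_iso T T id_ftr (comp_ftr id_ftr id_ftr) (Id T)"
        unfolding comp by (rule P.dom.natural_iso_id)
      show "natural_iso C C (comp_ftr id_ftr id_ftr) id_ftr (Id C)"
        unfolding comp by (rule Q.dom.natural_iso_id)
    qed (simp_all add: comp ftr_eq_def P.arr_map_Id Q.arr_map_Id)
  qed
qed

theorem theorem5p8:
  assumes "uncountable (UNIV :: 'u set)"
  shows "opfibration CInvMon SLat (E :: ('u monoid, 'u mon_arr, 'u monoid, 'u mon_arr) ftr) \<and>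
    (\<exists>(T :: ('u monoid, 'u mon_arr) monoidal_cat)
      (P :: ('u monoid, 'u mon_arr, 'u monoid, 'u mon_arr) ftr)
      (F :: ('u monoid, 'u mon_arr, 'u monoid, 'u mon_arr) ftr) \<phi> \<phi>\<^sub>0.
       monoidal_opfibration T SLat P \<and>
       equivalence_over SLat T P CInvMon E F \<and>
       strong_monoidal_functor T CInvMon F \<phi> \<phi>\<^sub>0)"
proof -
  have inf: "infinite (UNIV :: 'u set)" using assms countable_finite by blast
  \<comment> \<open>One encoding for each pair must be fixed simultaneously; the membership
    condition sits inside the existential so that the axiom of choice yields a total
    function.\<close>
  have "\<forall>A B :: 'u monoid. \<exists>e :: _ \<Rightarrow> 'u. A \<in> cinv \<and> B \<in> cinv \<longrightarrow>
      inj_on e (carrier (ten_quot A B)) \<and>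
      (\<forall>a \<in> idempotents A. \<forall>b \<in> idempotents B.
        e (ten_class A B {#(a, b)#}) = pure (idem_monoid A) (idem_monoid B) a b) \<and>
      idem_monoid (copy e (ten_quot A B)) = tensor (idem_monoid A) (idem_monoid B)"
    using ex_strict_tensor[OF assms] by blast
  then obtain e :: "'u monoid \<Rightarrow> 'u monoid \<Rightarrow> _ \<Rightarrow> 'u" where e: "\<forall>A B. A \<in> cinv \<and> B \<in> cinv \<longrightarrow>
      inj_on (e A B) (carrier (ten_quot A B)) \<and>
      (\<forall>a \<in> idempotents A. \<forall>b \<in> idempotents B.
        e A B (ten_class A B {#(a, b)#}) = pure (idem_monoid A) (idem_monoid B) a b) \<and>
      idem_monoid (copy (e A B) (ten_quot A B)) = tensor (idem_monoid A) (idem_monoid B)"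
    unfolding choice_iff by blast
  obtain i :: "int option \<Rightarrow> 'u" where i: "inj i" "idem_monoid (copy i int0) = small_copy free_slat"
    "idem_part (copy i int0) (i (Some 1)) = encode free_slat True"
    using ex_strict_unit[OF assms] by blast
  let ?t = "\<lambda>A B. copy (e A B) (ten_quot A B)" and ?p = "\<lambda>A B a b. e A B (ten_class A B {#(a, b)#})"
  interpret T: tensor_structure cinv "copy i int0" "i (Some 1)" ?t ?p
    by (rule tensor_structure_cinv[OF assms _ i(1)]) (use e in blast)
  interpret S: tensor_structure slat "small_copy free_slat :: 'u monoid" "encode free_slat True" tensor pure
    by (rule tensor_structure_slat[OF assms])
  interpret strict_tensor_structure "copy i int0" "i (Some 1)" ?t ?p
    "small_copy free_slat :: 'u monoid" "encode free_slat True" tensor pure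
    by unfold_locales (use e i in auto)
  let ?U = "copy (encode int0) int0 :: 'u monoid" and ?u = "encode int0 (Some 1) :: 'u"
  let ?t' = "\<lambda>A B. copy (encode (ten_quot A B)) (ten_quot A B) :: 'u monoid"
  let ?p' = "\<lambda>A B a b. encode (ten_quot A B) (ten_class A B {#(a, b)#}) :: 'u"
  interpret M: tensor_structure cinv ?U ?u ?t' ?p'
  proof (rule tensor_structure_cinv[OF assms])
    show "inj_on (encode (ten_quot A B) :: _ \<Rightarrow> 'u) (carrier (ten_quot A B))"
      if "A \<in> cinv" "B \<in> cinv" for A B :: "'u monoid"
      using that ten_quot_lesspoll[OF assms] cinv_comm_monoid
      by (intro inj_on_encode lesspoll_imp_lepoll) auto
    have "carrier int0 \<lesssim> (UNIV :: 'u set)"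
      using assms by (intro lesspoll_imp_lepoll countable_lesspoll_uncountable) auto
    from inj_on_encode[OF this] show "inj (encode int0 :: _ \<Rightarrow> 'u)" by simp
  qed
  \<comment> \<open>\<open>TM\<close> supplies the strong monoidal identity functor from the strict
    structure to \<open>CInvMon\<close>; \<open>MT\<close> supplies the identity functor back, for
    the equivalence.\<close>
  interpret TM: tensor_comparison cinv "copy i int0" "i (Some 1)" ?t ?p ?U ?u ?t' ?p' ..
  interpret MT: tensor_comparison cinv ?U ?u ?t' ?p' "copy i int0" "i (Some 1)" ?t ?p ..
  interpret M: idem_functor ?U ?u ?t' ?p' "small_copy free_slat :: 'u monoid" "encode free_slat True" tensor pure .
  note eqs = CInvMon_eq[symmetric] SLat_eq[symmetric]
  have "opfibration CInvMon SLat (E :: ('u monoid, 'u mon_arr, 'u monoid, 'u mon_arr) ftr)"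
    using M.opfibration_E[OF inf] unfolding eqs .
  moreover have "monoidal_opfibration T.V SLat E"
    using monoidal_opfibration_E[OF inf] unfolding eqs .
  moreover have "equivalence_over SLat T.V E CInvMon E id_ftr"
    using equivalence_over_id[OF is_functor_E M.is_functor_E TM.is_functor_id MT.is_functor_id]
    unfolding eqs .
  moreover have "strong_monoidal_functor T.V CInvMon id_ftr TM.comparison TM.unit_comparison"
    using TM.strong_monoidal_functor_id unfolding eqs .
  ultimately show ?thesis by blast
qed

end
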